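(* Fix $U_+,U_-\subset\mathbb{Z}$ such that $U_+\cap U_-=\varnothing$, $1\le N:=|U_+|+|U_-|<\infty$, and $U_+\cup U_-$ is simply connected. For any integer $p\ge 2$, there are $\epsilon_0>0$ and $\delta>0$ such that for any fixed $\epsilon\in(0,\epsilon_0)$ the resolvent operator $$R(\Omega)=(H_\epsilon-\Omega)^{-1}:\ l^2(\mathbb{Z})\times l^2(\mathbb{Z})\to l^2(\mathbb{Z})\times l^2(\mathbb{Z})$$ is bounded for any $\Omega\in\mathbb{C}$ with $\Omega\notin B_\delta(0)\cup[1,1+4\epsilon]\cup[-1-4\epsilon,-1]$. Moreover, $R(\Omega)$ has exactly $2N$ poles (counting multiplicities) inside $B_\delta(0)$ and admits the limits $$R^{\pm}(\Omega):=\lim_{\mu\downarrow0}R(\Omega\pm i\mu)$$ such that for any $\Omega\in[1,1+4\epsilon]\cup[-1-4\epsilon,-1]$ and any $\epsilon\in(0,\epsilon_0)$, there is $C>0$ such that $$\|R^{\pm}(\Omega)\|_{l^1_1\times l^1_1\to l^\infty\times l^\infty}\le C\epsilon^{-1}.$$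
   Context: Sequences are bi-infinite. $l^q_s(\mathbb{Z})$ is the space of sequences $u$ with $\{(1+n^2)^{s/2}u_n\}_{n\in\mathbb{Z}}\in l^q(\mathbb{Z})$, with the corresponding norm. $B_\delta(\lambda_0)\subset\mathbb{C}$ is the disk of radius $\delta$ centered at $\lambda_0$. A set $U_+\cup U_-\subset\mathbb{Z}$ is called simply connected if no element of $\mathbb{Z}\setminus(U_+\cup U_-)$ is located between elements of $U_+\cup U_-$ (i.e. it is a set of consecutive integers). Discrete soliton: let $\phi^{(0)}\in l^2(\mathbb{Z})$ be given by $\phi^{(0)}_n=1$ for $n\in U_+$, $\phi^{(0)}_n=-1$ for $n\in U_-$, and $\phi^{(0)}_n=0$ otherwise. It is known that for all sufficiently small $|\epsilon|$ the equation $$(1-\phi_n^{2p})\phi_n=\epsilon(\phi_{n+1}-2\phi_n+\phi_{n-1}),\quad n\in\mathbb{Z},$$ has a unique real solution $\phi=\phi(\epsilon)\in l^2(\mathbb{Z})$ near $\phi^{(0)}$; the map $\epsilon\mapsto\phi\in l^2(\mathbb{Z})$ is analytic, $\|\phi-\phi^{(0)}\|_{l^2}\le C|\epsilon|$, and $|\phi_n|\le Ce^{-\kappa|n|}$ for all $n$, with some $C,\kappa>0$ independent of $\epsilon$. ($\epsilon_0$ in the claim is taken small enough that this $\phi$ is defined.) Let $(\Delta u)_n=u_{n+1}-2u_n+u_{n-1}$ and let $\Phi$ be the multiplication operator $(\Phi u)_n=\phi_n^{2p}u_n$. The operator $H_\epsilon$ on $l^2(\mathbb{Z})\times l^2(\mathbb{Z})$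 is $$H_\epsilon=\begin{bmatrix}-\epsilon\Delta+I-(1+p)\Phi & -p\Phi\\ p\Phi & \epsilon\Delta-I+(1+p)\Phi\end{bmatrix}.$$ (It is the linearized operator of the discrete nonlinear Schrödinger equation $i\dot u_n+\epsilon(u_{n+1}-2u_n+u_{n-1})+|u_n|^{2p}u_n=0$ at $u_n=\phi_ne^{it}$.) Poles of $R(\Omega)$ are the isolated eigenvalues of $H_\epsilon$ and are counted with algebraic multiplicity. The limits $R^\pm(\Omega)$ are understood as: for every $(f,g)\in l^1_1\times l^1_1$, each component of $R(\Omega\pm i\mu)(f,g)$ converges as $\mu\downarrow0$, and the limit sequence defines $R^\pm(\Omega)(f,g)$. *)

theory Defs
  imports "HOL-Analysis.Analysis" "HOL-Library.Function_Algebras"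
begin

definition lq_weight :: "real \<Rightarrow> int \<Rightarrow> real" where
  "lq_weight s n = (1 + (real_of_int n)\<^sup>2) powr (s / 2)"

definition lq_space :: "real \<Rightarrow> real \<Rightarrow> (int \<Rightarrow> 'a::real_normed_vector) set" where
  "lq_space q s = {u. (\<lambda>n. (lq_weight s n * norm (u n)) powr q) summable_on UNIV}"

definition lq_norm :: "real \<Rightarrow> real \<Rightarrow> (int \<Rightarrow> 'a::real_normed_vector) \<Rightarrow> real" where
  "lq_norm q s u = (\<Sum>\<^sub>\<infinity>n. (lq_weight s n * norm (u n)) powr q) powr (1 / q)"

definition linf_space :: "(int \<Rightarrow> 'a::real_normed_vector) set" where
  "linf_space = {u. bounded (range u)}"

definition linf_norm :: "(int \<Rightarrow> 'a::real_normed_vector) \<Rightarrow> real" where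
  "linf_norm u = (SUP n. norm (u n))"

type_synonym seq2 = "(int \<Rightarrow> complex) \<times> (int \<Rightarrow> complex)"

definition lq2_space :: "real \<Rightarrow> real \<Rightarrow> seq2 set" where
  "lq2_space q s = lq_space q s \<times> lq_space q s"

definition lq2_norm :: "real \<Rightarrow> real \<Rightarrow> seq2 \<Rightarrow> real" where
  "lq2_norm q s x = (lq_norm q s (fst x) powr q + lq_norm q s (snd x) powr q) powr (1 / q)"

definition linf2_space :: "seq2 set" where
  "linf2_space = linf_space \<times> linf_space"

definition linf2_norm :: "seq2 \<Rightarrow> real" where
  "linf2_norm x = max (linf_norm (fst x)) (linf_norm (snd x))"

abbreviation l2_pairs :: "seq2 set" where
  "l2_pairs \<equiv> lq2_space 2 0"

definition seq2_scale :: "complex \<Rightarrow> seq2 \<Rightarrow> seq2" where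
  "seq2_scale c x = ((\<lambda>n. c * fst x n), (\<lambda>n. c * snd x n))"

interpretation seq2: vector_space seq2_scale
  by unfold_locales
    (auto simp: seq2_scale_def algebra_simps fun_eq_iff prod_eq_iff)

text \<open>\<open>T\<close> maps \<open>X\<close> into \<open>Y\<close> with operator norm at most \<open>K\<close>.\<close>

definition op_norm_le ::
  "seq2 set \<Rightarrow> (seq2 \<Rightarrow> real) \<Rightarrow> seq2 set \<Rightarrow> (seq2 \<Rightarrow> real) \<Rightarrow> (seq2 \<Rightarrow> seq2) \<Rightarrow> real \<Rightarrow> bool" where
  "op_norm_le X normX Y normY T K \<longleftrightarrow> (\<forall>x\<in>X. T x \<in> Y \<and> normY (T x) \<le> K * normX x)"

definition op_shift :: "(seq2 \<Rightarrow> seq2) \<Rightarrow> complex \<Rightarrow> seq2 \<Rightarrow> seq2" where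
  "op_shift A \<Omega> x = A x - seq2_scale \<Omega> x"

text \<open>Operators act on arbitrary sequences, so the inverse is the one relative to
  \<open>l\<^sup>2 \<times> l\<^sup>2\<close>. It is meaningful only for \<open>\<Omega>\<close> in the resolvent set.\<close>

definition resolvent :: "(seq2 \<Rightarrow> seq2) \<Rightarrow> complex \<Rightarrow> seq2 \<Rightarrow> seq2" where
  "resolvent A \<Omega> = inv_into l2_pairs (op_shift A \<Omega>)"

definition resolvent_set :: "(seq2 \<Rightarrow> seq2) \<Rightarrow> complex set" where
  "resolvent_set A = {\<Omega>. bij_betw (op_shift A \<Omega>) l2_pairs l2_pairs \<and>
     (\<exists>K. op_norm_le l2_pairs (lq2_norm 2 0) l2_pairs (lq2_norm 2 0) (resolvent A \<Omega>) K)}"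

definition is_eigenvalue :: "(seq2 \<Rightarrow> seq2) \<Rightarrow> complex \<Rightarrow> bool" where
  "is_eigenvalue A z \<longleftrightarrow> (\<exists>x\<in>l2_pairs. x \<noteq> 0 \<and> A x = seq2_scale z x)"

text \<open>An isolated eigenvalue at which the resolvent, analytic on a punctured disk, has a
  singularity of finite order. This excludes essential singularities, so that the range of the
  Riesz projection is the generalized eigenspace.\<close>

definition resolvent_pole :: "(seq2 \<Rightarrow> seq2) \<Rightarrow> complex \<Rightarrow> bool" where
  "resolvent_pole A z \<longleftrightarrow> is_eigenvalue A z \<and>
     (\<exists>r>0. \<exists>K. \<exists>k::nat. \<forall>\<Omega>\<in>ball z r - {z}. \<Omega> \<in> resolvent_set A \<and>
        op_norm_le l2_pairs (lq2_norm 2 0) l2_pairs (lq2_norm 2 0)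
          (resolvent A \<Omega>) (K / cmod (\<Omega> - z) ^ k))"

definition gen_eigenspace :: "(seq2 \<Rightarrow> seq2) \<Rightarrow> complex \<Rightarrow> seq2 set" where
  "gen_eigenspace A z = {x \<in> l2_pairs. \<exists>k::nat. (op_shift A z ^^ k) x = 0}"

text \<open>The library dimension of an infinite-dimensional space is \<open>0\<close>, hence the separate
  finiteness condition below.\<close>

definition alg_mult :: "(seq2 \<Rightarrow> seq2) \<Rightarrow> complex \<Rightarrow> nat" where
  "alg_mult A z = seq2.dim (gen_eigenspace A z)"

definition finite_alg_mult :: "(seq2 \<Rightarrow> seq2) \<Rightarrow> complex \<Rightarrow> bool" where
  "finite_alg_mult A z \<longleftrightarrow> (\<exists>B. finite B \<and> gen_eigenspace A z \<subseteq> seq2.span B)"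

text \<open>\<open>\<sigma> = 1\<close> and \<open>\<sigma> = -1\<close> give the limits from the upper and the lower half-plane.\<close>

definition boundary_limits_exist ::
  "(seq2 \<Rightarrow> seq2) \<Rightarrow> real \<Rightarrow> complex \<Rightarrow> bool" where
  "boundary_limits_exist A \<sigma> \<Omega> \<longleftrightarrow> (\<forall>x\<in>lq2_space 1 1. \<forall>n.
     (\<exists>l. ((\<lambda>\<mu>. fst (resolvent A (\<Omega> + \<i> * of_real (\<sigma> * \<mu>)) x) n) \<longlongrightarrow> l) (at_right 0)) \<and>
     (\<exists>l. ((\<lambda>\<mu>. snd (resolvent A (\<Omega> + \<i> * of_real (\<sigma> * \<mu>)) x) n) \<longlongrightarrow> l) (at_right 0)))"

definition boundary_resolvent ::
  "(seq2 \<Rightarrow> seq2) \<Rightarrow> real \<Rightarrow> complex \<Rightarrow> seq2 \<Rightarrow> seq2" where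
  "boundary_resolvent A \<sigma> \<Omega> x =
     ((\<lambda>n. Lim (at_right 0) (\<lambda>\<mu>. fst (resolvent A (\<Omega> + \<i> * of_real (\<sigma> * \<mu>)) x) n)),
      (\<lambda>n. Lim (at_right 0) (\<lambda>\<mu>. snd (resolvent A (\<Omega> + \<i> * of_real (\<sigma> * \<mu>)) x) n)))"

definition discrete_laplacian :: "(int \<Rightarrow> 'a::comm_ring_1) \<Rightarrow> int \<Rightarrow> 'a" where
  "discrete_laplacian u n = u (n + 1) - 2 * u n + u (n - 1)"

definition lattice_simply_connected :: "int set \<Rightarrow> bool" where
  "lattice_simply_connected S \<longleftrightarrow> \<not> (\<exists>m. m \<notin> S \<and> (\<exists>a\<in>S. \<exists>b\<in>S. a < m \<and> m < b))"

definition anticontinuum_soliton :: "int set \<Rightarrow> int set \<Rightarrow> int \<Rightarrow> real" where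
  "anticontinuum_soliton Up Um n = (if n \<in> Up then 1 else if n \<in> Um then -1 else 0)"

text \<open>The branch of real solutions near the anticontinuum soliton. By the implicit function
  theorem these conditions determine \<open>\<phi> \<epsilon>\<close> for all small \<open>\<epsilon>\<close>; outside that range
  \<open>\<phi>\<close> is arbitrary.\<close>

definition soliton_branch ::
  "nat \<Rightarrow> int set \<Rightarrow> int set \<Rightarrow> (real \<Rightarrow> int \<Rightarrow> real) \<Rightarrow> bool" where
  "soliton_branch p Up Um \<phi> \<longleftrightarrow> (\<exists>\<epsilon>1>0. \<exists>C>0. \<forall>\<epsilon>. \<bar>\<epsilon>\<bar> < \<epsilon>1 \<longrightarrow>
     \<phi> \<epsilon> \<in> lq_space 2 0 \<and>
     (\<forall>n. (1 - \<phi> \<epsilon> n ^ (2 * p)) * \<phi> \<epsilon> n = \<epsilon> * discrete_laplacian (\<phi> \<epsilon>) n) \<and>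
     lq_norm 2 0 (\<phi> \<epsilon> - anticontinuum_soliton Up Um) \<le> C * \<bar>\<epsilon>\<bar>)"

definition dnls_operator :: "nat \<Rightarrow> real \<Rightarrow> (int \<Rightarrow> real) \<Rightarrow> seq2 \<Rightarrow> seq2" where
  "dnls_operator p \<epsilon> \<phi> x =
     (let u = fst x; v = snd x; \<Phi> = (\<lambda>n. complex_of_real (\<phi> n ^ (2 * p))) in
      ((\<lambda>n. - of_real \<epsilon> * discrete_laplacian u n + u n
             - (1 + of_nat p) * \<Phi> n * u n - of_nat p * \<Phi> n * v n),
       (\<lambda>n. of_nat p * \<Phi> n * u n + of_real \<epsilon> * discrete_laplacian v n - v n
             + (1 + of_nat p) * \<Phi> n * v n)))"

definition spectral_bands :: "real \<Rightarrow> complex set" where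
  "spectral_bands \<epsilon> = complex_of_real ` ({1..1 + 4 * \<epsilon>} \<union> {-1 - 4 * \<epsilon>..-1})"

end

theory Submission
  imports Defs "HOL-Computational_Algebra.Fundamental_Theorem_Algebra"
begin

text \<open>The excited sites form an interval \<open>a, \<dots>, b\<close>, and the potential \<open>\<phi>\<^sup>2\<^sup>p\<close> is
  \<open>1 + O(\<epsilon>)\<close> on it and \<open>O(\<epsilon>\<^sup>2)\<close>, exponentially decaying, outside. Away from \<open>\<Omega> = 0\<close>
  the \<open>2 \<times> 2\<close> blocks on the excited sites can be inverted, so to leading order \<open>H - \<Omega>\<close> decouples
  into these blocks and Dirichlet Laplacians on the two half-lines outside. The Dirichlet
      resolvent at
  \<open>2 - w = z + 1/z\<close> has a kernel polynomial in \<open>z\<close>, bounded by the distance to the end point for all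
  \<open>\<bar>z\<bar> \<le> 1\<close>; hence it maps \<open>l\<^sup>1\<^sub>1\<close> to \<open>l\<^sup>\<infinity>\<close> with norm \<open>1/\<epsilon>\<close> up to and including the
  bands, without resonances at their ends, and the coupling is a contraction uniformly in \<open>\<Omega>\<close>.
  Near \<open>\<Omega> = 0\<close>, the operator has an invariant subspace of dimension \<open>2N\<close>, a graph over the states
  on the excited sites, on which its spectral radius is small, while modulo this subspace \<open>H - \<Omega>\<close> is
  invertible. The poles and their multiplicities are therefore those of a \<open>2N \<times> 2N\<close> matrix.\<close>

section \<open>Invariant subspaces of a linear operator\<close>

text \<open>Three obstacles shape the proof. On the half-lines, division by
  \<open>\<epsilon>\<close> gives the edge value the coefficient \<open>1\<close>, so this coupling
  is not small; it becomes contractive only in a norm with weight \<open>1/4\<close> on the excited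
  sites, where the reverse coupling is \<open>O(\<epsilon>)\<close>. Secondly, square-summable
  bounds for the half-line resolvent blow up at the bands. The uniform analysis therefore lives in a
  weighted supremum norm and admits \<open>|z| = 1\<close>; off the bands square summability is
  recovered afterwards, with constants depending on \<open>\<Omega>\<close>. Thirdly, the blocks at
  the excited sites are nilpotent but of norm of order \<open>p\<close>; rescaling one basis vector
  by \<open>\<eta>\<close> reduces their entry to at most \<open>1/16\<close>. The radius
  \<open>1/2\<close> separates two regimes: inverting the blocks needs \<open>|\<Omega>|\<close>
  bounded below, while the graph construction needs \<open>\<Omega>\<close> away from
  \<open>1\<close> and \<open>-1\<close>. Multiplicities are found by algebra instead of contour
  integrals: generalized eigenvectors for \<open>|z| < 1/2\<close> lie in the invariant subspace,
  and a product of factors \<open>T - z\<close> annihilating it bounds the order of the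
  poles.\<close>

context vector_space
begin

text \<open>The ambient space is infinite-dimensional, and finiteness enters only through
  \<open>V \<subseteq> span B\<close>. A basis \<open>K\<close> of the kernel is extended to a basis
  \<open>D\<close> of \<open>V\<close>; on the span of \<open>D - K\<close> the map is injective, so
  the image of \<open>D - K\<close> is a basis of the range.\<close>

lemma rank_nullity_subspace:
  assumes add: "\<And>x y. f (x + y) = f x + f y" and hom: "\<And>c x. f (scale c x) = scale c (f x)"
    and V: "subspace V" and fin: "finite B" "V \<subseteq> span B"
  shows "dim V = dim (f ` V) + dim {x \<in> V. f x = 0}"
proof -
  interpret f: Vector_Spaces.linear scale scale f
    by unfold_locales (auto simp: add hom)
  let ?N = "{x \<in> V. f x = 0}"
  have N: "subspace ?N"
    using V by (auto simp: subspace_def add hom f.zero)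
  obtain K where K: "K \<subseteq> ?N" "independent K" "?N \<subseteq> span K"
    by (rule maximal_independent_subset)
  have "K \<subseteq> V" using K(1) by auto
  then obtain D where D: "K \<subseteq> D" "D \<subseteq> V" "independent D" "V \<subseteq> span D"
    by (rule maximal_independent_subset_extend[OF _ K(2)])
  have finD: "finite D"
    using independent_span_bound[OF fin(1) D(3)] D(2) fin(2) by auto
  then have finK: "finite K" using D(1) finite_subset by blast
  let ?E = "D - K"
  have inj: "inj_on f (span ?E)"
    unfolding f.inj_on_iff_eq_0[OF subspace_span]
  proof (intro ballI impI)
    fix x assume x: "x \<in> span ?E" "f x = 0"
    have "x \<in> V" using x(1) span_minimal[of ?E V] D(2) V by auto
    then have "x \<in> span K" using K(3) x(2) by auto
    then obtain w where w: "x = (\<Sum>v\<in>K. scale (w v) v)"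
      using span_finite[OF finK] by auto
    obtain u where u: "x = (\<Sum>v\<in>?E. scale (u v) v)"
      using x(1) span_finite[of ?E] finD by auto
    \<comment> \<open>The two expansions of \<open>x\<close>, over \<open>K\<close> and over
      \<open>D - K\<close>, are subtracted to give a vanishing combination of the basis
      \<open>D\<close>.\<close>
    let ?g = "\<lambda>v. if v \<in> K then - w v else u v"
    have "(\<Sum>v\<in>D. scale (?g v) v) = (\<Sum>v\<in>?E. scale (?g v) v) + (\<Sum>v\<in>K. scale (?g v) v)"
      by (rule sum.subset_diff[OF D(1) finD])
    also have "(\<Sum>v\<in>?E. scale (?g v) v) = x" unfolding u by (rule sum.cong) auto
    also have "(\<Sum>v\<in>K. scale (?g v) v) = - x" unfolding w by (simp add: sum_negf)
    finally have "(\<Sum>v\<in>D. scale (?g v) v) = 0" by simp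
    then have "\<forall>v\<in>D. ?g v = 0"
      using D(3)[unfolded independent_explicit_finite_subsets, rule_format, OF subset_refl finD,
          of ?g]
      by blast
    then have "\<forall>v\<in>K. w v = 0" using D(1) by force
    then show "x = 0" unfolding w by simp
  qed
  have "independent (f ` ?E)"
    by (rule f.independent_injective_image[OF independent_mono[OF D(3)] inj]) auto
  moreover have "f ` V \<subseteq> span (f ` ?E)"
  proof -
    have "f ` V \<subseteq> span (f ` D)" using f.spans_image[OF D(4)] .
    also have "\<dots> \<subseteq> span (insert 0 (f ` ?E))"
      using K(1) by (intro span_mono) auto
    finally show ?thesis by simp
  qed
  moreover have "f ` ?E \<subseteq> f ` V" using D(2) by auto
  ultimately have "dim (f ` V) = card (f ` ?E)"
    using basis_card_eq_dim[of "f ` ?E" "f ` V"] by simp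
  also have "\<dots> = card ?E"
    using inj by (intro card_image) (meson inj_on_subset span_superset)
  finally have 1: "dim (f ` V) = card ?E" .
  have "dim ?N = card K" using basis_card_eq_dim[OF K(1,3,2)] by simp
  moreover have "dim V = card D" using basis_card_eq_dim[OF D(2,4,3)] by simp
  moreover have "card D = card ?E + card K"
    using card_Diff_subset[OF finK D(1)] card_mono[OF finD D(1)] by simp
  ultimately show ?thesis using 1 by simp
qed

end

section \<open>Eigenvalues and generalized eigenspaces on finite-dimensional invariant
  subspaces\<close>

locale complex_endomorphism = vector_space scale
  for scale :: "complex \<Rightarrow> 'b::ab_group_add \<Rightarrow> 'b" +
  fixes T :: "'b \<Rightarrow> 'b"
  assumes T_add: "T (x + y) = T x + T y"
    and T_scale: "T (scale c x) = scale c (T x)"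
begin

definition shifted :: "complex \<Rightarrow> 'b \<Rightarrow> 'b" where "shifted z x = T x - scale z x"

lemma T_0: "T 0 = 0"
  using T_scale[of 0 0] by simp

lemma T_diff: "T (x - y) = T x - T y"
  using T_add[of "x - y" y] by (simp add: algebra_simps)

lemma shifted_add: "shifted z (x + y) = shifted z x + shifted z y"
  by (simp add: shifted_def T_add scale_right_distrib)

lemma shifted_scale: "shifted z (scale c x) = scale c (shifted z x)"
  by (simp add: shifted_def T_scale scale_right_diff_distrib scale_left_commute)

lemma shifted_0: "shifted z 0 = 0"
  by (simp add: shifted_def T_0)

lemma shifted_diff: "shifted z (x - y) = shifted z x - shifted z y"
  by (simp add: shifted_def T_diff scale_right_diff_distrib)

lemma shifted_commute: "shifted z (shifted w x) = shifted w (shifted z x)"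
  by (simp add: shifted_def T_diff T_scale scale_right_diff_distrib scale_left_commute
      algebra_simps)

lemma shifted_shifted: "shifted z x = shifted w x + scale (w - z) x"
  by (simp add: shifted_def scale_left_diff_distrib)

lemma shifted_pow_add: "(shifted z ^^ k) (x + y) = (shifted z ^^ k) x + (shifted z ^^ k) y"
  by (induction k) (auto simp: shifted_add)

lemma shifted_pow_scale: "(shifted z ^^ k) (scale c x) = scale c ((shifted z ^^ k) x)"
  by (induction k) (auto simp: shifted_scale)

lemma shifted_pow_0: "(shifted z ^^ k) 0 = 0"
  by (induction k) (auto simp: shifted_0)

lemma shifted_pow_commute: "(shifted z ^^ k) (shifted w x) = shifted w ((shifted z ^^ k) x)"
  by (induction k) (auto simp: shifted_commute)

lemma shifted_pow_mono:
  assumes "(shifted z ^^ k) x = 0" "k \<le> m" shows "(shifted z ^^ m) x = 0"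
  using assms by (metis comp_apply funpow_add le_add_diff_inverse2 shifted_pow_0)

text \<open>This is the vector \<open>p(T) x\<close>, evaluated by Horner's scheme so that it
  recurses along \<open>pCons\<close>.\<close>

definition poly_op :: "complex poly \<Rightarrow> 'b \<Rightarrow> 'b" where
  "poly_op p x = fold_coeffs (\<lambda>a y. scale a x + T y) p 0"

lemma poly_op_0: "poly_op 0 x = 0"
  by (simp add: poly_op_def)

lemma poly_op_pCons: "poly_op (pCons a p) x = scale a x + T (poly_op p x)"
  by (cases "p = 0"; cases "a = 0") (auto simp: poly_op_def T_0)

lemma poly_op_add: "poly_op (p + q) x = poly_op p x + poly_op q x"
  by (induction p q rule: poly_induct2)
    (auto simp: poly_op_0 poly_op_pCons T_add scale_left_distrib)

lemma poly_op_smult: "poly_op (smult c p) x = scale c (poly_op p x)"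
  by (induction p) (auto simp: poly_op_0 poly_op_pCons T_scale scale_right_distrib)

lemma poly_op_linear_factor: "poly_op ([:-a, 1:] * q) x = shifted a (poly_op q x)"
proof -
  have "[:-a, 1:] * q = smult (-a) q + pCons 0 q" by (simp add: mult_pCons_left)
  then show ?thesis by (simp only: poly_op_add poly_op_smult poly_op_pCons shifted_def) simp
qed

lemma poly_op_monom: "poly_op (monom c n) x = scale c ((T ^^ n) x)"
  by (induction n) (auto simp: monom_0 monom_Suc poly_op_pCons T_0 T_scale poly_op_0)

lemma poly_op_sum: "finite A \<Longrightarrow> poly_op (sum g A) x = (\<Sum>i\<in>A. poly_op (g i) x)"
  by (induction A rule: finite_induct) (auto simp: poly_op_0 poly_op_add)

definition invariant :: "'b set \<Rightarrow> bool" where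
  "invariant W \<longleftrightarrow> subspace W \<and> T ` W \<subseteq> W \<and> (\<exists>B. finite B \<and> W \<subseteq> span B)"

lemma shifted_in_invariant: "invariant W \<Longrightarrow> x \<in> W \<Longrightarrow> shifted z x \<in> W"
  unfolding invariant_def shifted_def by (auto intro!: subspace_diff subspace_scale)

text \<open>The orbit of \<open>x\<close> stays in a finite-dimensional space, so some nonzero
  polynomial in \<open>T\<close> annihilates \<open>x\<close>. One of minimal degree has a complex
  root \<open>a\<close>; removing the factor \<open>T - a\<close> leaves a vector that is nonzero by
  minimality and is killed by \<open>T - a\<close>.\<close>

lemma eigenvector_exists:
  assumes W: "invariant W" and x: "x \<in> W" "x \<noteq> 0"
  shows "\<exists>z. \<exists>y\<in>W. y \<noteq> 0 \<and> shifted z y = 0"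
proof -
  obtain B where B: "finite B" "W \<subseteq> span B" using W by (auto simp: invariant_def)
  have TW: "(T ^^ n) x \<in> W" for n
    using W x by (induction n) (auto simp: invariant_def)
  have "\<exists>p. p \<noteq> 0 \<and> poly_op p x = 0"
  proof (rule ccontr)
    assume "\<not> ?thesis"
    then have z: "p = 0" if "poly_op p x = 0" for p using that by blast
    \<comment> \<open>Two equal iterates would already give an annihilating polynomial. Injectivity
      makes the iterates a set of \<open>card B + 1\<close> vectors, one too many to be
      independent.\<close>
    have inj: "inj (\<lambda>n. (T ^^ n) x)"
    proof (rule injI)
      fix m n :: nat assume "(T ^^ m) x = (T ^^ n) x"
      then have "poly_op (monom 1 m + smult (-1) (monom 1 n)) x = 0"
        by (simp only: poly_op_add poly_op_smult poly_op_monom) simp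
      then have "monom (1::complex) m = monom 1 n" using z by fastforce
      then show "m = n" by (metis coeff_monom zero_neq_one)
    qed
    let ?S = "(\<lambda>n. (T ^^ n) x) ` {..card B}"
    have "independent ?S"
    proof (rule independent_if_scalars_zero)
      fix u y assume u: "(\<Sum>y\<in>?S. scale (u y) y) = 0" and y: "y \<in> ?S"
      let ?p = "\<Sum>n\<le>card B. monom (u ((T ^^ n) x)) n"
      have "poly_op ?p x = (\<Sum>y\<in>?S. scale (u y) y)"
        using inj by (subst sum.reindex) (auto simp: poly_op_sum poly_op_monom intro: inj_on_subset)
      then have "?p = 0" using u z by simp
      obtain n where n: "n \<le> card B" "y = (T ^^ n) x" using y by auto
      have "coeff ?p n = u y"
        using n by (simp add: coeff_sum)
      then show "u y = 0" using \<open>?p = 0\<close> by simp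
    qed simp
    moreover have "?S \<subseteq> span B" using TW B by auto
    ultimately have "card ?S \<le> card B" using independent_span_bound[OF B(1)] by blast
    moreover have "card ?S = Suc (card B)"
      using inj by (subst card_image) (auto intro: inj_on_subset)
    ultimately show False by simp
  qed
  then obtain p where p: "p \<noteq> 0" "poly_op p x = 0"
    and pmin: "\<And>q. q \<noteq> 0 \<Longrightarrow> poly_op q x = 0 \<Longrightarrow> degree p \<le> degree q"
    using ex_has_least_nat[of "\<lambda>p. p \<noteq> 0 \<and> poly_op p x = 0" _ degree] by blast
  have "degree p \<noteq> 0"
  proof
    assume "degree p = 0"
    then obtain c where c: "p = [:c:]" by (metis degree_eq_zeroE)
    then show False using p x by (auto simp: poly_op_pCons poly_op_0 T_0)
  qed
  then have "\<not> constant (poly p)" by (simp add: constant_degree)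
  then obtain a where "poly p a = 0" using fundamental_theorem_of_algebra by blast
  then obtain q where q: "p = [:-a, 1:] * q" by (auto simp: poly_eq_0_iff_dvd)
  have "q \<noteq> 0" using p q by auto
  then have "degree p = Suc (degree q)" unfolding q by (subst degree_mult_eq) auto
  then have "poly_op q x \<noteq> 0" using pmin[of q] \<open>q \<noteq> 0\<close> by auto
  moreover have "shifted a (poly_op q x) = 0" using p(2) q poly_op_linear_factor by simp
  moreover have "poly_op q x \<in> W"
  proof (induction q)
    case 0 then show ?case using W by (auto simp: poly_op_0 invariant_def subspace_0)
  next
    case (pCons a q)
    then show ?case using W x
      by (auto simp: poly_op_pCons invariant_def intro!: subspace_add subspace_scale)
  qed
  ultimately show ?thesis by blast
qed

definition eigenvalues :: "'b set \<Rightarrow> complex set" where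
  "eigenvalues W = {z. \<exists>x\<in>W. x \<noteq> 0 \<and> T x = scale z x}"

definition gen_eigenvectors :: "'b set \<Rightarrow> complex \<Rightarrow> 'b set" where
  "gen_eigenvectors W z = {x \<in> W. \<exists>k. (shifted z ^^ k) x = 0}"

lemma eigenvalues_iff: "z \<in> eigenvalues W \<longleftrightarrow> (\<exists>x\<in>W. x \<noteq> 0 \<and> shifted z x = 0)"
  by (auto simp: eigenvalues_def shifted_def)

lemma subspace_gen_eigenvectors:
  assumes "subspace W" shows "subspace (gen_eigenvectors W z)"
  unfolding subspace_def gen_eigenvectors_def
proof (intro conjI ballI allI)
  show "0 \<in> {x \<in> W. \<exists>k. (shifted z ^^ k) x = 0}"
    using assms by (auto simp: subspace_0 shifted_pow_0)
next
  fix x y assume x: "x \<in> {x \<in> W. \<exists>k. (shifted z ^^ k) x = 0}"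
    and y: "y \<in> {x \<in> W. \<exists>k. (shifted z ^^ k) x = 0}"
  obtain k l where kl: "(shifted z ^^ k) x = 0" "(shifted z ^^ l) y = 0" using x y by auto
  then have "(shifted z ^^ max k l) (x + y) = 0"
    using shifted_pow_mono[OF kl(1), of "max k l"] shifted_pow_mono[OF kl(2), of "max k l"]
    by (simp add: shifted_pow_add)
  then show "x + y \<in> {x \<in> W. \<exists>k. (shifted z ^^ k) x = 0}"
    using assms x y by (auto intro!: subspace_add)
next
  fix c x assume "x \<in> {x \<in> W. \<exists>k. (shifted z ^^ k) x = 0}"
  then show "scale c x \<in> {x \<in> W. \<exists>k. (shifted z ^^ k) x = 0}"
    using assms by (auto intro!: subspace_scale simp: shifted_pow_scale)
qed

lemma gen_eigenvectors_trivial: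
  assumes W: "invariant W" and z: "z \<notin> eigenvalues W"
  shows "gen_eigenvectors W z = {0}"
proof -
  have "x = 0" if "x \<in> W" "(shifted z ^^ k) x = 0" for x k
    using that
  proof (induction k arbitrary: x)
    case (Suc k)
    then have "shifted z x = 0"
      using shifted_in_invariant[OF W] by (auto simp: funpow_swap1)
    then show ?case using z Suc.prems by (auto simp: eigenvalues_iff)
  qed auto
  moreover have "0 \<in> W" using W by (auto simp: invariant_def subspace_0)
  ultimately show ?thesis unfolding gen_eigenvectors_def using shifted_pow_0 by blast
qed

text \<open>The induction passes from \<open>W\<close> to the range \<open>(T - a) W\<close> for an eigenvalue \<open>a\<close>. This leaves
  the generalized eigenspaces for \<open>z \<noteq> a\<close> unchanged, and both \<open>W\<close> and the one for \<open>a\<close> lose exactly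
  the dimension of the kernel of \<open>T - a\<close>.\<close>

lemma primary_decomposition:
  assumes "invariant W"
  shows "finite (eigenvalues W) \<and> (\<Sum>z\<in>eigenvalues W. dim (gen_eigenvectors W z)) = dim W \<and>
    (\<exists>zs. set zs \<subseteq> eigenvalues W \<and> (\<forall>x\<in>W. fold shifted zs x = 0))"
  using assms
proof (induction "dim W" arbitrary: W rule: less_induct)
  case less
  note W = less.prems
  have sub: "subspace W" using W by (simp add: invariant_def)
  obtain B where B: "finite B" "W \<subseteq> span B" using W by (auto simp: invariant_def)
  show ?case
  proof (cases "W = {0}")
    case True
    then have "eigenvalues W = {}" by (auto simp: eigenvalues_def)
    moreover have "dim {0} = 0" using dim_le_card[of "{0}" "{}"] by simp
    ultimately show ?thesis using True by (auto intro!: exI[of _ "[]"])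
  next
    case False
    then obtain x where "x \<in> W" "x \<noteq> 0" using sub subspace_0 by blast
    then obtain a v where a: "v \<in> W" "v \<noteq> 0" "shifted a v = 0"
      using eigenvector_exists[OF W] by blast
    let ?R = "shifted a ` W"
    let ?N = "{x \<in> W. shifted a x = 0}"
    have R_sub: "?R \<subseteq> W" using shifted_in_invariant[OF W] by auto
    interpret sh: Vector_Spaces.linear scale scale "shifted a"
      by unfold_locales (auto simp: shifted_add shifted_scale)
    have R: "invariant ?R"
      unfolding invariant_def
    proof (intro conjI)
      show "subspace ?R" using sub by (rule sh.subspace_image)
      show "T ` ?R \<subseteq> ?R"
      proof safe
        fix x assume x: "x \<in> W"
        have "T (shifted a x) = shifted a (T x)"
          by (simp add: shifted_def T_diff T_scale)
        then show "T (shifted a x) \<in> ?R" using x W by (auto simp: invariant_def)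
      qed
      show "\<exists>B. finite B \<and> ?R \<subseteq> span B" using B R_sub by blast
    qed
    have dimW: "dim W = dim ?R + dim ?N"
      by (rule rank_nullity_subspace[OF shifted_add shifted_scale sub B])
    have "dim ?N \<noteq> 0"
    proof
      assume "dim ?N = 0"
      obtain K where K: "K \<subseteq> ?N" "independent K" "?N \<subseteq> span K" "card K = dim ?N"
        using basis_exists .
      have "finite K" using K(1,2) B independent_span_bound[OF B(1) K(2)] by auto
      then have "K = {}" using K(4) \<open>dim ?N = 0\<close> by simp
      then show False using K(3) a by auto
    qed
    then have IH: "finite (eigenvalues ?R)"
      "(\<Sum>z\<in>eigenvalues ?R. dim (gen_eigenvectors ?R z)) = dim ?R"
      "\<exists>zs. set zs \<subseteq> eigenvalues ?R \<and> (\<forall>x\<in>?R. fold shifted zs x = 0)"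
      using less.hyps[OF _ R] dimW by auto
    have ev: "eigenvalues W = insert a (eigenvalues ?R)"
    proof
      show "insert a (eigenvalues ?R) \<subseteq> eigenvalues W"
      proof
        fix z assume "z \<in> insert a (eigenvalues ?R)"
        then show "z \<in> eigenvalues W"
        proof
          assume "z = a"
          then show ?thesis using a unfolding eigenvalues_iff by blast
        next
          assume "z \<in> eigenvalues ?R"
          then show ?thesis using R_sub unfolding eigenvalues_iff by (meson subsetD)
        qed
      qed
      show "eigenvalues W \<subseteq> insert a (eigenvalues ?R)"
      proof
        fix z assume "z \<in> eigenvalues W"
        then obtain x where x: "x \<in> W" "x \<noteq> 0" "shifted z x = 0" by (auto simp: eigenvalues_iff)
        show "z \<in> insert a (eigenvalues ?R)"
        proof (cases "z = a")
          case False
          \<comment> \<open>On an eigenvector for \<open>z\<close>, the map \<open>T - a\<close> is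
            multiplication by \<open>z - a\<close>, hence the eigenvector lies in the range.\<close>
          have "shifted a x = scale (z - a) x" using x shifted_shifted[of a x z] by simp
          then have "x = shifted a (scale (1 / (z - a)) x)"
            using False by (simp add: shifted_scale)
          then have "x \<in> ?R" using x(1) sub by (metis image_eqI subspace_scale)
          then show ?thesis using x by (auto simp: eigenvalues_iff)
        qed simp
      qed
    qed
    have gen_ne: "gen_eigenvectors W z = gen_eigenvectors ?R z" if "z \<noteq> a" for z
    proof
      show "gen_eigenvectors ?R z \<subseteq> gen_eigenvectors W z"
        using R_sub by (auto simp: gen_eigenvectors_def)
      have "x \<in> ?R" if "x \<in> W" "(shifted z ^^ k) x = 0" for x k
        using that
      proof (induction k arbitrary: x)
        case 0 then show ?case using sub subspace_0 shifted_0 by (metis funpow_0 image_eqI)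
      next
        case (Suc k)
        then have y: "shifted z x \<in> ?R"
          using shifted_in_invariant[OF W] by (auto simp: funpow_swap1)
        have "shifted a x = shifted z x + scale (z - a) x" by (rule shifted_shifted)
        then have "scale (1 / (z - a)) (shifted a x - shifted z x) = x"
          using \<open>z \<noteq> a\<close> by simp
        moreover have "scale (1 / (z - a)) (shifted a x - shifted z x) \<in> ?R"
          using y Suc.prems(1) R unfolding invariant_def
              by (auto intro!: subspace_scale subspace_diff)
        ultimately show ?case by simp
      qed
      then show "gen_eigenvectors W z \<subseteq> gen_eigenvectors ?R z"
        by (auto simp: gen_eigenvectors_def)
    qed
    have gen_a: "dim (gen_eigenvectors W a) = dim (gen_eigenvectors ?R a) + dim ?N"
    proof -
      have "shifted a ` gen_eigenvectors W a = gen_eigenvectors ?R a"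
      proof
        show "shifted a ` gen_eigenvectors W a \<subseteq> gen_eigenvectors ?R a"
        proof
          fix y assume "y \<in> shifted a ` gen_eigenvectors W a"
          then obtain x k where x: "x \<in> W" "y = shifted a x" "(shifted a ^^ k) x = 0"
            by (auto simp: gen_eigenvectors_def)
          then have "(shifted a ^^ k) y = 0" by (simp add: shifted_pow_commute shifted_0)
          then show "y \<in> gen_eigenvectors ?R a" using x by (auto simp: gen_eigenvectors_def)
        qed
        show "gen_eigenvectors ?R a \<subseteq> shifted a ` gen_eigenvectors W a"
        proof
          fix y assume "y \<in> gen_eigenvectors ?R a"
          then obtain x k where x: "x \<in> W" "y = shifted a x" "(shifted a ^^ k) y = 0"
            by (auto simp: gen_eigenvectors_def)
          then have "(shifted a ^^ Suc k) x = 0" by (simp add: funpow_swap1)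
          then show "y \<in> shifted a ` gen_eigenvectors W a"
            using x unfolding gen_eigenvectors_def by blast
        qed
      qed
      moreover have "{x \<in> gen_eigenvectors W a. shifted a x = 0} = ?N"
        by (auto simp: gen_eigenvectors_def intro!: exI[of _ 1])
      moreover have "gen_eigenvectors W a \<subseteq> span B" using B by (auto simp: gen_eigenvectors_def)
      ultimately show ?thesis
        using rank_nullity_subspace[OF shifted_add[of a] shifted_scale[of a]
            subspace_gen_eigenvectors[OF sub] B(1)]
        by simp
    qed
    have "(\<Sum>z\<in>eigenvalues W. dim (gen_eigenvectors W z)) =
      dim (gen_eigenvectors W a) + (\<Sum>z\<in>eigenvalues ?R - {a}. dim (gen_eigenvectors W z))"
      unfolding ev using IH(1) by (simp add: sum.insert_remove)
    also have "(\<Sum>z\<in>eigenvalues ?R - {a}. dim (gen_eigenvectors W z)) =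
      (\<Sum>z\<in>eigenvalues ?R - {a}. dim (gen_eigenvectors ?R z))"
      by (rule sum.cong) (auto simp: gen_ne)
    finally have s1: "(\<Sum>z\<in>eigenvalues W. dim (gen_eigenvectors W z)) =
      dim ?N + (dim (gen_eigenvectors ?R a) + (\<Sum>z\<in>eigenvalues ?R - {a}. dim (gen_eigenvectors ?R
          z)))"
      using gen_a by simp
    \<comment> \<open>If \<open>a\<close> is no longer an eigenvalue on the range, its generalized
      eigenspace there is trivial and contributes \<open>0\<close>.\<close>
    have "dim (gen_eigenvectors ?R a) + (\<Sum>z\<in>eigenvalues ?R - {a}. dim (gen_eigenvectors ?R z)) =
        dim ?R"
    proof (cases "a \<in> eigenvalues ?R")
      case True
      then show ?thesis using IH(1,2) sum.remove by metis
    next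
      case False
      have "dim {0} = 0" using dim_le_card[of "{0}" "{}"] by simp
      then show ?thesis using gen_eigenvectors_trivial[OF R False] IH False by simp
    qed
    then have sum: "(\<Sum>z\<in>eigenvalues W. dim (gen_eigenvectors W z)) = dim W"
      using s1 dimW by simp
    obtain zs where zs: "set zs \<subseteq> eigenvalues ?R" "\<forall>x\<in>?R. fold shifted zs x = 0" using IH(3)
        by blast
    \<comment> \<open>\<open>fold\<close> applies the head first: \<open>T - a\<close> maps
      \<open>W\<close> into its range, which the factors in \<open>zs\<close> annihilate.\<close>
    have "set (a # zs) \<subseteq> eigenvalues W \<and> (\<forall>x\<in>W. fold shifted (a # zs) x = 0)"
      using zs ev by auto
    moreover have "finite (eigenvalues W)" using IH(1) ev by simp
    ultimately show ?thesis using sum by blast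
  qed
qed

text \<open>Inverts \<open>T - \<Omega>\<close> on vectors annihilated by \<open>\<Prod>(T - z\<^sub>i)\<close>, by solving first for the
  vector \<open>(T - z\<^sub>1) g\<close>. The number \<open>r\<close> bounds the distance of \<open>\<Omega>\<close> to the \<open>z\<^sub>i\<close> from below.\<close>

lemma solve_annihilated:
  fixes N :: "'b \<Rightarrow> real"
  assumes W: "invariant W"
    and N: "\<And>x. x \<in> W \<Longrightarrow> 0 \<le> N x" "N 0 = 0"
      "\<And>x y. x \<in> W \<Longrightarrow> y \<in> W \<Longrightarrow> N (x + y) \<le> N x + N y"
      "\<And>c x. x \<in> W \<Longrightarrow> N (scale c x) \<le> cmod c * N x"
    and h: "\<And>x. x \<in> W \<Longrightarrow> N (T x) \<le> h * N x" "0 \<le> h"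
  shows "\<exists>K\<ge>0. \<forall>\<Omega> r. 0 < r \<and> r \<le> 1 \<and> (\<forall>z\<in>set zs. r \<le> cmod (z - \<Omega>)) \<longrightarrow>
    (\<forall>g\<in>W. fold shifted zs g = 0 \<longrightarrow>
      (\<exists>x\<in>W. shifted \<Omega> x = g \<and> N x \<le> K / r ^ length zs * N g))"
proof (induction zs)
  case Nil
  have "0 \<in> W" using W by (auto simp: invariant_def subspace_0)
  then show ?case by (auto intro!: exI[of _ 0] bexI[of _ 0] simp: shifted_0 N)
next
  case (Cons z zs)
  then obtain K where K: "K \<ge> 0" "\<And>\<Omega> r g. 0 < r \<Longrightarrow> r \<le> 1 \<Longrightarrow> (\<forall>z\<in>set zs. r \<le> cmod (z - \<Omega>)) \<Longrightarrow>
    g \<in> W \<Longrightarrow> fold shifted zs g = 0 \<Longrightarrow>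
      (\<exists>x\<in>W. shifted \<Omega> x = g \<and> N x \<le> K / r ^ length zs * N g)" by blast
  have sub: "subspace W" using W by (simp add: invariant_def)
  have "\<exists>x\<in>W. shifted \<Omega> x = g \<and> N x \<le> (1 + K * (h + cmod z)) / r ^ length (z # zs) * N g"
    if r: "0 < r" "r \<le> 1" "\<forall>y\<in>set (z # zs). r \<le> cmod (y - \<Omega>)"
        and g: "g \<in> W" "fold shifted (z # zs) g = 0"
    for \<Omega> r g
  proof -
    have g': "shifted z g \<in> W" using shifted_in_invariant[OF W g(1)] .
    obtain y where y: "y \<in> W" "shifted \<Omega> y = shifted z g"
      "N y \<le> K / r ^ length zs * N (shifted z g)"
      using K(2)[OF r(1,2) _ g'] r(3) g(2) by auto
    \<comment> \<open>From \<open>(T - \<Omega>) y = (T - z) g\<close> one gets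
      \<open>(T - \<Omega>) (g - y) = (z - \<Omega>) g\<close>.\<close>
    define x where "x = scale (1 / (z - \<Omega>)) (g - y)"
    have ne: "z - \<Omega> \<noteq> 0" using r by auto
    have x: "x \<in> W" unfolding x_def using sub g y by (intro subspace_scale subspace_diff)
    have "shifted \<Omega> (g - y) = scale (z - \<Omega>) g"
      using shifted_shifted[of \<Omega> g z] y(2) by (simp add: shifted_diff)
    then have eq: "shifted \<Omega> x = g" unfolding x_def using ne by (simp add: shifted_scale)
    have Nm: "N (scale c v + w) \<le> cmod c * N v + N w" if "v \<in> W" "w \<in> W" for c v w
      using N(3)[of "scale c v" w] N(4)[of v c] that sub subspace_scale by fastforce
    have 1: "N (shifted z g) \<le> (h + cmod z) * N g"
    proof -
      have "shifted z g = scale (-z) g + T g" by (simp add: shifted_def)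
      then have "N (shifted z g) \<le> cmod (-z) * N g + N (T g)"
        using Nm[of g "T g" "-z"] g W by (auto simp: invariant_def)
      then show ?thesis using h(1)[OF g(1)] by (simp add: algebra_simps)
    qed
    have Ng: "0 \<le> N g" using N(1) g by blast
    have rp: "1 \<le> 1 / r ^ length zs" "0 < r ^ length zs"
      using r by (auto simp: power_le_one)
    have "N y \<le> K / r ^ length zs * ((h + cmod z) * N g)"
      using y(3) mult_left_mono[OF 1, of "K / r ^ length zs"] K(1) rp(2) by auto
    moreover have "N (g - y) \<le> N g + N y"
      using Nm[of y g "-1"] g y by (simp add: algebra_simps)
    moreover have "N g \<le> 1 / r ^ length zs * N g"
      using mult_right_mono[OF rp(1) Ng] by simp
    moreover have "1 / r ^ length zs * N g + K / r ^ length zs * ((h + cmod z) * N g) =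
        (1 + K * (h + cmod z)) / r ^ length zs * N g"
      by (simp add: add_divide_distrib distrib_right)
    ultimately have 2: "N (g - y) \<le> (1 + K * (h + cmod z)) / r ^ length zs * N g"
      by linarith
    have "N x \<le> cmod (1 / (z - \<Omega>)) * N (g - y)"
      unfolding x_def using N(4)[of "g - y"] sub g y by (meson subspace_diff)
    also have "\<dots> \<le> (1 / r) * N (g - y)"
    proof (rule mult_right_mono)
      show "cmod (1 / (z - \<Omega>)) \<le> 1 / r" using r ne by (simp add: norm_divide frac_le)
      show "0 \<le> N (g - y)" using N(1) sub g y by (meson subspace_diff)
    qed
    also have "\<dots> \<le> (1 / r) * ((1 + K * (h + cmod z)) / r ^ length zs * N g)"
      using 2 r by (intro mult_left_mono) auto
    finally show ?thesis using x eq by (auto simp: field_simps)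
  qed
  moreover have "1 + K * (h + cmod z) \<ge> 0" using K h by auto
  ultimately show ?case by blast
qed

end

section \<open>Contractions in sequence spaces\<close>

text \<open>A norm on a space of complex families, encoded by the predicate \<open>nb f B\<close> saying that \<open>f\<close>
  belongs to the space and has norm at most \<open>B\<close>. The closure under pointwise limits replaces
  completeness.\<close>

locale pointwise_norm =
  fixes nb :: "('i \<Rightarrow> complex) \<Rightarrow> real \<Rightarrow> bool" and w :: "'i \<Rightarrow> real"
  assumes nb_zero: "nb (\<lambda>_. 0) 0"
    and nb_add: "nb f B \<Longrightarrow> nb g C \<Longrightarrow> nb (\<lambda>i. f i + g i) (B + C)"
    and nb_uminus: "nb f B \<Longrightarrow> nb (\<lambda>i. - f i) B"
    and nb_mono: "nb f B \<Longrightarrow> B \<le> C \<Longrightarrow> nb f C"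
    and nb_pointwise: "nb f B \<Longrightarrow> cmod (f i) \<le> w i * B"
    and nb_limit: "(\<And>k::nat. nb (h k) B) \<Longrightarrow> (\<And>i. (\<lambda>k. h k i) \<longlonglongrightarrow> f i) \<Longrightarrow> nb f B"
begin

lemma nb_diff: "nb f B \<Longrightarrow> nb g C \<Longrightarrow> nb (\<lambda>i. f i - g i) (B + C)"
  using nb_add[OF _ nb_uminus, of f B g C] by simp

context
  fixes T :: "('i \<Rightarrow> complex) \<Rightarrow> 'i \<Rightarrow> complex" and q R :: real
  assumes q: "0 \<le> q" "q < 1" and R: "0 \<le> R"
    and T_ball: "\<And>x. nb x R \<Longrightarrow> nb (T x) R"
    and T_contract: "\<And>x y C. nb x R \<Longrightarrow> nb y R \<Longrightarrow> 0 \<le> C \<Longrightarrow> nb (\<lambda>i. x i - y i) C \<Longrightarrow>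
      nb (\<lambda>i. T x i - T y i) (q * C)"
begin

lemma iterates_ball: "nb ((T ^^ k) (\<lambda>_. 0)) R"
  by (induction k) (use nb_mono[OF nb_zero R] T_ball in auto)

lemma iterates_step: "nb (\<lambda>i. (T ^^ Suc k) (\<lambda>_. 0) i - (T ^^ k) (\<lambda>_. 0) i) (q ^ k * R)"
proof (induction k)
  case 0
  then show ?case using T_ball nb_mono[OF nb_zero R] by simp
next
  case (Suc k)
  have "nb (\<lambda>i. T ((T ^^ Suc k) (\<lambda>_. 0)) i - T ((T ^^ k) (\<lambda>_. 0)) i) (q * (q ^ k * R))"
    by (rule T_contract[OF iterates_ball iterates_ball _ Suc]) (use q R in simp)
  then show ?case by (simp add: mult.assoc)
qed

lemma iterates_Cauchy:
  "nb (\<lambda>i. (T ^^ (k + m)) (\<lambda>_. 0) i - (T ^^ k) (\<lambda>_. 0) i) (q ^ k * R * (\<Sum>j<m. q ^ j))"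
proof (induction m)
  case 0 then show ?case using nb_zero by simp
next
  case (Suc m)
  have "nb (\<lambda>i. ((T ^^ Suc (k + m)) (\<lambda>_. 0) i - (T ^^ (k + m)) (\<lambda>_. 0) i) +
      ((T ^^ (k + m)) (\<lambda>_. 0) i - (T ^^ k) (\<lambda>_. 0) i)) (q ^ (k + m) * R +
          q ^ k * R * (\<Sum>j<m. q ^ j))"
    by (rule nb_add[OF iterates_step Suc])
  moreover have "q ^ (k + m) * R + q ^ k * R * (\<Sum>j<m. q ^ j) = q ^ k * R * (\<Sum>j<Suc m. q ^ j)"
    by (simp add: power_add algebra_simps)
  ultimately show ?case by simp
qed

lemma geometric_partial_sum_le: "(\<Sum>j<m. q ^ j) \<le> 1 / (1 - q)"
proof -
  have "(\<Sum>j<m. q ^ j) = (1 - q ^ m) / (1 - q)" using q by (simp add: sum_gp_strict)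
  also have "\<dots> \<le> 1 / (1 - q)" using q by (intro divide_right_mono) auto
  finally show ?thesis .
qed

text \<open>Banach's theorem on the ball of radius \<open>R\<close>, with the iteration started at
  zero. The distance to the \<open>k\<close>-th iterate is kept explicit: being independent of
  parameters in \<open>T\<close>, it later permits a limit in the spectral parameter to be taken
  iterate by iterate.\<close>

theorem contraction_fixed_point:
  "\<exists>x. nb x R \<and> T x = x \<and> (\<forall>k. nb (\<lambda>i. x i - (T ^^ k) (\<lambda>_. 0) i) (q ^ k * R / (1 - q)))"
proof -
  let ?X = "\<lambda>k. (T ^^ k) (\<lambda>_. 0)"
  have conv: "convergent (\<lambda>k. ?X k i)" for i
  proof -
    have "summable (\<lambda>k. w i * R * q ^ k)"
      using q by (intro summable_mult summable_geometric) auto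
    then have "summable (\<lambda>k. ?X (Suc k) i - ?X k i)"
    proof (rule summable_comparison_test'[where N = 0])
      fix k show "cmod (?X (Suc k) i - ?X k i) \<le> w i * R * q ^ k"
        using nb_pointwise[OF iterates_step[of k], of i] by (simp add: mult_ac)
    qed
    then have "convergent (\<lambda>n. \<Sum>k<n. (?X (Suc k) i - ?X k i))"
      by (simp only: summable_iff_convergent)
    also have "(\<lambda>n. \<Sum>k<n. (?X (Suc k) i - ?X k i)) = (\<lambda>n. ?X n i - ?X 0 i)"
      by (rule ext, rule sum_lessThan_telescope)
    finally show ?thesis by simp
  qed
  define x where "x i = lim (\<lambda>k. ?X k i)" for i
  have lim: "(\<lambda>k. ?X k i) \<longlonglongrightarrow> x i" for i
    using conv[of i] by (simp add: x_def convergent_LIMSEQ_iff)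
  have xR: "nb x R" by (rule nb_limit[OF iterates_ball lim])
  have approx: "nb (\<lambda>i. x i - ?X k i) (q ^ k * R / (1 - q))" for k
  proof (rule nb_limit)
    fix m
    have "q ^ k * R * (\<Sum>j<m. q ^ j) \<le> q ^ k * R * (1 / (1 - q))"
      using q R by (intro mult_left_mono geometric_partial_sum_le) auto
    then show "nb (\<lambda>i. ?X (k + m) i - ?X k i) (q ^ k * R / (1 - q))"
      by (intro nb_mono[OF iterates_Cauchy]) simp
  next
    fix i
    have "(\<lambda>m. ?X (m + k) i) \<longlonglongrightarrow> x i" using lim LIMSEQ_ignore_initial_segment by blast
    then show "(\<lambda>m. ?X (k + m) i - ?X k i) \<longlonglongrightarrow> x i - ?X k i"
      by (intro tendsto_diff tendsto_const) (simp add: add.commute)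
  qed
  have "T x i = x i" for i
  proof -
    have "(\<lambda>k. T x i - ?X (Suc k) i) \<longlonglongrightarrow> 0"
    proof (rule Lim_null_comparison)
      show "\<forall>\<^sub>F k in sequentially. norm (T x i - ?X (Suc k) i) \<le> w i * q * R / (1 - q) * q ^ k"
      proof (rule always_eventually, rule allI)
        fix k
        have "nb (\<lambda>i. T x i - T (?X k) i) (q * (q ^ k * R / (1 - q)))"
          by (rule T_contract[OF xR iterates_ball _ approx]) (use q R in auto)
        from nb_pointwise[OF this, of i]
        show "norm (T x i - ?X (Suc k) i) \<le> w i * q * R / (1 - q) * q ^ k"
          by (simp add: mult_ac)
      qed
      show "(\<lambda>k. w i * q * R / (1 - q) * q ^ k) \<longlonglongrightarrow> 0"
        using q by (intro tendsto_mult_right_zero LIMSEQ_power_zero) auto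
    qed
    moreover have "(\<lambda>k. T x i - ?X (Suc k) i) \<longlonglongrightarrow> T x i - x i"
      using lim[of i] by (intro tendsto_diff tendsto_const LIMSEQ_Suc)
    ultimately have "T x i - x i = 0" using LIMSEQ_unique by blast
    then show ?thesis by simp
  qed
  then have "T x = x" by (rule ext)
  with xR approx show ?thesis by blast
qed

theorem contraction_unique:
  assumes x: "nb x R" "T x = x" and y: "nb y R" "T y = y"
  shows "x = y"
proof
  fix i
  have "nb (\<lambda>i. x i - y i) (q ^ k * (R + R))" for k
  proof (induction k)
    case 0 then show ?case using nb_diff[OF x(1) y(1)] by simp
  next
    case (Suc k)
    then show ?case using T_contract[OF x(1) y(1) _ Suc] q R x(2) y(2) by (simp add: mult.assoc)
  qed
  then have "cmod (x i - y i) \<le> w i * (R + R) * q ^ k" for k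
    using nb_pointwise[of "\<lambda>i. x i - y i" "q ^ k * (R + R)" i] by (simp add: mult_ac)
  moreover have "(\<lambda>k. w i * (R + R) * q ^ k) \<longlonglongrightarrow> 0"
    using q by (intro tendsto_mult_right_zero LIMSEQ_power_zero) auto
  ultimately have "cmod (x i - y i) \<le> 0"
    by (intro LIMSEQ_le_const[of _ 0]) auto
  then show "x i = y i" by simp
qed

end
end

section \<open>Weighted supremum norms and square-summable norms\<close>

definition sup_le :: "('i \<Rightarrow> real) \<Rightarrow> ('i \<Rightarrow> complex) \<Rightarrow> real \<Rightarrow> bool" where
  "sup_le v f B \<longleftrightarrow> (\<forall>i. cmod (f i) \<le> v i * B)"

lemma pointwise_norm_sup_le:
  assumes "\<And>i. 0 \<le> v i"
  shows "pointwise_norm (sup_le v) v"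
proof
  show "sup_le v f C" if "sup_le v f B" "B \<le> C" for f B C
    unfolding sup_le_def
  proof
    fix i show "cmod (f i) \<le> v i * C"
      using that mult_left_mono[OF that(2) assms[of i]] unfolding sup_le_def by (meson order_trans)
  qed
  show "sup_le v (\<lambda>i. f i + g i) (B + C)" if "sup_le v f B" "sup_le v g C" for f g B C
    unfolding sup_le_def
  proof
    fix i show "cmod (f i + g i) \<le> v i * (B + C)"
      using norm_triangle_ineq[of "f i" "g i"] that[unfolded sup_le_def, rule_format, of i]
      by (simp add: distrib_left)
  qed
  show "sup_le v f B" if "\<And>k::nat. sup_le v (g k) B" "\<And>i. (\<lambda>k. g k i) \<longlonglongrightarrow> f i" for f g B
    unfolding sup_le_def
  proof
    fix i show "cmod (f i) \<le> v i * B"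
      by (rule LIMSEQ_le_const2[OF tendsto_norm[OF that(2)]]) (use that(1) in \<open>auto simp:
          sup_le_def\<close>)
  qed
qed (auto simp: sup_le_def)

text \<open>Bounding finite partial sums makes membership and norm a single statement, over any
  index type, which passes to pointwise limits at once.\<close>

definition l2_le :: "('i \<Rightarrow> complex) \<Rightarrow> real \<Rightarrow> bool" where
  "l2_le f B \<longleftrightarrow> (\<forall>F. finite F \<longrightarrow> L2_set (\<lambda>i. cmod (f i)) F \<le> B)"

lemma l2_le_nonneg: "l2_le f B \<Longrightarrow> 0 \<le> B"
  unfolding l2_le_def by (metis L2_set_empty finite.emptyI)

lemma l2_le_pointwise: "l2_le f B \<Longrightarrow> cmod (f i) \<le> B"
  unfolding l2_le_def by (drule spec[of _ "{i}"]) (simp add: L2_set_def)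

lemma l2_le_mono: "l2_le f B \<Longrightarrow> B \<le> C \<Longrightarrow> l2_le f C"
  unfolding l2_le_def by force

lemma l2_le_dominated:
  assumes "l2_le g B" "\<And>i. cmod (f i) \<le> cmod (g i)" shows "l2_le f B"
  unfolding l2_le_def
proof (intro allI impI)
  fix F :: "'a set" assume "finite F"
  have "L2_set (\<lambda>i. cmod (f i)) F \<le> L2_set (\<lambda>i. cmod (g i)) F"
    by (rule L2_set_mono) (auto simp: assms)
  then show "L2_set (\<lambda>i. cmod (f i)) F \<le> B" using assms(1) \<open>finite F\<close> unfolding l2_le_def
      by fastforce
qed

lemma l2_le_zero: "l2_le (\<lambda>_. 0) 0"
  by (simp add: l2_le_def L2_set_def)

lemma l2_le_add:
  assumes "l2_le f B" "l2_le g C" shows "l2_le (\<lambda>i. f i + g i) (B + C)"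
  unfolding l2_le_def
proof (intro allI impI)
  fix F :: "'a set" assume F: "finite F"
  have "L2_set (\<lambda>i. cmod (f i + g i)) F \<le> L2_set (\<lambda>i. cmod (f i) + cmod (g i)) F"
    by (rule L2_set_mono) (auto simp: norm_triangle_ineq)
  also have "\<dots> \<le> L2_set (\<lambda>i. cmod (f i)) F + L2_set (\<lambda>i. cmod (g i)) F"
    by (rule L2_set_triangle_ineq)
  also have "\<dots> \<le> B + C" using assms F unfolding l2_le_def by (simp add: add_mono)
  finally show "L2_set (\<lambda>i. cmod (f i + g i)) F \<le> B + C" .
qed

lemma l2_le_mult: "l2_le f B \<Longrightarrow> l2_le (\<lambda>i. c * f i) (cmod c * B)"
  unfolding l2_le_def by (auto simp: norm_mult L2_set_right_distrib[symmetric] mult_left_mono)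

lemma l2_le_uminus: "l2_le f B \<Longrightarrow> l2_le (\<lambda>i. - f i) B"
  by (simp add: l2_le_def)

lemma l2_le_diff: "l2_le f B \<Longrightarrow> l2_le g C \<Longrightarrow> l2_le (\<lambda>i. f i - g i) (B + C)"
  using l2_le_add[OF _ l2_le_uminus, of f B g C] by simp

lemma l2_le_sum:
  "finite K \<Longrightarrow> (\<And>k. k \<in> K \<Longrightarrow> l2_le (f k) (B k)) \<Longrightarrow> l2_le (\<lambda>i. \<Sum>k\<in>K. f k i) (\<Sum>k\<in>K. B k)"
  by (induction K rule: finite_induct) (auto simp: l2_le_zero intro!: l2_le_add)

lemma l2_le_limit:
  assumes "\<And>k::nat. l2_le (g k) B" "\<And>i. (\<lambda>k. g k i) \<longlonglongrightarrow> f i"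
  shows "l2_le f B"
  unfolding l2_le_def
proof (intro allI impI)
  fix F :: "'a set" assume F: "finite F"
  have "(\<lambda>k. L2_set (\<lambda>i. cmod (g k i)) F) \<longlonglongrightarrow> L2_set (\<lambda>i. cmod (f i)) F"
    unfolding L2_set_def by (intro tendsto_intros assms)
  then show "L2_set (\<lambda>i. cmod (f i)) F \<le> B"
    by (rule LIMSEQ_le_const2) (use assms(1) F in \<open>auto simp: l2_le_def\<close>)
qed

text \<open>An injective change of index can only drop terms of the square sum. Filling up with
  zeros covers the right shifts inside \<open>bwd\<close> and the gluing of half-lines into the
  lattice.\<close>

lemma l2_le_reindex:
  assumes f: "l2_le f B" and h: "inj_on h {i. P i}"
  shows "l2_le (\<lambda>i. if P i then f (h i) else 0) B"
  unfolding l2_le_def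
proof (intro allI impI)
  fix F :: "'b set" assume F: "finite F"
  let ?F = "{i\<in>F. P i}"
  have "(\<Sum>i\<in>F. (cmod (if P i then f (h i) else 0))\<^sup>2) = (\<Sum>i\<in>?F. (cmod (f (h i)))\<^sup>2)"
    using F by (intro sum.mono_neutral_cong_right) auto
  also have "\<dots> = (\<Sum>j\<in>h ` ?F. (cmod (f j))\<^sup>2)"
    using h by (subst sum.reindex) (auto simp: inj_on_def)
  finally have "L2_set (\<lambda>i. cmod (if P i then f (h i) else 0)) F = L2_set (\<lambda>i. cmod (f i)) (h ` ?F)"
    by (simp add: L2_set_def)
  then show "L2_set (\<lambda>i. cmod (if P i then f (h i) else 0)) F \<le> B"
    using f F by (auto simp: l2_le_def)
qed

lemma l2_le_compose: "l2_le f B \<Longrightarrow> inj h \<Longrightarrow> l2_le (\<lambda>i. f (h i)) B"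
  using l2_le_reindex[of f B h "\<lambda>_. True"] by simp

lemma l2_le_sum_bound:
  assumes "\<And>F. finite F \<Longrightarrow> (\<Sum>i\<in>F. cmod (f i)) \<le> B"
  shows "l2_le f B"
  unfolding l2_le_def
proof (intro allI impI)
  fix F :: "'a set" assume "finite F"
  have "L2_set (\<lambda>i. cmod (f i)) F \<le> (\<Sum>i\<in>F. cmod (f i))" by (rule L2_set_le_sum) simp
  then show "L2_set (\<lambda>i. cmod (f i)) F \<le> B" using assms[OF \<open>finite F\<close>] by simp
qed

lemma l2_le_finite_support:
  assumes A: "finite A" and f: "\<And>i. i \<notin> A \<Longrightarrow> f i = 0" "\<And>i. i \<in> A \<Longrightarrow> cmod (f i) \<le> M"
  shows "l2_le f (real (card A) * M)"
proof (rule l2_le_sum_bound)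
  fix F :: "'a set" assume F: "finite F"
  have "(\<Sum>i\<in>F. cmod (f i)) \<le> (\<Sum>i\<in>F \<union> A. cmod (f i))" using F A by (intro sum_mono2) auto
  also have "\<dots> = (\<Sum>i\<in>A. cmod (f i))" using F A f by (intro sum.mono_neutral_right) auto
  also have "\<dots> \<le> real (card A) * M" using f(2) sum_bounded_above[of A "\<lambda>i. cmod (f i)" M] by simp
  finally show "(\<Sum>i\<in>F. cmod (f i)) \<le> real (card A) * M" .
qed

lemma pointwise_norm_l2_le: "pointwise_norm l2_le (\<lambda>_. 1)"
  by unfold_locales
    (auto simp: l2_le_zero l2_le_add l2_le_uminus l2_le_pointwise intro: l2_le_mono l2_le_limit)

text \<open>The norm for the unknown of the Riccati equation, an operator given by its columns
  \<open>j\<close>: the supremum of the norms of the columns.\<close>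

lemma pointwise_norm_column_l2_le:
  "pointwise_norm (\<lambda>X B. \<forall>j. l2_le (\<lambda>i. X (j, i)) B) (\<lambda>_. 1)"
proof
  show "\<forall>j. l2_le (\<lambda>i. f (j, i)) B"
    if "\<And>k::nat. \<forall>j. l2_le (\<lambda>i. g k (j, i)) B" "\<And>i. (\<lambda>k. g k i) \<longlonglongrightarrow> f i"
    for f :: "'a \<times> 'b \<Rightarrow> complex" and g B
  proof
    fix j show "l2_le (\<lambda>i. f (j, i)) B"
      by (rule l2_le_limit[of "\<lambda>k i. g k (j, i)"]) (use that in auto)
  qed
  show "cmod (f i) \<le> 1 * B" if "\<forall>j. l2_le (\<lambda>i. f (j, i)) B" for f :: "'a \<times> 'b \<Rightarrow> complex" and i B
    using that l2_le_pointwise[of "\<lambda>k. f (fst i, k)" B "snd i"] by simp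
qed (auto simp: l2_le_zero l2_le_add l2_le_uminus intro: l2_le_mono)

section \<open>The Dirichlet Laplacian on a half-line\<close>

text \<open>The resolvent of the Dirichlet Laplacian on the half-line \<open>{0, 1, \<dots>}\<close>. With
  \<open>z + 1/z = 2 - w\<close> and the right shift \<open>S\<close>, whose adjoint \<open>S\<^sup>*\<close> satisfies \<open>S\<^sup>*S = 1\<close>,
  one has \<open>z (2 - w - S - S\<^sup>*) = (1 - z S\<^sup>*) (1 - z S)\<close>; \<open>fwd\<close> and \<open>bwd\<close> invert the two factors.\<close>

definition fwd :: "complex \<Rightarrow> (nat \<Rightarrow> complex) \<Rightarrow> nat \<Rightarrow> complex" where
  "fwd z h k = (\<Sum>j. z ^ j * h (k + j))"

definition bwd :: "complex \<Rightarrow> (nat \<Rightarrow> complex) \<Rightarrow> nat \<Rightarrow> complex" where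
  "bwd z g k = (\<Sum>i\<le>k. z ^ i * g (k - i))"

definition half_line :: "complex \<Rightarrow> (nat \<Rightarrow> complex) \<Rightarrow> nat \<Rightarrow> complex" where
  "half_line z h k = z * bwd z (fwd z h) k"

text \<open>Absolute convergence of all series in \<open>fwd z h\<close>. Boundedness of
  \<open>h\<close> gives it for \<open>|z| < 1\<close> and summability for
  \<open>|z| \<le> 1\<close>, so the algebra below serves both situations.\<close>

definition admissible :: "complex \<Rightarrow> (nat \<Rightarrow> complex) \<Rightarrow> bool" where
  "admissible z h \<longleftrightarrow> (\<forall>k. summable (\<lambda>j. cmod (z ^ j * h (k + j))))"

lemma fwd_rec:
  assumes "admissible z h" shows "fwd z h k = h k + z * fwd z h (Suc k)"
proof -
  have s: "summable (\<lambda>j. z ^ j * h (k + j))" "summable (\<lambda>j. z ^ j * h (Suc k + j))"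
    using assms unfolding admissible_def by (blast intro: summable_norm_cancel)+
  have "fwd z h k = z ^ 0 * h (k + 0) + (\<Sum>j. z ^ Suc j * h (k + Suc j))"
    unfolding fwd_def using suminf_split_head[OF s(1)] by simp
  also have "(\<Sum>j. z ^ Suc j * h (k + Suc j)) = (\<Sum>j. z * (z ^ j * h (Suc k + j)))"
    by (simp add: mult.assoc)
  also have "\<dots> = z * fwd z h (Suc k)"
    unfolding fwd_def using suminf_mult[OF s(2)] by simp
  finally show ?thesis by simp
qed

lemma bwd_0: "bwd z g 0 = g 0"
  by (simp add: bwd_def)

lemma bwd_Suc: "bwd z g (Suc k) = g (Suc k) + z * bwd z g k"
  unfolding bwd_def by (subst sum.atMost_Suc_shift) (simp add: sum_distrib_left mult.assoc)

text \<open>The three-term relation arises by eliminating \<open>fwd\<close> between the one-step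
  recursions of \<open>fwd\<close> and \<open>bwd\<close>. The value \<open>0\<close> substituted at
  \<open>k = 0\<close> is the Dirichlet condition beyond the end point.\<close>

lemma half_line_equation:
  assumes "admissible z h"
  shows "(1 + z\<^sup>2) * half_line z h k - z * half_line z h (Suc k)
    - z * (if k = 0 then 0 else half_line z h (k - 1)) = z * h k"
proof -
  define b where "b = bwd z (fwd z h)"
  have 1: "b (Suc k) = fwd z h (Suc k) + z * b k" by (simp add: b_def bwd_Suc)
  have 2: "b k = fwd z h k + z * (if k = 0 then 0 else b (k - 1))"
    by (cases k) (auto simp: b_def bwd_Suc bwd_0)
  have "(1 + z\<^sup>2) * b k - z * b (Suc k) - z * (if k = 0 then 0 else b (k - 1)) = h k"
    using 1 2 fwd_rec[OF assms, of k] by (simp add: algebra_simps power2_eq_square)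
  then have "z * ((1 + z\<^sup>2) * b k - z * b (Suc k) - z * (if k = 0 then 0 else b (k - 1))) = z * h k"
    by simp
  then show ?thesis
    unfolding half_line_def b_def[symmetric] by (cases k) (simp_all add: algebra_simps)
qed

lemma admissible_bounded:
  assumes z: "cmod z < 1" and h: "\<And>k. cmod (h k) \<le> M"
  shows "admissible z h" "cmod (fwd z h k) \<le> M / (1 - cmod z)"
proof -
  have M: "0 \<le> M" using h norm_ge_zero order_trans by blast
  have le: "cmod (z ^ j * h (k + j)) \<le> M * cmod z ^ j" for j k
    using mult_left_mono[OF h[of "k + j"], of "cmod z ^ j"]
    by (simp add: norm_mult norm_power mult.commute)
  have sg: "summable (\<lambda>j. M * cmod z ^ j)" using z by (intro summable_mult summable_geometric) simp
  then show "admissible z h"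
    unfolding admissible_def by (intro allI summable_comparison_test'[OF sg, of 0]) (use le in simp)
  have "cmod (fwd z h k) \<le> (\<Sum>j. M * cmod z ^ j)"
    unfolding fwd_def by (rule norm_suminf_le[OF le sg])
  also have "\<dots> = M / (1 - cmod z)"
    using z by (simp add: suminf_mult suminf_geometric summable_geometric)
  finally show "cmod (fwd z h k) \<le> M / (1 - cmod z)" .
qed

lemma bwd_bounded:
  assumes z: "cmod z < 1" and h: "\<And>k. cmod (h k) \<le> M"
  shows "cmod (bwd z h k) \<le> M / (1 - cmod z)"
proof -
  have M: "0 \<le> M" using h norm_ge_zero order_trans by blast
  have "cmod (bwd z h k) \<le> (\<Sum>i\<le>k. cmod (z ^ i * h (k - i)))" unfolding bwd_def by (rule norm_sum)
  also have "\<dots> \<le> (\<Sum>i\<le>k. M * cmod z ^ i)"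
  proof (rule sum_mono)
    fix i
    show "cmod (z ^ i * h (k - i)) \<le> M * cmod z ^ i"
      using mult_right_mono[OF h[of "k - i"], of "cmod z ^ i"]
          by (simp add: norm_mult norm_power mult.commute)
  qed
  also have "\<dots> \<le> (\<Sum>i. M * cmod z ^ i)"
    using z M by (intro sum_le_suminf summable_mult summable_geometric) auto
  also have "\<dots> = M / (1 - cmod z)"
    using z by (simp add: suminf_mult suminf_geometric summable_geometric)
  finally show ?thesis .
qed

text \<open>One geometric series for each of the two factors. The bound degenerates as
  \<open>|z|\<close> tends to \<open>1\<close> and serves off the bands only.\<close>

lemma half_line_bounded:
  assumes z: "cmod z < 1" and h: "\<And>k. cmod (h k) \<le> M"
  shows "cmod (half_line z h k) \<le> M / (1 - cmod z)\<^sup>2"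
proof -
  have "cmod (half_line z h k) \<le> 1 * (M / (1 - cmod z) / (1 - cmod z))"
    unfolding half_line_def norm_mult
    by (rule mult_mono) (use z bwd_bounded[OF z admissible_bounded(2)[OF z h]] in auto)
  then show ?thesis by (simp add: power2_eq_square)
qed

text \<open>For \<open>y k = u k - z * u (k - 1)\<close> the equation becomes
  \<open>y k - z * y (k + 1) = z * h k\<close>. Its homogeneous solutions are multiples of
  \<open>z^(-k)\<close> and unbounded, so boundedness forces \<open>y = z * fwd z h\<close>, and
  \<open>u\<close> follows by forward recursion.\<close>

lemma half_line_unique:
  assumes z: "cmod z < 1" "z \<noteq> 0" and u: "\<And>k. cmod (u k) \<le> M"
    and eq: "\<And>k. (1 + z\<^sup>2) * u k - z * u (Suc k) - z * (if k = 0 then 0 else u (k - 1)) = z * h k"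
  shows "u = half_line z h"
proof -
  define y where "y k = u k - z * (if k = 0 then 0 else u (k - 1))" for k
  have yh: "y k - z * y (Suc k) = z * h k" for k
    using eq[of k] by (simp add: y_def algebra_simps power2_eq_square)
  have M: "0 \<le> M" using u norm_ge_zero order_trans by blast
  have yb: "cmod (y k) \<le> 2 * M" for k
  proof -
    have "cmod (z * (if k = 0 then 0 else u (k - 1))) \<le> 1 * M"
      unfolding norm_mult by (rule mult_mono) (use z u M in auto)
    then show ?thesis
      unfolding y_def using norm_triangle_ineq4[of "u k" "z * (if k =
          0 then 0 else u (k - 1))"] u[of k]
      by linarith
  qed
  have "y k = z * fwd z h k" for k
  proof -
    have part: "(\<Sum>j<n. z ^ j * (z * h (k + j))) = y k - z ^ n * y (k + n)" for n
    proof (induction n)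
      case (Suc n)
      have "z ^ n * (z * h (k + n)) = z ^ n * y (k + n) - z ^ Suc n * y (k + Suc n)"
        using yh[of "k + n"] by (simp add: algebra_simps)
      then show ?case using Suc by simp
    qed simp
    have "(\<lambda>n. z ^ n * y (k + n)) \<longlonglongrightarrow> 0"
    proof (rule Lim_null_comparison)
      show "\<forall>\<^sub>F n in sequentially. norm (z ^ n * y (k + n)) \<le> 2 * M * cmod z ^ n"
        using mult_left_mono[OF yb] by (auto simp: norm_mult norm_power mult.commute)
      show "(\<lambda>n. 2 * M * cmod z ^ n) \<longlonglongrightarrow> 0"
        using z by (intro tendsto_mult_right_zero LIMSEQ_power_zero) auto
    qed
    then have "(\<lambda>n. y k - z ^ n * y (k + n)) \<longlonglongrightarrow> y k - 0" by (intro tendsto_intros)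
    then have "(\<lambda>j. z ^ j * (z * h (k + j))) sums y k"
      unfolding sums_def part by simp
    then have "(\<lambda>j. z * (z ^ j * h (k + j))) sums y k" by (simp add: mult_ac)
    then have "(\<lambda>j. z * (z ^ j * h (k + j)) / z) sums (y k / z)" by (rule sums_divide)
    then have "(\<lambda>j. z ^ j * h (k + j)) sums (y k / z)" using z(2) by simp
    then have "fwd z h k = y k / z" unfolding fwd_def by (rule sums_unique[symmetric])
    then show ?thesis using z by simp
  qed
  then have y: "y = (\<lambda>k. z * fwd z h k)" by auto
  have "u k = z * bwd z (fwd z h) k" for k
  proof (induction k)
    case 0
    have "u 0 = y 0" by (simp add: y_def)
    then show ?case using y by (simp add: bwd_0)
  next
    case (Suc k)
    have "u (Suc k) = y (Suc k) + z * u k" by (simp add: y_def)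
    then show ?case using y Suc by (simp add: bwd_Suc algebra_simps)
  qed
  then show ?thesis by (auto simp: half_line_def)
qed

text \<open>The half-line form of the \<open>l\<^sup>1\<^sub>1\<close> norm. The weight
  \<open>1 + m\<close>, comparable to the original one, is the distance to the excited
  sites.\<close>

definition weighted_le :: "(nat \<Rightarrow> complex) \<Rightarrow> real \<Rightarrow> bool" where
  "weighted_le h B \<longleftrightarrow> summable (\<lambda>m. (1 + real m) * cmod (h m)) \<and> (\<Sum>m. (1 + real m) * cmod (h m)) \<le> B"

lemma weighted_leI:
  assumes "\<And>n. (\<Sum>m<n. (1 + real m) * cmod (h m)) \<le> B" shows "weighted_le h B"
proof -
  have "summable (\<lambda>m. (1 + real m) * cmod (h m))"
    using assms by (intro bounded_imp_summable[of _ B])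
      (auto simp: lessThan_Suc_atMost[symmetric] simp del: sum.lessThan_Suc)
  then show ?thesis unfolding weighted_le_def using assms by (auto intro: suminf_le_const)
qed

lemma weighted_le_summable: "weighted_le h B \<Longrightarrow> summable (\<lambda>m. cmod (h m))"
  unfolding weighted_le_def
  by (rule summable_comparison_test'[of "\<lambda>m. (1 + real m) * cmod (h m)" 0])
    (auto simp: mult_left_mono distrib_right)

lemma weighted_le_nonneg: "weighted_le h B \<Longrightarrow> 0 \<le> B"
  unfolding weighted_le_def using suminf_nonneg[of "\<lambda>m. (1 + real m) * cmod (h m)"] by fastforce

lemma weighted_le_add:
  assumes "weighted_le f B" "weighted_le g C" shows "weighted_le (\<lambda>m. f m + g m) (B + C)"
proof (rule weighted_leI)
  fix n
  have p: "(\<Sum>m<n. (1 + real m) * cmod (h m)) \<le> D" if "weighted_le h D" for h D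
    using that sum_le_suminf[of "\<lambda>m. (1 + real m) * cmod (h m)" "{..<n}"]
    unfolding weighted_le_def by fastforce
  have "(\<Sum>m<n. (1 + real m) * cmod (f m + g m)) \<le>
    (\<Sum>m<n. (1 + real m) * cmod (f m) + (1 + real m) * cmod (g m))"
    by (intro sum_mono) (simp add: distrib_left[symmetric] mult_left_mono norm_triangle_ineq)
  then show "(\<Sum>m<n. (1 + real m) * cmod (f m + g m)) \<le> B + C"
    using p[OF assms(1)] p[OF assms(2)] by (simp add: sum.distrib)
qed

lemma weighted_le_mult:
  assumes "weighted_le f B" shows "weighted_le (\<lambda>m. c * f m) (cmod c * B)"
proof -
  have "(\<lambda>m. (1 + real m) * cmod (c * f m)) = (\<lambda>m. cmod c * ((1 + real m) * cmod (f m)))"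
    by (auto simp: norm_mult)
  then show ?thesis
    using assms unfolding weighted_le_def by (simp add: summable_mult suminf_mult mult_left_mono)
qed

lemma admissible_weighted:
  assumes z: "cmod z \<le> 1" and h: "summable (\<lambda>m. cmod (h m))"
  shows "admissible z h" "cmod (fwd z h k) \<le> (\<Sum>m. cmod (h (k + m)))"
proof -
  have le: "cmod (z ^ j * h (k + j)) \<le> cmod (h (k + j))" for j k
    using z by (simp add: norm_mult norm_power mult_left_le_one_le power_le_one)
  have sh: "summable (\<lambda>j. cmod (h (k + j)))" for k
    using h summable_ignore_initial_segment[of "\<lambda>m. cmod (h m)" k] by (simp add: add.commute)
  show "admissible z h"
    unfolding admissible_def by (intro allI summable_comparison_test'[OF sh, of 0]) (use le in simp)
  show "cmod (fwd z h k) \<le> (\<Sum>m. cmod (h (k + m)))"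
    unfolding fwd_def by (rule norm_suminf_le[OF le sh])
qed

text \<open>Double counting: \<open>a m\<close> occurs only in the tails that start at
  \<open>0, ..., m\<close>, hence at most \<open>m + 1\<close> times.\<close>

lemma sum_tails_le:
  fixes a :: "nat \<Rightarrow> real"
  assumes "\<And>m. 0 \<le> a m" "summable (\<lambda>m. (1 + real m) * a m)"
  shows "(\<Sum>i\<le>k. \<Sum>m. a (i + m)) \<le> (\<Sum>m. (1 + real m) * a m)"
  using assms
proof (induction k arbitrary: a)
  have sa: "summable a" if "\<And>m. 0 \<le> a m" "summable (\<lambda>m. (1 + real m) * a m)" for a :: "nat \<Rightarrow> real"
    by (rule summable_comparison_test'[OF that(2),
        of 0]) (use that(1) in \<open>auto simp: distrib_right\<close>)
  {
    case 0
    then show ?case using sa[OF 0] by (auto intro!: suminf_le simp: distrib_right)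
  next
    case (Suc k)
    have s: "summable a" by (rule sa[OF Suc.prems])
    have sm: "summable (\<lambda>m. real m * a m)"
      using summable_diff[OF Suc.prems(2) s] by (simp add: algebra_simps)
    then have sm': "summable (\<lambda>m. (1 + real m) * a (Suc m))"
      using summable_Suc_iff[of "\<lambda>m. real m * a m"] by simp
    have "(\<Sum>i\<le>Suc k. \<Sum>m. a (i + m)) = (\<Sum>m. a m) + (\<Sum>i\<le>k. \<Sum>m. a (Suc (i + m)))"
      by (subst sum.atMost_Suc_shift) simp
    also have "(\<Sum>i\<le>k. \<Sum>m. a (Suc (i + m))) \<le> (\<Sum>m. (1 + real m) * a (Suc m))"
      using Suc.IH[of "\<lambda>m. a (Suc m)"] Suc.prems(1) sm' by simp
    also have "(\<Sum>m. (1 + real m) * a (Suc m)) = (\<Sum>m. real m * a m)"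
      using suminf_split_head[OF sm] by simp
    also have "(\<Sum>m. a m) + (\<Sum>m. real m * a m) = (\<Sum>m. (1 + real m) * a m)"
      using suminf_add[OF s sm] by (simp add: algebra_simps)
    finally show ?case by simp
  }
qed

text \<open>Powers of \<open>z\<close> are estimated by \<open>1\<close> rather than summed, at the
  price of the weight \<open>1 + m\<close>. The bound therefore survives on the whole unit circle,
  including \<open>z = 1\<close> and \<open>z = -1\<close>, the ends of the bands.\<close>

lemma half_line_weighted:
  assumes z: "cmod z \<le> 1" and h: "weighted_le h B"
  shows "cmod (half_line z h k) \<le> B"
proof -
  have sh: "summable (\<lambda>m. cmod (h m))" by (rule weighted_le_summable[OF h])
  have "cmod (bwd z (fwd z h) k) \<le> (\<Sum>i\<le>k. cmod (z ^ i * fwd z h (k - i)))"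
    unfolding bwd_def by (rule norm_sum)
  also have "\<dots> \<le> (\<Sum>i\<le>k. \<Sum>m. cmod (h (k - i + m)))"
  proof (rule sum_mono)
    fix i
    have "cmod (z ^ i * fwd z h (k - i)) \<le> cmod (fwd z h (k - i))"
      using z by (simp add: norm_mult norm_power mult_left_le_one_le power_le_one)
    then show "cmod (z ^ i * fwd z h (k - i)) \<le> (\<Sum>m. cmod (h (k - i + m)))"
      using admissible_weighted(2)[OF z sh, of "k - i"] by linarith
  qed
  also have "\<dots> = (\<Sum>i\<le>k. \<Sum>m. cmod (h (i + m)))"
    by (rule sum.nat_diff_reindex[of "\<lambda>i. \<Sum>m. cmod (h (i + m))" "Suc k",
        simplified lessThan_Suc_atMost diff_Suc_Suc])
  also have "\<dots> \<le> (\<Sum>m. (1 + real m) * cmod (h m))"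
    using h unfolding weighted_le_def by (intro sum_tails_le) auto
  also have "\<dots> \<le> B" using h by (simp add: weighted_le_def)
  finally have "cmod (bwd z (fwd z h) k) \<le> B" .
  then show ?thesis
    using mult_left_le_one_le[of "cmod (bwd z (fwd z h) k)" "cmod z"] z
    by (simp add: half_line_def norm_mult)
qed

lemma half_line_add:
  assumes "admissible z h" "admissible z g"
  shows "half_line z (\<lambda>k. h k + g k) k = half_line z h k + half_line z g k"
proof -
  have "fwd z (\<lambda>k. h k + g k) k = fwd z h k + fwd z g k" for k
    using assms suminf_add[of "\<lambda>j. z ^ j * h (k + j)" "\<lambda>j. z ^ j * g (k + j)"]
    unfolding fwd_def admissible_def by (simp add: distrib_left summable_norm_cancel)
  then show ?thesis by (simp add: half_line_def bwd_def distrib_left sum.distrib)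
qed

lemma half_line_uminus:
  assumes "admissible z h" shows "half_line z (\<lambda>k. - h k) k = - half_line z h k"
proof -
  have "fwd z (\<lambda>k. - h k) k = - fwd z h k" for k
    using assms suminf_minus[of "\<lambda>j. z ^ j * h (k + j)"]
    unfolding fwd_def admissible_def by (simp add: summable_norm_cancel)
  then show ?thesis by (simp add: half_line_def bwd_def sum_negf)
qed

lemma admissible_add:
  assumes "admissible z h" "admissible z g" shows "admissible z (\<lambda>k. h k + g k)"
  unfolding admissible_def
proof
  fix k
  have "summable (\<lambda>j. cmod (z ^ j * h (k + j)) + cmod (z ^ j * g (k + j)))"
    using assms unfolding admissible_def by (intro summable_add) auto
  then show "summable (\<lambda>j. cmod (z ^ j * (h (k + j) + g (k + j))))"
    by (rule summable_comparison_test'[of _ 0]) (auto simp: distrib_left norm_triangle_ineq)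
qed

lemma admissible_uminus: "admissible z h \<Longrightarrow> admissible z (\<lambda>k. - h k)"
  by (simp add: admissible_def)

lemma half_line_diff:
  assumes "admissible z h" "admissible z g"
  shows "half_line z (\<lambda>k. h k - g k) k = half_line z h k - half_line z g k"
  using half_line_add[OF assms(1) admissible_uminus[OF assms(2)],
      of k] half_line_uminus[OF assms(2)]
  by simp

text \<open>The triangle inequality for a series of shifted copies of one sequence, applied to
  partial sums and followed by the closure of \<open>l2_le\<close> under pointwise limits.\<close>

lemma l2_le_geometric:
  assumes z: "cmod z < 1" and h: "l2_le h B" and H: "\<And>j. l2_le (H j) B"
    and s: "\<And>k. (\<lambda>j. z ^ j * H j k) sums g k"
  shows "l2_le g (B / (1 - cmod z))"
proof (rule l2_le_limit)
  show "(\<lambda>n. \<Sum>j<n. z ^ j * H j k) \<longlonglongrightarrow> g k" for k using s unfolding sums_def .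
  fix n
  have B: "0 \<le> B" using h l2_le_nonneg by blast
  have sum: "l2_le (\<lambda>k. \<Sum>j<n. z ^ j * H j k) (\<Sum>j<n. cmod (z ^ j) * B)"
    by (intro l2_le_sum l2_le_mult H) auto
  have "(\<Sum>j<n. cmod (z ^ j) * B) \<le> (\<Sum>j. B * cmod z ^ j)"
    using z B by (subst mult.commute, unfold norm_power)
      (intro sum_le_suminf summable_mult summable_geometric, auto)
  moreover have "(\<Sum>j. B * cmod z ^ j) = B / (1 - cmod z)"
    using z by (simp add: suminf_mult suminf_geometric summable_geometric)
  ultimately have "(\<Sum>j<n. cmod (z ^ j) * B) \<le> B / (1 - cmod z)" by simp
  then show "l2_le (\<lambda>k. \<Sum>j<n. z ^ j * H j k) (B / (1 - cmod z))"
    by (rule l2_le_mono[OF sum])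
qed

lemma half_line_l2:
  assumes z: "cmod z < 1" and h: "l2_le h B"
  shows "l2_le (half_line z h) (B / (1 - cmod z)\<^sup>2)"
proof -
  have f: "l2_le (fwd z h) (B / (1 - cmod z))"
  proof (rule l2_le_geometric[OF z h, of "\<lambda>j k. h (k + j)"])
    show "l2_le (\<lambda>k. h (k + j)) B" for j by (rule l2_le_compose[OF h]) (simp add: inj_def)
    have "summable (\<lambda>j. z ^ j * h (k + j))" for k
      using admissible_bounded(1)[OF z, of h B] l2_le_pointwise[OF h]
      by (auto simp: admissible_def intro: summable_norm_cancel)
    then show "(\<lambda>j. z ^ j * h (k + j)) sums fwd z h k" for k
      unfolding fwd_def by (rule summable_sums)
  qed
  have b: "l2_le (bwd z (fwd z h)) (B / (1 - cmod z) / (1 - cmod z))"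
  proof (rule l2_le_geometric[OF z f, of "\<lambda>j k. if j \<le> k then fwd z h (k - j) else 0"])
    show "l2_le (\<lambda>k. if j \<le> k then fwd z h (k - j) else 0) (B / (1 - cmod z))" for j
      by (rule l2_le_reindex[OF f]) (auto simp: inj_on_def)
    show "(\<lambda>j. z ^ j * (if j \<le> k then fwd z h (k - j) else 0)) sums bwd z (fwd z h) k" for k
    proof -
      have "(\<lambda>j. z ^ j * (if j \<le> k then fwd z h (k - j) else 0)) sums
          (\<Sum>j\<le>k. z ^ j * (if j \<le> k then fwd z h (k - j) else 0))"
        by (rule sums_finite) auto
      also have "(\<Sum>j\<le>k. z ^ j * (if j \<le> k then fwd z h (k - j) else 0)) = bwd z (fwd z h) k"
        unfolding bwd_def by (rule sum.cong) auto
      finally show ?thesis .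
    qed
  qed
  have c: "l2_le (\<lambda>k. z * bwd z (fwd z h) k) (cmod z * (B / (1 - cmod z) / (1 - cmod z)))"
    by (rule l2_le_mult[OF b])
  have "cmod z * (B / (1 - cmod z) / (1 - cmod z)) \<le> B / (1 - cmod z)\<^sup>2"
    using mult_left_le_one_le[of "B / (1 - cmod z) / (1 - cmod z)" "cmod z"] l2_le_nonneg[OF b] z
    by (simp add: power2_eq_square)
  then show ?thesis unfolding half_line_def by (rule l2_le_mono[OF c])
qed

text \<open>Dominated convergence for series. Since \<open>|z| \<le> 1\<close>, a summable majorant
  of the right-hand sides dominates for all parameters, which gives continuity up to the unit
  circle.\<close>

lemma half_line_tendsto:
  fixes h :: "'a \<Rightarrow> nat \<Rightarrow> complex"
  assumes F: "F \<noteq> bot" and z: "(zz \<longlongrightarrow> z) F" "\<forall>\<^sub>F t in F. cmod (zz t) \<le> 1"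
    and h: "\<And>m. ((\<lambda>t. h t m) \<longlongrightarrow> g m) F" "\<forall>\<^sub>F t in F. \<forall>m. cmod (h t m) \<le> M m" "summable M"
  shows "((\<lambda>t. half_line (zz t) (h t) k) \<longlongrightarrow> half_line z g k) F"
proof -
  have "((\<lambda>t. fwd (zz t) (h t) k) \<longlongrightarrow> fwd z g k) F" for k
    unfolding fwd_def
  proof (rule tannerys_theorem[THEN conjunct2, THEN conjunct2])
    show "((\<lambda>t. zz t ^ j * h t (k + j)) \<longlongrightarrow> z ^ j * g (k + j)) F" for j
      by (intro tendsto_intros z h)
    have "\<forall>\<^sub>F t in F. \<forall>j. cmod (zz t ^ j * h t (k + j)) \<le> M (k + j)"
      using z(2) h(2)
    proof eventually_elim
      case (elim t)
      show ?case
      proof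
        fix j
        have "cmod (zz t ^ j * h t (k + j)) \<le> cmod (h t (k + j))"
          using elim(1) by (simp add: norm_mult norm_power mult_left_le_one_le power_le_one)
        then show "cmod (zz t ^ j * h t (k + j)) \<le> M (k + j)" using elim(2) order_trans by blast
      qed
    qed
    then show "\<forall>\<^sub>F (j, t) in at_top \<times>\<^sub>F F. cmod (zz t ^ j * h t (k + j)) \<le> M (k + j)"
      unfolding eventually_prod_filter
      by (intro exI[of _ "\<lambda>_. True"] exI[of _ "\<lambda>t. \<forall>j. cmod (zz t ^ j * h t (k + j)) \<le>
          M (k + j)"]) auto
    show "summable (\<lambda>j. M (k + j))"
      using summable_ignore_initial_segment[OF h(3), of k] by (simp add: add.commute)
  qed (fact F)
  then show ?thesis
    unfolding half_line_def bwd_def by (intro tendsto_intros z)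
qed

section \<open>Decoupling at the excited sites\<close>

text \<open>The constant is the value \<open>4\<close> of the series of
  \<open>(1 + m) * (1/2)^m\<close>, whose partial sums have a closed form.\<close>

lemma weighted_le_geometric:
  assumes h: "\<And>k. cmod (h k) \<le> M * (1/2) ^ k" shows "weighted_le h (4 * M)"
proof (rule weighted_leI)
  fix n
  have M: "0 \<le> M" using order_trans[OF norm_ge_zero h[of 0]] by simp
  have s: "(\<Sum>m<n. (1 + real m) * (1/2) ^ m) = 4 - (real n + 2) * 2 * (1/2) ^ n"
  proof (induction n)
    case (Suc n)
    have "(\<Sum>m<Suc n. (1 + real m) * (1/2) ^ m) = 4 - (real n + 2) * 2 * (1/2) ^ n + (1 +
        real n) * (1/2) ^ n"
      using Suc by simp
    also have "\<dots> = 4 - (real (Suc n) + 2) * 2 * (1/2) ^ Suc n" by (simp add: field_simps)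
    finally show ?case .
  qed simp
  have "(\<Sum>m<n. (1 + real m) * cmod (h m)) \<le> (\<Sum>m<n. (1 + real m) * (M * (1/2) ^ m))"
    by (intro sum_mono mult_left_mono h) auto
  also have "\<dots> = M * (\<Sum>m<n. (1 + real m) * (1/2) ^ m)" by (simp add: sum_distrib_left mult_ac)
  also have "\<dots> \<le> M * 4" unfolding s by (intro mult_left_mono M) simp
  finally show "(\<Sum>m<n. (1 + real m) * cmod (h m)) \<le> 4 * M" by simp
qed

lemma weighted_le_mono: "weighted_le h B \<Longrightarrow> B \<le> C \<Longrightarrow> weighted_le h C"
  by (auto simp: weighted_le_def)

lemma weighted_le_single:
  assumes "\<And>k. k > 0 \<Longrightarrow> h k = 0" shows "weighted_le h (cmod (h 0))"
proof (rule weighted_leI)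
  fix n
  have "(\<Sum>m<n. (1 + real m) * cmod (h m)) = (\<Sum>m<n. if m = 0 then cmod (h 0) else 0)"
    by (rule sum.cong) (auto simp: assms)
  then show "(\<Sum>m<n. (1 + real m) * cmod (h m)) \<le> cmod (h 0)" by simp
qed

lemma weighted_le_imp_l2_le: assumes "weighted_le h B" shows "l2_le h B"
proof (rule l2_le_sum_bound)
  fix F :: "nat set" assume F: "finite F"
  have "(\<Sum>i\<in>F. cmod (h i)) \<le> (\<Sum>i\<in>F. (1 + real i) * cmod (h i))"
    by (intro sum_mono) (simp add: distrib_right)
  also have "\<dots> \<le> (\<Sum>i. (1 + real i) * cmod (h i))"
    using assms F unfolding weighted_le_def by (intro sum_le_suminf) auto
  finally show "(\<Sum>i\<in>F. cmod (h i)) \<le> B" using assms by (simp add: weighted_le_def)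
qed

text \<open>The entries of \<open>diag(1, -1)\<close>, indexed by the component.\<close>

definition sg :: "bool \<Rightarrow> complex" where "sg s = (if s then 1 else - 1)"

lemma sg_simps [simp]: "sg True = 1" "sg False = - 1" "cmod (sg s) = 1" "sg s * sg s = 1" "sg s \<noteq> 0"
  by (auto simp: sg_def)

lemma sg_mult_sg [simp]: "sg s * (sg s * x) = x"
  by (auto simp: sg_def)

text \<open>States are functions of a site and a component; \<open>True\<close> selects the first component.
  The excited sites are \<open>a, \<dots>, b\<close>, and \<open>\<Phi>\<close> plays the role of \<open>\<phi>\<^sup>2\<^sup>p\<close>.\<close>

locale dnls_lattice =
  fixes a b :: int and p :: nat and \<epsilon> c :: real and \<Phi> :: "int \<Rightarrow> real"
  assumes ab: "a \<le> b" and eps: "0 < \<epsilon>" and c: "0 < c"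
    and Phi_in: "\<And>n. a \<le> n \<Longrightarrow> n \<le> b \<Longrightarrow> \<bar>\<Phi> n - 1\<bar> \<le> c * \<epsilon>"
    and Phi_right: "\<And>k::nat. \<bar>\<Phi> (b + 1 + int k)\<bar> \<le> c * \<epsilon>\<^sup>2 * (1/2) ^ k"
    and Phi_left: "\<And>k::nat. \<bar>\<Phi> (a - 1 - int k)\<bar> \<le> c * \<epsilon>\<^sup>2 * (1/2) ^ k"
    and small: "(8 * real p + 2) * (4 + c * (1 + 2 * real p)) * \<epsilon> \<le> 1/8"
begin

definition inner :: "int \<Rightarrow> bool" where "inner n \<longleftrightarrow> a \<le> n \<and> n \<le> b"

text \<open>Both half-lines are enumerated outwards from the excited sites (\<open>True\<close> is
  the right one); reflecting the left one makes each a copy of \<open>{0, 1, ...}\<close>.\<close>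

definition site :: "bool \<Rightarrow> nat \<Rightarrow> int" where
  "site r k = (if r then b + 1 + int k else a - 1 - int k)"

definition edge :: "bool \<Rightarrow> int" where "edge r = (if r then b else a)"

definition pos :: "int \<Rightarrow> nat" where "pos n = nat (if n > b then n - b - 1 else a - 1 - n)"

lemma inner_edge [simp]: "inner (edge r)"
  using ab by (simp add: inner_def edge_def)

lemma not_inner_site [simp]: "\<not> inner (site r k)"
  using ab by (auto simp: inner_def site_def)

lemma pos_site [simp]: "pos (site r k) = k"
  using ab by (auto simp: pos_def site_def)

lemma side_site [simp]: "b < site r k \<longleftrightarrow> r"
  using ab by (auto simp: site_def)

lemma site_pos [simp]: "\<not> inner n \<Longrightarrow> site (b < n) (pos n) = n"
  by (auto simp: inner_def site_def pos_def)

lemma outer_cases: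
  assumes "\<not> inner n" obtains r k where "n = site r k"
  using site_pos[OF assms] by metis

lemma neighbours_site:
  "x (site r k + 1) + x (site r k - 1) =
    (x (site r (Suc k)) + (if k = 0 then x (edge r) else x (site r (k - 1))) ::
        'b::ab_semigroup_add)"
  by (cases r; cases k) (auto simp: site_def edge_def algebra_simps)

lemma Phi_site: "\<bar>\<Phi> (site r k)\<bar> \<le> c * \<epsilon>\<^sup>2 * (1/2) ^ k"
  using Phi_right[of k] Phi_left[of k] by (simp add: site_def)

text \<open>A single formula covers both rows of the operator, because the second row is minus the
  first with the components exchanged; this sign is \<open>sg s\<close>.\<close>

definition H :: "(int \<times> bool \<Rightarrow> complex) \<Rightarrow> int \<times> bool \<Rightarrow> complex" where
  "H x = (\<lambda>(n, s). sg s * (of_real \<epsilon> * (2 * x (n, s) - (x (n + 1, s) + x (n - 1, s))) + x (n, s)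
    - of_real (\<Phi> n) * ((1 + of_nat p) * x (n, s) + of_nat p * x (n, \<not> s))))"

text \<open>What couples a half-line to the other states, moved to the right and divided by
  \<open>\<epsilon>\<close>. The potential becomes \<open>O(\<epsilon>)\<close>, whereas the edge
  value keeps the coefficient \<open>1\<close>.\<close>

definition src :: "(int \<times> bool \<Rightarrow> complex) \<Rightarrow> bool \<Rightarrow> bool \<Rightarrow> nat \<Rightarrow> complex" where
  "src x r s k = of_real (\<Phi> (site r k) / \<epsilon>) *
      ((1 + of_nat p) * x (site r k, s) + of_nat p * x (site r k, \<not> s))
    + (if k = 0 then x (edge r, s) else 0)"

definition forcing :: "(int \<times> bool \<Rightarrow> complex) \<Rightarrow> bool \<Rightarrow> bool \<Rightarrow> nat \<Rightarrow> complex" where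
  "forcing f r s k = sg s * f (site r k, s) / of_real \<epsilon>"

text \<open>The equation at an excited site with only the block for \<open>\<Phi> = 1\<close>, and
  \<open>\<Omega>\<close>, kept on the left. Apart from \<open>f\<close>, every term carries a
  factor \<open>\<epsilon>\<close> or \<open>\<Phi> n - 1\<close>.\<close>

definition inner_rhs :: "(int \<times> bool \<Rightarrow> complex) \<Rightarrow> (int \<times> bool \<Rightarrow> complex) \<Rightarrow> int \<Rightarrow> bool \<Rightarrow> complex"
    where
  "inner_rhs f x n s = f (n, s) + sg s * (of_real \<epsilon> * (x (n + 1, s) + x (n - 1, s) - 2 * x (n, s))
    + of_real (\<Phi> n - 1) * ((1 + of_nat p) * x (n, s) + of_nat p * x (n, \<not> s)))"

text \<open>Fixed points of \<open>decoupled\<close> solve \<open>(H - \<Omega>) x = f\<close>: at the sites \<open>a, \<dots>, b\<close> the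
  anticontinuum \<open>2 \<times> 2\<close> block minus \<open>\<Omega>\<close>, of determinant \<open>\<Omega>\<^sup>2\<close>, is inverted,
      and on the two half-lines
  outside the Dirichlet Laplacian is.\<close>

definition decoupled :: "complex \<Rightarrow> (bool \<Rightarrow> complex) \<Rightarrow> (int \<times> bool \<Rightarrow> complex) \<Rightarrow>
    (int \<times> bool \<Rightarrow> complex) \<Rightarrow> int \<times> bool \<Rightarrow> complex" where
  "decoupled \<Omega> z f x = (\<lambda>(n, s). if inner n
     then ((sg s * of_nat p - \<Omega>) * inner_rhs f x n s +
         sg s * of_nat p * inner_rhs f x n (\<not> s)) / \<Omega>\<^sup>2
     else half_line (z s) (\<lambda>k. forcing f (b < n) s k + src x (b < n) s k) (pos n))"

text \<open>Values at excited sites are measured four times as strictly, so that an edge value costs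
  only a quarter in \<open>src\<close>. The opposite factor \<open>4\<close> falls on the equations
  at excited sites, whose coupling is \<open>O(\<epsilon>)\<close>.\<close>

definition wt :: "int \<times> bool \<Rightarrow> real" where "wt i = (if inner (fst i) then 1/4 else 1)"

sublocale weighted_sup: pointwise_norm "sup_le wt" wt
  by (rule pointwise_norm_sup_le) (simp add: wt_def)

lemma sup_le_bounds:
  assumes "sup_le wt x B"
  shows "0 \<le> B" "cmod (x i) \<le> B" "inner n \<Longrightarrow> cmod (x (n, s)) \<le> B / 4"
proof -
  have 1: "cmod (x (a, True)) \<le> B / 4" using assms[unfolded sup_le_def, rule_format, of "(a,
      True)"] ab by (simp add: wt_def inner_def)
  then show B: "0 \<le> B" using norm_ge_zero[of "x (a, True)"] by linarith
  show "inner n \<Longrightarrow> cmod (x (n, s)) \<le> B / 4"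
    using assms[unfolded sup_le_def, rule_format, of "(n, s)"] by (simp add: wt_def)
  have "cmod (x i) \<le> wt i * B" using assms unfolding sup_le_def by (rule spec)
  also have "\<dots> \<le> 1 * B" using B by (intro mult_right_mono) (auto simp: wt_def)
  finally show "cmod (x i) \<le> B" by simp
qed

lemma small': "4 * c * (1 + 2 * real p) * \<epsilon> \<le> 1/4"
proof -
  have "2 * (c * (1 + 2 * real p)) \<le> (8 * real p + 2) * (4 + c * (1 + 2 * real p))"
    using c by (intro mult_mono) auto
  then have "2 * (c * (1 + 2 * real p)) * \<epsilon> \<le> (8 * real p + 2) * (4 + c * (1 + 2 * real p)) * \<epsilon>"
    using eps by (intro mult_right_mono) auto
  then have "2 * (c * (1 + 2 * real p)) * \<epsilon> \<le> 1/8" using small by linarith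
  then show ?thesis by simp
qed

lemma src_diff: "src (\<lambda>i. x i - y i) r s k = src x r s k - src y r s k"
  by (simp add: src_def algebra_simps)

lemma coupling_norm:
  assumes "\<And>s. cmod (x (n, s)) \<le> B"
  shows "cmod ((1 + of_nat p) * x (n, s) + of_nat p * x (n, \<not> s)) \<le> (1 + 2 * real p) * B"
proof -
  have "cmod ((1 + of_nat p) * x (n, s) + of_nat p * x (n, \<not> s)) \<le>
    cmod (1 + of_nat p) * cmod (x (n, s)) + cmod (of_nat p) * cmod (x (n, \<not> s))"
    using norm_triangle_ineq[of "(1 + of_nat p) * x (n, s)" "of_nat p * x (n, \<not> s)"]
        by (simp add: norm_mult)
  also have "cmod (1 + of_nat p) = 1 + real p"
    using norm_of_nat[of "Suc p", where 'a = complex] by simp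
  also have "(1 + real p) * cmod (x (n, s)) + cmod (of_nat p) * cmod (x (n, \<not> s)) \<le>
    (1 + real p) * B + real p * B"
    by (intro add_mono mult_mono assms) auto
  finally show ?thesis by (simp add: algebra_simps)
qed

lemma src_potential_bound:
  assumes x: "sup_le wt x B"
  shows "cmod (of_real (\<Phi> (site r k) / \<epsilon>) *
      ((1 + of_nat p) * x (site r k, s) + of_nat p * x (site r k, \<not> s)))
    \<le> c * \<epsilon> * (1 + 2 * real p) * B * (1/2) ^ k" (is "cmod ?g \<le> _")
proof -
  have "\<bar>\<Phi> (site r k) / \<epsilon>\<bar> \<le> c * \<epsilon>\<^sup>2 * (1/2) ^ k / \<epsilon>"
    using Phi_site[of r k] eps by (simp add: abs_divide divide_right_mono)
  also have "\<dots> = c * \<epsilon> * (1/2) ^ k" using eps by (simp add: power2_eq_square)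
  finally have "cmod ?g \<le> (c * \<epsilon> * (1/2) ^ k) * ((1 + 2 * real p) * B)"
    unfolding norm_mult norm_of_real using c eps
    by (intro mult_mono coupling_norm sup_le_bounds[OF x]) auto
  then show ?thesis by (simp only: mult_ac)
qed

text \<open>The half is \<open>1/4 + 1/4\<close>: the potential contributes a quarter by
  \<open>small'\<close>, the edge value a quarter by the choice of \<open>wt\<close>.\<close>

lemma src_weighted:
  assumes x: "sup_le wt x B" shows "weighted_le (src x r s) (B / 2)"
proof -
  note B = sup_le_bounds[OF x]
  let ?g = "\<lambda>k. of_real (\<Phi> (site r k) / \<epsilon>) *
      ((1 + of_nat p) * x (site r k, s) + of_nat p * x (site r k, \<not> s))"
  let ?e = "\<lambda>k::nat. if k = 0 then x (edge r, s) else 0"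
  have "weighted_le ?g (4 * (c * \<epsilon> * (1 + 2 * real p) * B))"
    by (rule weighted_le_geometric[OF src_potential_bound[OF x]])
  moreover have "weighted_le ?e (cmod (?e 0))" by (rule weighted_le_single) simp
  ultimately have sum: "weighted_le (\<lambda>k. ?g k + ?e k) (4 * (c * \<epsilon> * (1 + 2 * real p) * B) +
      cmod (?e 0))"
    by (rule weighted_le_add)
  have "4 * (c * \<epsilon> * (1 + 2 * real p) * B) + cmod (?e 0) \<le> B / 2"
  proof -
    have "4 * (c * \<epsilon> * (1 + 2 * real p) * B) = 4 * c * (1 + 2 * real p) * \<epsilon> * B"
        by (simp only: mult_ac)
    also have "\<dots> \<le> 1/4 * B" by (rule mult_right_mono[OF small' B(1)])
    finally show ?thesis using B(3)[of "edge r" s] by simp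
  qed
  then show ?thesis unfolding src_def by (rule weighted_le_mono[OF sum])
qed

lemma src_pointwise:
  assumes x: "sup_le wt x B"
  shows "cmod (src x r s k) \<le> c * \<epsilon> * (1 + 2 * real p) * B * (1/2) ^ k + (if k = 0 then B else 0)"
  unfolding src_def using sup_le_bounds(2)[OF x, of "(edge r, s)"]
  by (intro order_trans[OF norm_triangle_ineq] add_mono src_potential_bound[OF x]) auto

lemma src_admissible: "cmod z \<le> 1 \<Longrightarrow> sup_le wt x B \<Longrightarrow> admissible z (src x r s)"
  by (rule admissible_weighted(1)[OF _ weighted_le_summable[OF src_weighted]])

lemma inner_rhs_diff:
  "inner_rhs f x n s - inner_rhs f y n s = inner_rhs (\<lambda>_. 0) (\<lambda>i. x i - y i) n s"
  by (simp add: inner_rhs_def algebra_simps)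

lemma inner_rhs_norm:
  assumes n: "inner n" and x: "\<And>i. cmod (x i) \<le> B"
  shows "cmod (inner_rhs (\<lambda>_. 0) x n s) \<le> (4 + c * (1 + 2 * real p)) * \<epsilon> * B"
proof -
  have "cmod (x (n + 1, s) + x (n - 1, s) - 2 * x (n, s)) \<le> B + B + 2 * B"
    using norm_triangle_ineq4[of "x (n + 1, s) + x (n - 1, s)" "2 * x (n, s)"]
      norm_triangle_ineq[of "x (n + 1, s)" "x (n - 1, s)"] x[of "(n + 1, s)"] x[of "(n - 1,
          s)"] x[of "(n, s)"]
    by (simp add: norm_mult)
  then have 1: "cmod (of_real \<epsilon> * (x (n + 1, s) + x (n - 1, s) - 2 * x (n, s))) \<le> \<epsilon> * (4 * B)"
    using eps by (simp add: norm_mult mult_left_mono)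
  have 2: "cmod (of_real (\<Phi> n - 1) * ((1 + of_nat p) * x (n, s) + of_nat p * x (n, \<not> s)))
      \<le> (c * \<epsilon>) * ((1 + 2 * real p) * B)"
    unfolding norm_mult norm_of_real
    using Phi_in[of n] n c eps by (intro mult_mono coupling_norm x) (auto simp: inner_def)
  have "cmod (inner_rhs (\<lambda>_. 0) x n s) \<le> \<epsilon> * (4 * B) + (c * \<epsilon>) * ((1 + 2 * real p) * B)"
    unfolding inner_rhs_def by (simp only: add_0 norm_mult sg_simps mult_1)
      (rule order_trans[OF norm_triangle_ineq add_mono[OF 1 2]])
  then show ?thesis by (simp add: algebra_simps)
qed

text \<open>The constant comes from \<open>2 p \<le> 8 p |\<Omega>|^2\<close> and
  \<open>|\<Omega>| \<le> 2 |\<Omega>|^2\<close>, both consequences of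
  \<open>|\<Omega>| \<ge> 1/2\<close>. It is uniform for large \<open>\<Omega>\<close> as
  well.\<close>

lemma block_inverse_norm:
  assumes \<Omega>: "1/2 \<le> cmod \<Omega>" and "\<And>s. cmod (r s) \<le> M"
  shows "cmod (((sg s * of_nat p - \<Omega>) * r s + sg s * of_nat p * r (\<not> s)) / \<Omega>\<^sup>2) \<le>
      (8 * real p + 2) * M"
proof -
  have M: "0 \<le> M" using assms(2) norm_ge_zero order_trans by blast
  have "cmod (sg s * of_nat p - \<Omega>) \<le> real p + cmod \<Omega>"
    using norm_triangle_ineq4[of "sg s * of_nat p" \<Omega>] by (simp add: norm_mult)
  then have "cmod ((sg s * of_nat p - \<Omega>) * r s) \<le> (real p + cmod \<Omega>) * M"
    unfolding norm_mult using assms M by (intro mult_mono) auto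
  moreover have "cmod (sg s * of_nat p * r (\<not> s)) \<le> real p * M"
    using assms M by (simp add: norm_mult mult_left_mono)
  ultimately have 1: "cmod ((sg s * of_nat p - \<Omega>) * r s + sg s * of_nat p * r (\<not> s)) \<le>
      (2 * real p + cmod \<Omega>) * M"
    using norm_triangle_ineq[of "(sg s * of_nat p - \<Omega>) * r s" "sg s * of_nat p * r (\<not> s)"]
    by (simp add: algebra_simps)
  have sq: "1/4 \<le> (cmod \<Omega>)\<^sup>2" using power_mono[OF \<Omega>, of 2] by (simp add: power2_eq_square)
  have "2 * real p + cmod \<Omega> \<le> (8 * real p + 2) * (cmod \<Omega>)\<^sup>2"
  proof -
    have "2 * real p \<le> 8 * real p * (cmod \<Omega>)\<^sup>2" using mult_left_mono[OF sq, of "8 * real p"] by simp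
    moreover have "cmod \<Omega> \<le> 2 * (cmod \<Omega>)\<^sup>2"
      using mult_right_mono[OF \<Omega>, of "2 * cmod \<Omega>"] by (simp add: power2_eq_square)
    ultimately show ?thesis by (simp add: algebra_simps)
  qed
  then have "(2 * real p + cmod \<Omega>) * M \<le> (8 * real p + 2) * (cmod \<Omega>)\<^sup>2 * M"
    using M by (rule mult_right_mono)
  then have "cmod ((sg s * of_nat p - \<Omega>) * r s + sg s * of_nat p * r (\<not> s)) \<le>
      (8 * real p + 2) * M * (cmod \<Omega>)\<^sup>2"
    using 1 by (simp add: mult_ac)
  moreover have "0 < (cmod \<Omega>)\<^sup>2" using sq by linarith
  ultimately show ?thesis by (simp add: norm_divide norm_power pos_divide_le_eq)
qed

text \<open>On the half-lines the factor \<open>1/2\<close> is that of \<open>src_weighted\<close>.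
  At excited sites it has to be combined with the weight \<open>1/4\<close>, which is the origin of
  the bound \<open>1/8\<close> in the assumption \<open>small\<close>.\<close>

lemma decoupled_contract:
  assumes \<Omega>: "1/2 \<le> cmod \<Omega>" and z: "\<And>s. cmod (z s) \<le> 1"
    and f: "\<And>r s. admissible (z s) (forcing f r s)"
    and x: "sup_le wt x B" and y: "sup_le wt y B'" and xy: "sup_le wt (\<lambda>i. x i - y i) C"
  shows "sup_le wt (\<lambda>i. decoupled \<Omega> z f x i - decoupled \<Omega> z f y i) (1/2 * C)"
  unfolding sup_le_def
proof
  fix i :: "int \<times> bool" obtain n s where i: "i = (n, s)" by (cases i)
  note C = sup_le_bounds[OF xy]
  show "cmod (decoupled \<Omega> z f x i - decoupled \<Omega> z f y i) \<le> wt i * (1/2 * C)"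
  proof (cases "inner n")
    case True
    let ?r = "\<lambda>s. inner_rhs (\<lambda>_. 0) (\<lambda>i. x i - y i) n s"
    have "decoupled \<Omega> z f x i - decoupled \<Omega> z f y i =
        ((sg s * of_nat p - \<Omega>) * ?r s + sg s * of_nat p * ?r (\<not> s)) / \<Omega>\<^sup>2"
      unfolding inner_rhs_diff[of f x n _ y, symmetric] using True
      by (simp add: i decoupled_def diff_divide_distrib[symmetric] algebra_simps)
    also have "cmod \<dots> \<le> (8 * real p + 2) * ((4 + c * (1 + 2 * real p)) * \<epsilon> * C)"
      by (rule block_inverse_norm[OF \<Omega> inner_rhs_norm[OF True C(2)]])
    also have "\<dots> \<le> 1/8 * C"
      using mult_right_mono[OF small C(1)] by (simp add: mult.assoc)
    finally show ?thesis using True by (simp add: i wt_def)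
  next
    case False
    let ?r = "b < n"
    have adm: "admissible (z s) (\<lambda>k. forcing f ?r s k + src x ?r s k)"
      "admissible (z s) (\<lambda>k. forcing f ?r s k + src y ?r s k)"
      using admissible_add[OF f src_admissible[OF z x]] admissible_add[OF f src_admissible[OF z y]]
      by auto
    have "decoupled \<Omega> z f x i - decoupled \<Omega> z f y i =
        half_line (z s) (src (\<lambda>i. x i - y i) ?r s) (pos n)"
      using False half_line_diff[OF adm, of "pos n"]
      by (simp add: i decoupled_def src_diff[abs_def])
    also have "cmod \<dots> \<le> C / 2" by (rule half_line_weighted[OF z src_weighted[OF xy]])
    finally show ?thesis using False by (simp add: i wt_def)
  qed
qed

lemma decoupled_zero_bound:
  assumes \<Omega>: "1/2 \<le> cmod \<Omega>"
    and f: "\<And>n s. inner n \<Longrightarrow> cmod (f (n, s)) \<le> F"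
      "\<And>r s k. cmod (half_line (z s) (forcing f r s) k) \<le> F'"
    and D: "4 * (8 * real p + 2) * F \<le> D" "F' \<le> D"
  shows "sup_le wt (decoupled \<Omega> z f (\<lambda>_. 0)) D"
  unfolding sup_le_def
proof
  fix i :: "int \<times> bool" obtain n s where i: "i = (n, s)" by (cases i)
  show "cmod (decoupled \<Omega> z f (\<lambda>_. 0) i) \<le> wt i * D"
  proof (cases "inner n")
    case True
    have "cmod (decoupled \<Omega> z f (\<lambda>_. 0) i) =
      cmod (((sg s * of_nat p - \<Omega>) * f (n, s) + sg s * of_nat p * f (n, \<not> s)) / \<Omega>\<^sup>2)"
      using True by (simp add: i decoupled_def inner_rhs_def)
    also have "\<dots> \<le> (8 * real p + 2) * F"
      by (rule block_inverse_norm[OF \<Omega>, of "\<lambda>s. f (n, s)"]) (rule f(1)[OF True])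
    finally have "4 * cmod (decoupled \<Omega> z f (\<lambda>_. 0) i) \<le> 4 * ((8 * real p + 2) * F)"
      by (intro mult_left_mono) auto
    also have "\<dots> \<le> D" using D(1) by (simp only: mult.assoc)
    finally show ?thesis using True by (simp add: i wt_def)
  next
    case False
    have "src (\<lambda>_. 0) r s k = 0" for r s k by (simp add: src_def)
    then show ?thesis using False order_trans[OF f(2) D(2)] by (simp add: i decoupled_def wt_def)
  qed
qed

text \<open>With \<open>w = (\<plusminus>\<Omega> - 1) / \<epsilon>\<close>, this is the relation \<open>z + 1/z = 2 - w\<close> for either component.\<close>

definition band_roots :: "complex \<Rightarrow> (bool \<Rightarrow> complex) \<Rightarrow> bool" where
  "band_roots \<Omega> z \<longleftrightarrow> (\<forall>s. z s \<noteq> 0 \<and> of_real \<epsilon> * (1 + (z s)\<^sup>2) =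
      z s * (2 * of_real \<epsilon> + 1 - sg s * \<Omega>))"

section \<open>Fixed points versus solutions of \<open>(H - \<Omega>) x = f\<close>\<close>

lemma decoupled_solves:
  assumes \<Omega>: "1/2 \<le> cmod \<Omega>" and z: "\<And>s. cmod (z s) \<le> 1" "band_roots \<Omega> z"
    and f: "\<And>r s. admissible (z s) (forcing f r s)"
    and x: "sup_le wt x B" "decoupled \<Omega> z f x = x"
  shows "H x i - \<Omega> * x i = f i"
proof -
  obtain n s where i: "i = (n, s)" by (cases i)
  have \<Omega>0: "\<Omega> \<noteq> 0" using \<Omega> by auto
  show ?thesis
  proof (cases "inner n")
    case True
    let ?r = "inner_rhs f x n"
    have xe: "x (n, s) = ((sg s * of_nat p - \<Omega>) * ?r s + sg s * of_nat p * ?r (\<not> s)) / \<Omega>\<^sup>2" for s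
      using True fun_cong[OF x(2), of "(n, s)"] by (simp add: decoupled_def)
    have \<Omega>x: "\<Omega>\<^sup>2 * x (n, s) = (sg s * of_nat p - \<Omega>) * ?r s + sg s * of_nat p * ?r (\<not> s)" for s
      unfolding xe[of s] using \<Omega>0 by simp
    \<comment> \<open>The block \<open>B\<close> satisfies \<open>B^2 = 0\<close>, so
      \<open>(B - \<Omega>) (- B - \<Omega>) = \<Omega>^2\<close>; the two matrices here are these
      factors.\<close>
    have "\<Omega>\<^sup>2 * ((- (sg s * of_nat p) - \<Omega>) * x (n, s) - sg s * of_nat p * x (n, \<not> s)) = \<Omega>\<^sup>2 * ?r s"
    proof -
      have "\<Omega>\<^sup>2 * ((- (sg s * of_nat p) - \<Omega>) * x (n, s) - sg s * of_nat p * x (n, \<not> s)) =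
        (- (sg s * of_nat p) - \<Omega>) * (\<Omega>\<^sup>2 * x (n, s)) - sg s * of_nat p * (\<Omega>\<^sup>2 * x (n, \<not> s))"
        by (simp add: algebra_simps)
      also have "\<dots> = \<Omega>\<^sup>2 * ?r s"
        unfolding \<Omega>x by (cases s) (simp_all add: algebra_simps power2_eq_square)
      finally show ?thesis .
    qed
    then have "(- (sg s * of_nat p) - \<Omega>) * x (n, s) - sg s * of_nat p * x (n, \<not> s) = ?r s"
      using \<Omega>0 by simp
    then show ?thesis
      by (simp add: i H_def inner_rhs_def algebra_simps)
  next
    case False
    then obtain r k where n: "n = site r k" by (rule outer_cases)
    let ?h = "\<lambda>k. forcing f r s k + src x r s k"
    have X: "x (site r k, s) = half_line (z s) ?h k" for k
      using fun_cong[OF x(2), of "(site r k, s)"] by (simp add: decoupled_def)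
    have adm: "admissible (z s) ?h" using admissible_add[OF f src_admissible[OF z(1) x(1)]] .
    have z0: "z s \<noteq> 0" and zr: "of_real \<epsilon> * (1 + (z s)\<^sup>2) = z s * (2 * of_real \<epsilon> + 1 - sg s * \<Omega>)"
      using z(2) by (auto simp: band_roots_def)
    let ?q = "if k = 0 then 0 else x (site r (k - 1), s)"
    have "(1 + (z s)\<^sup>2) * x (n, s) - z s * x (site r (Suc k), s) - z s * ?q = z s * ?h k"
      unfolding n using half_line_equation[OF adm, of k] by (cases k) (simp_all add: X)
    then have "of_real \<epsilon> * (1 + (z s)\<^sup>2) * x (n, s) - z s * (of_real \<epsilon> * (x (site r (Suc k), s) +
        ?q)) =
        z s * (of_real \<epsilon> * ?h k)"
    proof -
      assume e: "(1 + (z s)\<^sup>2) * x (n, s) - z s * x (site r (Suc k), s) - z s * ?q = z s * ?h k"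
      have "of_real \<epsilon> * (1 + (z s)\<^sup>2) * x (n, s) - z s * (of_real \<epsilon> * (x (site r (Suc k), s) +
          ?q)) =
        of_real \<epsilon> * ((1 + (z s)\<^sup>2) * x (n, s) - z s * x (site r (Suc k), s) - z s * ?q)"
        by (simp add: algebra_simps)
      also have "\<dots> = z s * (of_real \<epsilon> * ?h k)" unfolding e by simp
      finally show ?thesis .
    qed
    then have "z s * ((2 * of_real \<epsilon> + 1 - sg s * \<Omega>) * x (n, s) - of_real \<epsilon> * (x (site r (Suc k),
        s) + ?q)) =
        z s * (of_real \<epsilon> * ?h k)"
      unfolding zr by (simp add: algebra_simps)
    then have eq: "(2 * of_real \<epsilon> + 1 - sg s * \<Omega>) * x (n, s) - of_real \<epsilon> * (x (site r (Suc k),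
        s) + ?q) =
        of_real \<epsilon> * ?h k"
      using z0 by (simp only: mult_cancel_left) simp
    have nb: "x (n + 1, s) + x (n - 1, s) = x (site r (Suc k), s) + ?q + (if k =
        0 then x (edge r, s) else 0)"
      unfolding n using neighbours_site[of "\<lambda>m. x (m, s)" r k] by simp
    have eh: "of_real \<epsilon> * ?h k = sg s * f (n, s) +
        of_real (\<Phi> n) * ((1 + of_nat p) * x (n, s) + of_nat p * x (n, \<not> s))
        + of_real \<epsilon> * (if k = 0 then x (edge r, s) else 0)"
      using eps by (simp add: forcing_def src_def n distrib_left)
    have "sg s * (H x i - \<Omega> * x i) = sg s * f i"
    proof -
      have "sg s * (H x i - \<Omega> * x i) = (2 * of_real \<epsilon> + 1 - sg s * \<Omega>) * x (n, s)
          - of_real \<epsilon> * (x (n + 1, s) + x (n - 1, s))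
          - of_real (\<Phi> n) * ((1 + of_nat p) * x (n, s) + of_nat p * x (n, \<not> s))"
        by (simp add: i H_def right_diff_distrib) (simp add: algebra_simps)
      also have "\<dots> = sg s * f i"
        unfolding nb using eq eh by (simp add: i algebra_simps)
      finally show ?thesis .
    qed
    then show ?thesis by simp
  qed
qed

text \<open>Converse of \<open>decoupled_solves\<close> for bounded solutions; the strict inequality
  \<open>|z| < 1\<close> enters through \<open>half_line_unique\<close>. It identifies resolvent
  values with fixed points, to which the uniqueness of contractions applies.\<close>

lemma decoupled_unique:
  assumes \<Omega>: "1/2 \<le> cmod \<Omega>" and z: "\<And>s. cmod (z s) < 1" "band_roots \<Omega> z"
    and x: "\<And>i. cmod (x i) \<le> M" and eq: "\<And>i. H x i - \<Omega> * x i = f i"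
  shows "decoupled \<Omega> z f x = x"
proof
  fix i :: "int \<times> bool" obtain n s where i: "i = (n, s)" by (cases i)
  have \<Omega>0: "\<Omega> \<noteq> 0" using \<Omega> by auto
  show "decoupled \<Omega> z f x i = x i"
  proof (cases "inner n")
    case True
    let ?r = "inner_rhs f x n"
    have r: "?r s = (- (sg s * of_nat p) - \<Omega>) * x (n, s) - sg s * of_nat p * x (n, \<not> s)" for s
      unfolding inner_rhs_def eq[symmetric] by (simp add: H_def algebra_simps)
    have "(sg s * of_nat p - \<Omega>) * ?r s + sg s * of_nat p * ?r (\<not> s) = \<Omega>\<^sup>2 * x (n, s)"
      unfolding r by (cases s) (simp_all add: algebra_simps power2_eq_square)
    then show ?thesis using True \<Omega>0 by (simp add: i decoupled_def)
  next
    case False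
    then obtain r k where n: "n = site r k" by (rule outer_cases)
    let ?h = "\<lambda>k. forcing f r s k + src x r s k"
    have z0: "z s \<noteq> 0" and zr: "of_real \<epsilon> * (1 + (z s)\<^sup>2) = z s * (2 * of_real \<epsilon> + 1 - sg s * \<Omega>)"
      using z(2) by (auto simp: band_roots_def)
    have "(\<lambda>k. x (site r k, s)) = half_line (z s) ?h"
    proof (rule half_line_unique[OF z(1) z0])
      show "cmod (x (site r k, s)) \<le> M" for k by (rule x)
      fix k
      let ?q = "if k = 0 then 0 else x (site r (k - 1), s)"
      let ?n = "site r k"
      have nb: "x (?n + 1, s) + x (?n - 1, s) = x (site r (Suc k), s) + ?q + (if k =
          0 then x (edge r, s) else 0)"
        using neighbours_site[of "\<lambda>m. x (m, s)" r k] by simp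
      have "sg s * f (?n, s) = (2 * of_real \<epsilon> + 1 - sg s * \<Omega>) * x (?n, s)
          - of_real \<epsilon> * (x (?n + 1, s) + x (?n - 1, s))
          - of_real (\<Phi> ?n) * ((1 + of_nat p) * x (?n, s) + of_nat p * x (?n, \<not> s))"
        unfolding eq[symmetric] by (simp add: H_def right_diff_distrib) (simp add: algebra_simps)
      moreover have "of_real \<epsilon> * ?h k = sg s * f (?n, s) +
        of_real (\<Phi> ?n) * ((1 + of_nat p) * x (?n, s) + of_nat p * x (?n, \<not> s))
        + of_real \<epsilon> * (if k = 0 then x (edge r, s) else 0)"
        using eps by (simp add: forcing_def src_def distrib_left)
      ultimately have e: "of_real \<epsilon> * ?h k = (2 * of_real \<epsilon> + 1 - sg s * \<Omega>) * x (?n, s)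
          - of_real \<epsilon> * (x (site r (Suc k), s) + ?q)"
        unfolding nb by (simp add: algebra_simps)
      have "of_real \<epsilon> * ((1 + (z s)\<^sup>2) * x (?n, s) - z s * x (site r (Suc k), s) - z s * ?q) =
         of_real \<epsilon> * (1 + (z s)\<^sup>2) * x (?n, s) - z s * (of_real \<epsilon> * (x (site r (Suc k), s) + ?q))"
        by (simp add: algebra_simps)
      also have "\<dots> = z s * (of_real \<epsilon> * ?h k)"
        unfolding zr e by (simp add: algebra_simps)
      also have "\<dots> = of_real \<epsilon> * (z s * ?h k)" by simp
      finally show "(1 + (z s)\<^sup>2) * x (?n, s) - z s * x (site r (Suc k), s) - z s * ?q = z s * ?h k"
        using eps by (simp only: mult_cancel_left) simp
    qed
    then have "x (site r k, s) = half_line (z s) ?h k" by metis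
    then show ?thesis by (simp add: i n decoupled_def)
  qed
qed

end

section \<open>The resolvent away from zero and its boundary values\<close>

context dnls_lattice
begin

lemma decoupled_ball:
  assumes \<Omega>: "1/2 \<le> cmod \<Omega>" and z: "\<And>s. cmod (z s) \<le> 1"
    and f: "\<And>r s. admissible (z s) (forcing f r s)"
    and D: "sup_le wt (decoupled \<Omega> z f (\<lambda>_. 0)) D" "2 * D \<le> R"
    and x: "sup_le wt x R"
  shows "sup_le wt (decoupled \<Omega> z f x) R"
proof -
  have R0: "sup_le wt (\<lambda>_. 0) R"
    using weighted_sup.nb_mono[OF weighted_sup.nb_zero] sup_le_bounds(1)[OF x] by blast
  have "sup_le wt (\<lambda>i. decoupled \<Omega> z f x i - decoupled \<Omega> z f (\<lambda>_. 0) i) (1/2 * R)"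
    by (rule decoupled_contract[OF \<Omega> z f x R0]) (use x in simp_all)
  from weighted_sup.nb_add[OF this D(1)] have "sup_le wt (decoupled \<Omega> z f x) (1/2 * R + D)" by simp
  then show ?thesis by (rule weighted_sup.nb_mono) (use D(2) in simp)
qed

text \<open>The rate of convergence and the bound on all iterates are recorded as well. They involve
  \<open>\<Omega>\<close> and \<open>z\<close> only through \<open>D\<close>, hence are uniform
  wherever \<open>D\<close> is.\<close>

lemma decoupled_fixed_point:
  assumes \<Omega>: "1/2 \<le> cmod \<Omega>" and z: "\<And>s. cmod (z s) \<le> 1"
    and f: "\<And>r s. admissible (z s) (forcing f r s)"
    and D: "sup_le wt (decoupled \<Omega> z f (\<lambda>_. 0)) D"
  shows "\<exists>x. sup_le wt x (2 * D) \<and> decoupled \<Omega> z f x = x \<and>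
    (\<forall>k. sup_le wt (\<lambda>i. x i - (decoupled \<Omega> z f ^^ k) (\<lambda>_. 0) i) ((1/2) ^ k * (4 * D))) \<and>
    (\<forall>k. sup_le wt ((decoupled \<Omega> z f ^^ k) (\<lambda>_. 0)) (2 * D))"
proof -
  have D0: "0 \<le> 2 * D" using sup_le_bounds(1)[OF D] by simp
  have ball: "sup_le wt (decoupled \<Omega> z f x) (2 * D)" if "sup_le wt x (2 * D)" for x
    by (rule decoupled_ball[OF \<Omega> z f D _ that]) simp
  have con: "sup_le wt (\<lambda>i. decoupled \<Omega> z f x i - decoupled \<Omega> z f y i) (1/2 * C)"
    if "sup_le wt x (2 * D)" "sup_le wt y (2 * D)" "0 \<le> C" "sup_le wt (\<lambda>i. x i - y i) C" for x y C
    by (rule decoupled_contract[OF \<Omega> z f that(1,2,4)])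
  from weighted_sup.contraction_fixed_point[of "1/2" "2 * D" "decoupled \<Omega> z f", OF _ _ D0 ball con]
  obtain x where x: "sup_le wt x (2 * D)" "decoupled \<Omega> z f x = x"
    "\<And>k. sup_le wt (\<lambda>i. x i - (decoupled \<Omega> z f ^^ k) (\<lambda>_. 0) i) ((1/2) ^ k * (2 * D) / (1 - 1/2))"
    by auto
  moreover have "sup_le wt ((decoupled \<Omega> z f ^^ k) (\<lambda>_. 0)) (2 * D)" for k
    by (rule weighted_sup.iterates_ball[of "1/2", OF _ _ D0 ball con]) auto
  moreover have "(1/2) ^ k * (2 * D) / (1 - 1/2) = (1/2) ^ k * (4 * D)" for k by simp
  ultimately show ?thesis by metis
qed

lemma decoupled_fixed_point_unique:
  assumes \<Omega>: "1/2 \<le> cmod \<Omega>" and z: "\<And>s. cmod (z s) \<le> 1"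
    and f: "\<And>r s. admissible (z s) (forcing f r s)"
    and D: "sup_le wt (decoupled \<Omega> z f (\<lambda>_. 0)) D"
    and x: "sup_le wt x B" "decoupled \<Omega> z f x = x"
    and y: "sup_le wt y C" "decoupled \<Omega> z f y = y"
  shows "x = y"
proof -
  define R where "R = max (2 * D) (max B C)"
  have R: "0 \<le> R" "2 * D \<le> R" using sup_le_bounds(1)[OF D] by (auto simp: R_def)
  have ball: "sup_le wt (decoupled \<Omega> z f x) R" if "sup_le wt x R" for x
    by (rule decoupled_ball[OF \<Omega> z f D R(2) that])
  have con: "sup_le wt (\<lambda>i. decoupled \<Omega> z f x i - decoupled \<Omega> z f y i) (1/2 * C)"
    if "sup_le wt x R" "sup_le wt y R" "0 \<le> C" "sup_le wt (\<lambda>i. x i - y i) C" for x y C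
    by (rule decoupled_contract[OF \<Omega> z f that(1,2,4)])
  have "sup_le wt x R" "sup_le wt y R"
    using x(1) y(1) by (auto intro: weighted_sup.nb_mono simp: R_def)
  then show ?thesis
    using weighted_sup.contraction_unique[of "1/2" R "decoupled \<Omega> z f" x y,
        OF _ _ R(1) ball con] x y by auto
qed

lemma l2_le_sup_le:
  assumes "l2_le x B" shows "sup_le wt x (4 * B)"
  unfolding sup_le_def
proof
  fix i
  have "cmod (x i) \<le> B" "0 \<le> B" using l2_le_pointwise[OF assms] l2_le_nonneg[OF assms] by auto
  then show "cmod (x i) \<le> wt i * (4 * B)" by (simp add: wt_def)
qed

lemma sum_over_pieces:
  fixes x :: "int \<times> bool \<Rightarrow> complex"
  assumes x: "\<And>r k s. x (site r k, s) = g r s k"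
  shows "x = (\<lambda>i. (if inner (fst i) then x i else 0) + (\<Sum>rs\<in>UNIV.
    if \<not> inner (fst i) \<and> (b < fst i) = fst rs \<and> snd i =
        snd rs then g (fst rs) (snd rs) (pos (fst i)) else 0))"
proof
  fix i :: "int \<times> bool"
  obtain n s where i: "i = (n, s)" by (cases i)
  show "x i = (if inner (fst i) then x i else 0) + (\<Sum>rs\<in>UNIV.
    if \<not> inner (fst i) \<and> (b < fst i) = fst rs \<and> snd i =
        snd rs then g (fst rs) (snd rs) (pos (fst i)) else 0)"
  proof (cases "inner n")
    case False
    have "(\<Sum>rs\<in>UNIV. if \<not> inner n \<and> (b < n) = fst rs \<and>
        s = snd rs then g (fst rs) (snd rs) (pos n) else 0) =
      (\<Sum>rs\<in>{(b < n, s)}. g (fst rs) (snd rs) (pos n))"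
      using False by (intro sum.mono_neutral_cong_right) auto
    then show ?thesis unfolding i fst_conv snd_conv using False x[of "b < n" "pos n" s] by simp
  qed (simp add: i)
qed

text \<open>The factor \<open>4\<close> counts the pairs of a side and a component, each carrying
  one half-line sequence.\<close>

lemma l2_le_pieces:
  fixes x :: "int \<times> bool \<Rightarrow> complex"
  assumes x: "\<And>r k s. x (site r k, s) = g r s k" and g: "\<And>r s. l2_le (g r s) G"
    and inn: "\<And>n s. inner n \<Longrightarrow> cmod (x (n, s)) \<le> M"
  shows "l2_le x (real (card ({a..b} \<times> (UNIV :: bool set))) * M + 4 * G)"
proof -
  have 1: "l2_le (\<lambda>i. if inner (fst i) then x i else 0) (real (card ({a..b} \<times> (UNIV :: bool set)))
      * M)"
  proof (rule l2_le_finite_support)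
    fix i :: "int \<times> bool"
    show "(if inner (fst i) then x i else 0) = 0" if "i \<notin> {a..b} \<times> UNIV"
      using that by (cases i) (auto simp: inner_def)
    show "cmod (if inner (fst i) then x i else 0) \<le> M" if "i \<in> {a..b} \<times> UNIV"
      using that inn[of "fst i" "snd i"] by (auto simp: inner_def)
  qed simp
  have 2: "l2_le (\<lambda>i. \<Sum>rs\<in>UNIV.
    if \<not> inner (fst i) \<and> (b < fst i) = fst rs \<and> snd i =
        snd rs then g (fst rs) (snd rs) (pos (fst i)) else 0)
    (\<Sum>rs\<in>(UNIV :: (bool \<times> bool) set). G)"
  proof (rule l2_le_sum)
    fix rs :: "bool \<times> bool"
    have inj: "inj_on (\<lambda>i. pos (fst i)) {i. \<not> inner (fst i) \<and> (b < fst i) = fst rs \<and>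
        snd i = snd rs}"
    proof (rule inj_on_inverseI[where g = "\<lambda>k. (site (fst rs) k, snd rs)"])
      fix i assume i: "i \<in> {i. \<not> inner (fst i) \<and> (b < fst i) = fst rs \<and> snd i = snd rs}"
      then have "site (fst rs) (pos (fst i)) = fst i" using site_pos[of "fst i"] by simp
      then show "(site (fst rs) (pos (fst i)), snd rs) = i" using i by (simp add: prod_eq_iff)
    qed
    show "l2_le (\<lambda>i. if \<not> inner (fst i) \<and> (b < fst i) = fst rs \<and> snd i = snd rs
        then g (fst rs) (snd rs) (pos (fst i)) else 0) G"
      by (rule l2_le_reindex[OF g inj])
  qed simp
  have "card (UNIV :: (bool \<times> bool) set) = 4" by (simp add: card_UNIV_bool card_prod)
  then show ?thesis
    using l2_le_add[OF 1 2] unfolding sum_over_pieces[of x g, OF x, symmetric] by simp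
qed

theorem off_band_injective:
  assumes \<Omega>: "1/2 \<le> cmod \<Omega>" and z: "\<And>s. cmod (z s) < 1" "band_roots \<Omega> z"
    and x: "l2_le x B" "\<And>i. H x i - \<Omega> * x i = 0"
  shows "x = (\<lambda>_. 0)"
proof -
  have z1: "cmod (z s) \<le> 1" for s using z(1)[of s] by simp
  have f: "forcing (\<lambda>_. 0) r s = (\<lambda>_. 0)" for r s by (simp add: forcing_def fun_eq_iff)
  have adm: "admissible (z s) (forcing (\<lambda>_. 0) r s)" for r s unfolding f
      by (simp add: admissible_def)
  have src0: "src (\<lambda>_. 0) r s = (\<lambda>_. 0)" for r s by (simp add: src_def fun_eq_iff)
  have h0: "half_line w (\<lambda>_. 0) k = 0" for w k by (simp add: half_line_def bwd_def fwd_def)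
  have zero: "decoupled \<Omega> z (\<lambda>_. 0) (\<lambda>_. 0) = (\<lambda>_. 0)"
    by (auto simp: decoupled_def inner_rhs_def f src0 h0 fun_eq_iff)
  have D: "sup_le wt (decoupled \<Omega> z (\<lambda>_. 0) (\<lambda>_. 0)) 0" unfolding zero
      by (rule weighted_sup.nb_zero)
  have fixed: "decoupled \<Omega> z (\<lambda>_. 0) x = x"
    by (rule decoupled_unique[OF \<Omega> z l2_le_pointwise[OF x(1)] x(2)])
  show ?thesis
    by (rule decoupled_fixed_point_unique[OF \<Omega> z1 adm D l2_le_sup_le[OF x(1)] fixed
        weighted_sup.nb_zero zero])
qed

text \<open>The fixed point is found in the weighted supremum norm and turns out to be square
  summable a posteriori: \<open>src\<close> is weighted summable, and \<open>half_line\<close>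
  preserves square summability for \<open>|z| < 1\<close>. The constant depends on
  \<open>\<Omega>\<close> through \<open>\<rho>\<close>.\<close>

theorem off_band_surjective:
  assumes \<Omega>: "1/2 \<le> cmod \<Omega>" and z: "\<And>s. cmod (z s) < 1" "band_roots \<Omega> z"
  shows "\<exists>K. \<forall>f F. l2_le f F \<longrightarrow> (\<exists>x. (\<forall>i. H x i - \<Omega> * x i = f i) \<and> l2_le x (K * F))"
proof -
  have z1: "cmod (z s) \<le> 1" for s using z(1)[of s] by simp
  define \<rho> where "\<rho> = max (cmod (z True)) (cmod (z False))"
  have \<rho>: "cmod (z s) \<le> \<rho>" "\<rho> < 1" for s
    using z(1) by (cases s; auto simp: \<rho>_def)+
  have mono: "M / (1 - cmod (z s))\<^sup>2 \<le> M / (1 - \<rho>)\<^sup>2" if "0 \<le> M" for M s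
    using \<rho> z(1)[of s] that
    by (intro divide_left_mono power_mono mult_pos_pos zero_less_power) (auto simp: algebra_simps)
  define K1 where "K1 = 4 * (8 * real p + 2) + 1 / \<epsilon> / (1 - \<rho>)\<^sup>2"
  define K where "K = real (card ({a..b} \<times> (UNIV :: bool set))) * K1 + 4 * ((1 / \<epsilon> +
      K1) / (1 - \<rho>)\<^sup>2)"
  have "\<exists>x. (\<forall>i. H x i - \<Omega> * x i = f i) \<and> l2_le x (K * F)" if f: "l2_le f F" for f F
  proof -
    have F: "0 \<le> F" using l2_le_nonneg[OF f] .
    have frc2: "l2_le (forcing f r s) (F / \<epsilon>)" for r s
    proof -
      have "l2_le (\<lambda>k. f (site r k, s)) F"
        by (rule l2_le_compose[OF f]) (auto simp: inj_def site_def)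
      from l2_le_mult[OF this, of "sg s / of_real \<epsilon>"] show ?thesis
        using eps by (simp add: forcing_def[abs_def] norm_divide)
    qed
    have adm: "admissible (z s) (forcing f r s)" for r s
      by (rule admissible_bounded(1)[OF z(1) l2_le_pointwise[OF frc2]])
    have D: "sup_le wt (decoupled \<Omega> z f (\<lambda>_. 0)) (K1 * F)"
    proof (rule decoupled_zero_bound[OF \<Omega>])
      show "cmod (f (n, s)) \<le> F" for n s by (rule l2_le_pointwise[OF f])
      show "cmod (half_line (z s) (forcing f r s) k) \<le> F / \<epsilon> / (1 - \<rho>)\<^sup>2" for r s k
        using half_line_bounded[of "z s" "forcing f r s" "F / \<epsilon>" k,
            OF z(1) l2_le_pointwise[OF frc2]]
          mono[of "F / \<epsilon>" s] F eps by simp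
      show "4 * (8 * real p + 2) * F \<le> K1 * F"
        unfolding K1_def using F eps by (intro mult_right_mono) auto
      have "F / \<epsilon> / (1 - \<rho>)\<^sup>2 = 1 / \<epsilon> / (1 - \<rho>)\<^sup>2 * F" by simp
      also have "\<dots> \<le> K1 * F" unfolding K1_def using F by (intro mult_right_mono) auto
      finally show "F / \<epsilon> / (1 - \<rho>)\<^sup>2 \<le> K1 * F" .
    qed
    obtain x where x: "sup_le wt x (2 * (K1 * F))" "decoupled \<Omega> z f x = x"
      using decoupled_fixed_point[OF \<Omega> z1 adm D] by blast
    have "H x i - \<Omega> * x i = f i" for i
      by (rule decoupled_solves[OF \<Omega> z1 z(2) adm x])
    moreover have "l2_le x (K * F)"
    proof -
      have "l2_le (half_line (z s) (\<lambda>k. forcing f r s k + src x r s k)) ((1 / \<epsilon> +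
          K1) / (1 - \<rho>)\<^sup>2 * F)" for r s
      proof -
        have h: "l2_le (\<lambda>k. forcing f r s k + src x r s k) (F / \<epsilon> + 2 * (K1 * F) / 2)"
          by (rule l2_le_add[OF frc2 weighted_le_imp_l2_le[OF src_weighted[OF x(1)]]])
        have "(F / \<epsilon> + 2 * (K1 * F) / 2) / (1 - cmod (z s))\<^sup>2 \<le>
            (F / \<epsilon> + 2 * (K1 * F) / 2) / (1 - \<rho>)\<^sup>2"
          by (rule mono[OF l2_le_nonneg[OF h]])
        also have "\<dots> = (1 / \<epsilon> + K1) / (1 - \<rho>)\<^sup>2 * F"
          by (simp add: add_divide_distrib distrib_right)
        finally show ?thesis by (rule l2_le_mono[OF half_line_l2[OF z(1) h]])
      qed
      moreover have "x (site r k, s) = half_line (z s) (\<lambda>k. forcing f r s k +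
          src x r s k) k" for r k s
        using fun_cong[OF x(2), of "(site r k, s)"] by (simp add: decoupled_def)
      moreover have "cmod (x (n, s)) \<le> K1 * F" if "inner n" for n s
        using sup_le_bounds(3)[OF x(1) that, of s] sup_le_bounds(1)[OF x(1)] by linarith
      ultimately have "l2_le x (real (card ({a..b} \<times> (UNIV :: bool set))) * (K1 * F)
          + 4 * ((1 / \<epsilon> + K1) / (1 - \<rho>)\<^sup>2 * F))"
        using l2_le_pieces[of x "\<lambda>r s. half_line (z s) (\<lambda>k. forcing f r s k + src x r s k)"]
            by blast
      then show ?thesis by (simp add: K_def distrib_right mult.assoc)
    qed
    ultimately show ?thesis by blast
  qed
  then show ?thesis by blast
qed

lemma src_tendsto:
  assumes "\<And>i. ((\<lambda>t. x t i) \<longlongrightarrow> y i) F"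
  shows "((\<lambda>t. src (x t) r s k) \<longlongrightarrow> src y r s k) F"
  unfolding src_def by (cases "k = 0") (use eps in \<open>auto intro!: tendsto_intros assms\<close>)

lemma decoupled_tendsto:
  fixes x :: "'a \<Rightarrow> int \<times> bool \<Rightarrow> complex"
  assumes F: "F \<noteq> bot" and \<Omega>: "(\<Omega> \<longlongrightarrow> \<Omega>0) F" "\<Omega>0 \<noteq> 0"
    and z: "\<And>s. ((\<lambda>t. z t s) \<longlongrightarrow> z0 s) F" "\<And>s. \<forall>\<^sub>F t in F. cmod (z t s) \<le> 1"
    and f: "\<And>r s. summable (\<lambda>k. cmod (forcing f r s k))"
    and x: "\<And>i. ((\<lambda>t. x t i) \<longlongrightarrow> x0 i) F" "\<forall>\<^sub>F t in F. sup_le wt (x t) B"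
  shows "((\<lambda>t. decoupled (\<Omega> t) (z t) f (x t) i) \<longlongrightarrow> decoupled \<Omega>0 z0 f x0 i) F"
proof -
  obtain n s where i: "i = (n, s)" by (cases i)
  show ?thesis
  proof (cases "inner n")
    case True
    then show ?thesis
      unfolding i decoupled_def inner_rhs_def using \<Omega>(2) by (auto intro!: tendsto_intros \<Omega>(1) x(1))
  next
    case False
    \<comment> \<open>A majorant independent of \<open>t\<close>: the common bound \<open>B\<close>
      on the states controls the potential part geometrically and the edge value at
      \<open>k = 0\<close>.\<close>
    let ?M = "\<lambda>k. cmod (forcing f (b < n) s k) +
      (c * \<epsilon> * (1 + 2 * real p) * B * (1/2) ^ k + (if k = 0 then B else 0))"
    have "((\<lambda>t. half_line (z t s) (\<lambda>k. forcing f (b < n) s k + src (x t) (b < n) s k) (pos n))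
      \<longlongrightarrow> half_line (z0 s) (\<lambda>k. forcing f (b < n) s k + src x0 (b < n) s k) (pos n)) F"
    proof (rule half_line_tendsto[OF F z, where M = ?M])
      show "((\<lambda>t. forcing f (b < n) s k + src (x t) (b < n) s k)
        \<longlongrightarrow> forcing f (b < n) s k + src x0 (b < n) s k) F" for k
        by (intro tendsto_intros src_tendsto x(1))
      show "\<forall>\<^sub>F t in F. \<forall>k. cmod (forcing f (b < n) s k + src (x t) (b < n) s k) \<le> ?M k"
        using x(2)
      proof eventually_elim
        case (elim t)
        show ?case
          by (intro allI order_trans[OF norm_triangle_ineq] add_left_mono src_pointwise[OF elim])
      qed
      have "summable (\<lambda>k. c * \<epsilon> * (1 + 2 * real p) * B * (1/2) ^ k)"
        by (intro summable_mult summable_geometric) simp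
      moreover have "summable (\<lambda>k::nat. if k = 0 then B else 0)"
        by (rule summable_finite[of "{0}"]) auto
      ultimately show "summable ?M" by (intro summable_add f)
    qed
    then show ?thesis using False by (simp add: i decoupled_def)
  qed
qed

text \<open>The \<open>k\<close>-th iterates approximate the fixed points within
  \<open>(1/2)^k * (4 * D)\<close> for all parameters at once, and each iterate is continuous in the
  parameters. An argument with three thirds of \<open>e\<close> interchanges the limits and
  identifies \<open>y\<close> as the fixed point for \<open>z0\<close>.\<close>

theorem limiting_absorption:
  fixes x :: "'a \<Rightarrow> int \<times> bool \<Rightarrow> complex"
  assumes F: "F \<noteq> bot" and \<Omega>: "(\<Omega> \<longlongrightarrow> \<Omega>0) F" "1/2 \<le> cmod \<Omega>0" "\<forall>\<^sub>F t in F. 1/2 \<le> cmod (\<Omega> t)"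
    and z: "\<And>s. ((\<lambda>t. z t s) \<longlongrightarrow> z0 s) F" "\<forall>\<^sub>F t in F. \<forall>s. cmod (z t s) \<le> 1"
    and f: "\<And>r s. weighted_le (\<lambda>k. f (site r k, s)) W" "\<And>n s. inner n \<Longrightarrow> cmod (f (n, s)) \<le> W"
    and x: "\<forall>\<^sub>F t in F. decoupled (\<Omega> t) (z t) f (x t) = x t" "\<forall>\<^sub>F t in F. \<exists>B. sup_le wt (x t) B"
  shows "\<exists>y. (\<forall>i. ((\<lambda>t. x t i) \<longlongrightarrow> y i) F) \<and> (\<forall>i. cmod (y i) \<le>
      2 * ((4 * (8 * real p + 2) + 1 / \<epsilon>) * W))"
proof -
  define D where "D = (4 * (8 * real p + 2) + 1 / \<epsilon>) * W"
  have W: "0 \<le> W" by (rule weighted_le_nonneg[OF f(1)])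
  have frc: "weighted_le (forcing f r s) (W / \<epsilon>)" for r s
    using weighted_le_mult[OF f(1)[of r s], of "sg s / of_real \<epsilon>"] eps
    by (simp add: forcing_def[abs_def] norm_divide)
  note frs = weighted_le_summable[OF frc]
  have D: "sup_le wt (decoupled \<omega> w f (\<lambda>_. 0)) D" if "1/2 \<le> cmod \<omega>" "\<forall>s. cmod (w s) \<le> 1" for \<omega> w
  proof (rule decoupled_zero_bound[OF that(1), where F = W and F' = "W / \<epsilon>"])
    show "cmod (f (n, s)) \<le> W" if "inner n" for n s by (rule f(2)[OF that])
    show "cmod (half_line (w s) (forcing f r s) k) \<le> W / \<epsilon>" for r s k
      by (rule half_line_weighted[OF _ frc]) (use that in simp)
    show "4 * (8 * real p + 2) * W \<le> D" "W / \<epsilon> \<le> D"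
      unfolding D_def using W eps by (simp_all add: distrib_right)
  qed
  have z01: "cmod (z0 s) \<le> 1" for s
    by (rule tendsto_upperbound[OF tendsto_norm[OF z(1)] _ F]) (use z(2) in \<open>auto elim:
        eventually_mono\<close>)
  have adm: "admissible (w s) (forcing f r s)" if "\<forall>s. cmod (w s) \<le> 1" for w r s
    by (rule admissible_weighted(1)[OF _ frs]) (use that in simp)
  have z01': "\<forall>s. cmod (z0 s) \<le> 1" using z01 by simp
  obtain y where y: "sup_le wt y (2 * D)"
    "\<And>k. sup_le wt (\<lambda>i. y i - (decoupled \<Omega>0 z0 f ^^ k) (\<lambda>_. 0) i) ((1/2) ^ k * (4 * D))"
    using decoupled_fixed_point[OF \<Omega>(2) z01 adm[OF z01'] D[OF \<Omega>(2) z01']] by blast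
  have xt: "\<forall>\<^sub>F t in F. (\<forall>k. sup_le wt (\<lambda>i. x t i - (decoupled (\<Omega> t) (z t) f ^^ k) (\<lambda>_. 0) i)
      ((1/2) ^ k * (4 * D)))
      \<and> (\<forall>k. sup_le wt ((decoupled (\<Omega> t) (z t) f ^^ k) (\<lambda>_. 0)) (2 * D))"
    using \<Omega>(3) z(2) x
  proof eventually_elim
    case (elim t)
    obtain B where B: "sup_le wt (x t) B" using elim(4) by blast
    have zt: "cmod (z t s) \<le> 1" for s using elim(2) by blast
    obtain u where u: "sup_le wt u (2 * D)" "decoupled (\<Omega> t) (z t) f u = u"
      "\<forall>k. sup_le wt (\<lambda>i. u i - (decoupled (\<Omega> t) (z t) f ^^ k) (\<lambda>_. 0) i) ((1/2) ^ k * (4 * D))"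
      "\<forall>k. sup_le wt ((decoupled (\<Omega> t) (z t) f ^^ k) (\<lambda>_. 0)) (2 * D)"
      using decoupled_fixed_point[OF elim(1) zt adm[OF elim(2)] D[OF elim(1,2)]] by blast
    have "x t = u"
      by (rule decoupled_fixed_point_unique[OF elim(1) zt adm[OF elim(2)] D[OF elim(1,2)] B
          elim(3) u(1,2)])
    then show ?case using u by simp
  qed
  have it: "((\<lambda>t. (decoupled (\<Omega> t) (z t) f ^^ k) (\<lambda>_. 0) i) \<longlongrightarrow> (decoupled \<Omega>0 z0 f ^^ k) (\<lambda>_. 0) i)
      F" for k i
  proof (induction k arbitrary: i)
    case (Suc k)
    have B: "\<forall>\<^sub>F t in F. sup_le wt ((decoupled (\<Omega> t) (z t) f ^^ k) (\<lambda>_. 0)) (2 * D)"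
      using xt by eventually_elim blast
    have ne: "\<Omega>0 \<noteq> 0" using \<Omega>(2) by auto
    have le: "\<forall>\<^sub>F t in F. cmod (z t s) \<le> 1" for s using z(2) by eventually_elim blast
    show ?case
      unfolding funpow.simps comp_apply
      by (rule decoupled_tendsto[OF F \<Omega>(1) ne z(1) le frs Suc B])
  qed simp
  have "((\<lambda>t. x t i) \<longlongrightarrow> y i) F" for i
  proof (rule tendstoI)
    fix e :: real assume e: "0 < e"
    have "(\<lambda>k. (1/2) ^ k * (4 * D)) \<longlonglongrightarrow> 0"
      by (intro tendsto_mult_left_zero LIMSEQ_power_zero) simp
    then have "\<forall>\<^sub>F k in sequentially. (1/2) ^ k * (4 * D) < e / 3"
      using e by (intro order_tendstoD) auto
    then obtain k where k: "(1/2) ^ k * (4 * D) < e / 3" by (auto simp: eventually_sequentially)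
    have "\<forall>\<^sub>F t in F. dist ((decoupled (\<Omega> t) (z t) f ^^ k) (\<lambda>_. 0) i) ((decoupled \<Omega>0 z0 f ^^ k)
        (\<lambda>_. 0) i) < e / 3"
      by (rule tendstoD[OF it]) (use e in simp)
    then show "\<forall>\<^sub>F t in F. dist (x t i) (y i) < e"
      using xt
    proof eventually_elim
      case (elim t)
      have 1: "cmod (x t i - (decoupled (\<Omega> t) (z t) f ^^ k) (\<lambda>_. 0) i) < e / 3"
        using sup_le_bounds(2)[OF elim(2)[THEN conjunct1, rule_format, of k], of i] k by linarith
      have 2: "cmod (y i - (decoupled \<Omega>0 z0 f ^^ k) (\<lambda>_. 0) i) < e / 3"
        using sup_le_bounds(2)[OF y(2), of i k] k by linarith
      show ?case
        using 1 2 elim(1) dist_triangle_third[of "x t i" "(decoupled (\<Omega> t) (z t) f ^^ k) (\<lambda>_. 0)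
            i" e
            "(decoupled \<Omega>0 z0 f ^^ k) (\<lambda>_. 0) i" "y i"]
        by (simp add: dist_norm norm_minus_commute)
    qed
  qed
  then show ?thesis using sup_le_bounds(2)[OF y(1)] unfolding D_def by blast
qed

end

section \<open>The invariant subspace near zero\<close>

text \<open>For small \<open>\<epsilon>\<close>, the eigenvalues near \<open>0\<close> are those of \<open>H\<close> on an invariant subspace, which is
  the graph of an operator \<open>X\<close> from the states on \<open>a, \<dots>, b\<close> to the states outside. The equation
  \<open>H w\<^sub>j \<in> span w\<close> for its basis vectors is a quadratic (Riccati) equation for \<open>X\<close>.\<close>

locale dnls_graph = dnls_lattice +
  assumes small_graph:
    "2 * real (card {a..b}) * ((4 + c * (1 + 2 * real p)) * \<epsilon>) * (1 + 32 * (real p + 1)) \<le> 1/16"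
begin

text \<open>At each site, the basis \<open>(1, -1)\<close>, \<open>(\<eta>, 0)\<close> turns the nilpotent anticontinuum block into one
  with single nonzero entry \<open>-p \<eta>\<close>, which is small.\<close>

definition \<eta> :: real where "\<eta> = 1 / (16 * (real p + 1))"

text \<open>The size of what \<open>H\<close> adds to its leading blocks:
  \<open>4 * \<epsilon>\<close> from the Laplacian and \<open>c * (1 + 2 * p) * \<epsilon>\<close>
  from the error of the potential, inside and outside alike.\<close>

definition \<kappa> :: real where "\<kappa> = (4 + c * (1 + 2 * real p)) * \<epsilon>"

definition I :: "(int \<times> bool) set" where "I = {a..b} \<times> UNIV"

definition block_vec :: "int \<times> bool \<Rightarrow> int \<times> bool \<Rightarrow> complex" where
  "block_vec j i = (if fst i \<noteq> fst j then 0 else if snd j then sg (snd i)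
     else if snd i then of_real \<eta> else 0)"

text \<open>Coordinates dual to \<open>block_vec\<close>. The block sees a state only through its
  pair sum and maps it to a multiple of \<open>(1, -1)\<close>, so the division by
  \<open>\<eta>\<close> affects just the small perturbation.\<close>

definition coord :: "(int \<times> bool \<Rightarrow> complex) \<Rightarrow> int \<times> bool \<Rightarrow> complex" where
  "coord x j = (if snd j then - x (fst j, False) else (x (fst j, True) + x (fst j,
      False)) / of_real \<eta>)"

definition outer :: "(int \<times> bool \<Rightarrow> complex) \<Rightarrow> int \<times> bool \<Rightarrow> complex" where
  "outer x i = (if inner (fst i) then 0 else x i)"

text \<open>Away from the excited sites the anticontinuum operator is multiplication by
  \<open>sg\<close>; there \<open>rest\<close> is the perturbation, of norm at most
  \<open>\<kappa>\<close>.\<close>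

definition rest :: "(int \<times> bool \<Rightarrow> complex) \<Rightarrow> int \<times> bool \<Rightarrow> complex" where
  "rest x i = H x i - sg (snd i) * x i"

lemma eta: "0 < \<eta>" "\<eta> \<le> 1" "real p * \<eta> \<le> 1/16" "1 / \<eta> = 16 * (real p + 1)"
  by (auto simp: \<eta>_def divide_simps)

lemma finite_I [simp]: "finite I"
  by (simp add: I_def)

lemma card_I: "card I = 2 * card {a..b}"
  by (simp add: I_def card_cartesian_product)

lemma I_iff: "j \<in> I \<longleftrightarrow> inner (fst j)"
  by (cases j) (auto simp: I_def inner_def)

text \<open>The assumptions \<open>small\<close> and \<open>small_graph\<close> restated through
  \<open>\<kappa>\<close> and \<open>\<eta>\<close>; the term \<open>32 * (p + 1)\<close> in the
  latter is \<open>2 / \<eta>\<close>.\<close>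

lemma kappa: "0 < \<kappa>" "\<kappa> \<le> 1/16" "real (card {a..b}) * (\<kappa> * (1 + 2 / \<eta>)) \<le> 1/32" "\<epsilon> \<le> 1" "c * \<epsilon> \<le> 1"
proof -
  show k0: "0 < \<kappa>" using c eps by (simp add: \<kappa>_def add_pos_nonneg)
  have s: "(8 * real p + 2) * \<kappa> \<le> 1/8" using small by (simp add: \<kappa>_def mult.assoc)
  moreover have "2 * \<kappa> \<le> (8 * real p + 2) * \<kappa>" using k0 by (intro mult_right_mono) auto
  ultimately show k: "\<kappa> \<le> 1/16" by simp
  have "2 / \<eta> = 2 * (1 / \<eta>)" by simp
  then have "2 / \<eta> = 32 * (real p + 1)" unfolding eta(4) by simp
  then show "real (card {a..b}) * (\<kappa> * (1 + 2 / \<eta>)) \<le> 1/32"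
    using small_graph by (simp add: \<kappa>_def mult_ac)
  have "4 * \<epsilon> \<le> \<kappa>" "c * (1 + 2 * real p) * \<epsilon> \<le> \<kappa>"
    using c eps by (simp_all add: \<kappa>_def algebra_simps)
  moreover have "c * \<epsilon> \<le> c * (1 + 2 * real p) * \<epsilon>" using c eps by simp
  ultimately show "\<epsilon> \<le> 1" "c * \<epsilon> \<le> 1" using k by linarith+
qed

lemma Phi_outer: "\<not> inner n \<Longrightarrow> \<bar>\<Phi> n\<bar> \<le> c * \<epsilon>"
proof -
  assume "\<not> inner n"
  then obtain r k where n: "n = site r k" by (rule outer_cases)
  have "\<bar>\<Phi> n\<bar> \<le> c * \<epsilon>\<^sup>2 * (1/2) ^ k" unfolding n by (rule Phi_site)
  also have "\<dots> \<le> c * \<epsilon>\<^sup>2 * 1" using c by (intro mult_left_mono power_le_one) auto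
  also have "\<dots> \<le> c * \<epsilon>" using c eps kappa(4) by (simp add: power2_eq_square mult_left_le_one_le)
  finally show ?thesis .
qed

lemma Phi_le: "\<bar>\<Phi> n\<bar> \<le> 2"
  using Phi_outer[of n] Phi_in[of n] kappa(5) by (cases "inner n") (auto simp: inner_def)

lemma H_add: "H (\<lambda>i. x i + y i) i = H x i + H y i"
  by (cases i) (simp add: H_def algebra_simps)

lemma H_scale: "H (\<lambda>i. t * x i) i = t * H x i"
  by (cases i) (simp add: H_def algebra_simps)

lemma H_diff: "H (\<lambda>i. x i - y i) i = H x i - H y i"
  by (cases i) (simp add: H_def algebra_simps)

lemma H_sum: "finite K \<Longrightarrow> H (\<lambda>i. \<Sum>k\<in>K. t k * x k i) i = (\<Sum>k\<in>K. t k * H (x k) i)"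
proof (induction K rule: finite_induct)
  case empty
  then show ?case by (cases i) (simp add: H_def)
next
  case (insert k K)
  then show ?case using H_add[of "\<lambda>i. t k * x k i" "\<lambda>i. \<Sum>k\<in>K. t k * x k i" i] H_scale by simp
qed

lemma rest_diff: "rest (\<lambda>i. x i - y i) i = rest x i - rest y i"
  by (simp add: rest_def H_diff algebra_simps)

lemma coord_diff: "coord (\<lambda>i. x i - y i) j = coord x j - coord y j"
  by (cases "snd j") (simp_all add: coord_def add_divide_distrib diff_divide_distrib)

lemma coord_add: "coord (\<lambda>i. x i + y i) j = coord x j + coord y j"
  by (simp add: coord_def add_divide_distrib)

lemma coord_scale: "coord (\<lambda>i. t * x i) j = t * coord x j"
  by (simp add: coord_def distrib_left[symmetric])

lemma coord_sum: "finite K \<Longrightarrow> coord (\<lambda>i. \<Sum>k\<in>K. t k * x k i) j = (\<Sum>k\<in>K. t k * coord (x k) j)"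
proof (induction K rule: finite_induct)
  case empty
  then show ?case by (simp add: coord_def)
next
  case (insert k K)
  then show ?case
    using coord_add[of "\<lambda>i. t k * x k i" "\<lambda>i. \<Sum>k\<in>K. t k * x k i" j] coord_scale by simp
qed

lemma coord_block_vec: "coord (block_vec k) j = (if j = k then 1 else 0)"
  using eta(1) by (cases j; cases k) (auto simp: coord_def block_vec_def)

lemma coord_outer: "j \<in> I \<Longrightarrow> coord (outer x) j = 0"
  by (simp add: coord_def outer_def I_iff)

lemma block_expansion:
  assumes "inner (fst i)" shows "(\<Sum>j\<in>I. coord x j * block_vec j i) = x i"
proof -
  obtain n s where i: "i = (n, s)" by (cases i)
  have "(\<Sum>j\<in>I. coord x j * block_vec j i) = (\<Sum>j\<in>{(n, True), (n, False)}. coord x j * block_vec j i)"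
    using assms by (intro sum.mono_neutral_right) (auto simp: I_iff i block_vec_def)
  then show ?thesis using eta(1) by (cases s) (simp_all add: i coord_def block_vec_def)
qed

lemma block_vec_outer: "j \<in> I \<Longrightarrow> \<not> inner (fst i) \<Longrightarrow> block_vec j i = 0"
  by (auto simp: block_vec_def I_iff)

lemma block_vec_norm: "cmod (block_vec j i) \<le> 1"
  using eta(1,2) by (auto simp: block_vec_def)

lemma block_vec_l2: "l2_le (block_vec j) 2"
proof -
  have "l2_le (block_vec j) (real (card {(fst j, True), (fst j, False)}) * 1)"
  proof (rule l2_le_finite_support)
    show "block_vec j i = 0" if "i \<notin> {(fst j, True), (fst j, False)}" for i
      using that by (cases i; cases "snd i") (auto simp: block_vec_def)
  qed (auto simp: block_vec_norm)
  then show ?thesis by simp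
qed

lemma outer_l2: "l2_le x B \<Longrightarrow> l2_le (outer x) B"
  by (erule l2_le_dominated) (simp add: outer_def)

lemma swap_component_l2:
  fixes x :: "int \<times> bool \<Rightarrow> complex"
  shows "l2_le x B \<Longrightarrow> l2_le (\<lambda>i. x (fst i, \<not> snd i)) B"
  by (rule l2_le_compose[where h = "\<lambda>i. (fst i, \<not> snd i)"]) (auto simp: inj_def)

lemma shift_l2:
  fixes x :: "int \<times> bool \<Rightarrow> complex"
  shows "l2_le x B \<Longrightarrow> l2_le (\<lambda>i. x (fst i + m, snd i)) B"
  by (rule l2_le_compose[where h = "\<lambda>i. (fst i + m, snd i)"]) (auto simp: inj_def)

lemma kinetic_l2:
  fixes x :: "int \<times> bool \<Rightarrow> complex"
  assumes x: "l2_le x B"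
  shows "l2_le (\<lambda>i. of_real \<epsilon> * (2 * x i - (x (fst i + 1, snd i) + x (fst i - 1,
      snd i)))) (4 * \<epsilon> * B)"
proof -
  have "l2_le (\<lambda>i. 2 * x i - (x (fst i + 1, snd i) + x (fst i + (-1), snd i))) (cmod 2 * B + (B +
      B))"
    by (intro l2_le_diff l2_le_add l2_le_mult shift_l2 x)
  then have "l2_le (\<lambda>i. 2 * x i - (x (fst i + 1, snd i) + x (fst i - 1, snd i))) (4 * B)" by simp
  from l2_le_mult[OF this, of "of_real \<epsilon>"] show ?thesis using eps by (simp add: mult_ac)
qed

lemma coupling_l2:
  fixes x :: "int \<times> bool \<Rightarrow> complex"
  assumes x: "l2_le x B"
  shows "l2_le (\<lambda>i. (1 + of_nat p) * x i + of_nat p * x (fst i, \<not> snd i)) ((1 + 2 * real p) * B)"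
proof -
  have "l2_le (\<lambda>i. (1 + of_nat p) * x i + of_nat p * x (fst i, \<not> snd i))
      (cmod (1 + of_nat p) * B + cmod (of_nat p) * B)"
    by (intro l2_le_add l2_le_mult swap_component_l2 x)
  moreover have "cmod (1 + of_nat p) = 1 + real p"
      using norm_of_nat[of "Suc p", where 'a = complex] by simp
  then have "cmod (1 + of_nat p) * B + cmod (of_nat p) * B = (1 + 2 * real p) * B"
      by (simp add: algebra_simps)
  ultimately show ?thesis by simp
qed

lemma rest_l2:
  assumes x: "l2_le x B" shows "l2_le (outer (rest x)) (\<kappa> * B)"
proof -
  let ?f = "\<lambda>i. of_real \<epsilon> * (2 * x i - (x (fst i + 1, snd i) + x (fst i - 1, snd i)))"
  let ?g = "\<lambda>i. (1 + of_nat p) * x i + of_nat p * x (fst i, \<not> snd i)"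
  have L: "l2_le (\<lambda>i. if inner (fst i) then 0 else of_real (\<Phi> (fst i)) * ?g i) (cmod (of_real (c *
      \<epsilon>)) * ((1 + 2 * real p) * B))"
  proof (rule l2_le_dominated[OF l2_le_mult[OF coupling_l2[OF x]]])
    fix i :: "int \<times> bool"
    show "cmod (if inner (fst i) then 0 else of_real (\<Phi> (fst i)) * ?g i) \<le>
        cmod (of_real (c * \<epsilon>) * ?g i)"
    proof (cases "inner (fst i)")
      case False
      have "\<bar>\<Phi> (fst i)\<bar> \<le> \<bar>c * \<epsilon>\<bar>" using Phi_outer[OF False] by simp
      then show ?thesis using False by (simp only: norm_mult norm_of_real if_False mult_right_mono
          norm_ge_zero)
    qed simp
  qed
  have E: "4 * \<epsilon> * B + cmod (of_real (c * \<epsilon>)) * ((1 + 2 * real p) * B) = \<kappa> * B"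
    using c eps by (simp add: \<kappa>_def norm_mult algebra_simps)
  have "l2_le (\<lambda>i. ?f i - (if inner (fst i) then 0 else of_real (\<Phi> (fst i)) * ?g i)) (\<kappa> * B)"
    unfolding E[symmetric] by (rule l2_le_diff[OF kinetic_l2[OF x] L])
  then show ?thesis
  proof (rule l2_le_dominated)
    fix i :: "int \<times> bool"
    show "cmod (outer (rest x) i) \<le> cmod (?f i - (if inner (fst i) then 0 else of_real (\<Phi> (fst i))
        * ?g i))"
    proof (cases "inner (fst i)")
      case False
      have "rest x i = sg (snd i) * (?f i - of_real (\<Phi> (fst i)) * ?g i)"
        by (cases i) (simp add: rest_def H_def algebra_simps)
      then show ?thesis using False by (simp add: outer_def norm_mult)
    qed (simp add: outer_def)
  qed
qed

lemma H_l2: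
  assumes x: "l2_le x B" shows "l2_le (H x) ((4 * \<epsilon> + 1 + 2 * (1 + 2 * real p)) * B)"
proof -
  let ?f = "\<lambda>i. of_real \<epsilon> * (2 * x i - (x (fst i + 1, snd i) + x (fst i - 1, snd i)))"
  let ?g = "\<lambda>i. (1 + of_nat p) * x i + of_nat p * x (fst i, \<not> snd i)"
  have "l2_le (\<lambda>i. of_real (\<Phi> (fst i)) * ?g i) (cmod 2 * ((1 + 2 * real p) * B))"
  proof (rule l2_le_dominated[OF l2_le_mult[OF coupling_l2[OF x]]])
    fix i :: "int \<times> bool"
    show "cmod (of_real (\<Phi> (fst i)) * ?g i) \<le> cmod (2 * ?g i)"
      unfolding norm_mult norm_of_real using Phi_le[of "fst i"] by (intro mult_right_mono) auto
  qed
  from l2_le_diff[OF l2_le_add[OF kinetic_l2[OF x] x] this]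
  have "l2_le (\<lambda>i. ?f i + x i - of_real (\<Phi> (fst i)) * ?g i) (4 * \<epsilon> * B + B + cmod 2 * ((1 +
      2 * real p) * B))" .
  moreover have "4 * \<epsilon> * B + B + cmod 2 * ((1 + 2 * real p) * B) =
      (4 * \<epsilon> + 1 + 2 * (1 + 2 * real p)) * B"
    by (simp add: algebra_simps)
  ultimately have "l2_le (\<lambda>i. ?f i + x i - of_real (\<Phi> (fst i)) * ?g i) ((4 * \<epsilon> + 1 + 2 * (1 +
      2 * real p)) * B)"
    by (simp only:)
  then show ?thesis
    by (rule l2_le_dominated) (auto simp: H_def norm_mult)
qed

lemma H_inner:
  "H x (n, s) = - (sg s * of_nat p * (x (n, s) + x (n, \<not> s))) - inner_rhs (\<lambda>_. 0) x n s"
  by (simp add: H_def inner_rhs_def algebra_simps)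

lemma sum_I: "(\<Sum>j\<in>I. f j) = (\<Sum>n\<in>{a..b}. f (n, True) + f (n, False))"
proof -
  have "(\<Sum>j\<in>I. f j) = (\<Sum>n\<in>{a..b}. \<Sum>s\<in>UNIV. f (n, s))" by (simp add: I_def sum.cartesian_product)
  then show ?thesis by (simp add: UNIV_bool add.commute)
qed

text \<open>Every state occurring below has a pair sum \<open>x (n, True) + x (n, False)\<close> that vanishes at all
  inner sites but at most one, whence the single term \<open>p e\<close>.\<close>

lemma coord_H_sum:
  assumes x: "\<And>i. cmod (x i) \<le> B"
    and pair: "\<And>n. inner n \<Longrightarrow> cmod (x (n, True) + x (n, False)) \<le> (if n = m then e else 0)"
        and e: "0 \<le> e"
  shows "(\<Sum>k\<in>I. cmod (coord (H x) k)) \<le> real p * e + B / 32"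
proof -
  have B: "0 \<le> B" using x norm_ge_zero order_trans by blast
  have t: "cmod (coord (H x) (n, True)) + cmod (coord (H x) (n, False)) \<le>
      (if n = m then real p * e else 0) + \<kappa> * (1 + 2 / \<eta>) * B" if n: "n \<in> {a..b}" for n
  proof -
    have inn: "inner n" using n by (simp add: inner_def)
    note r = inner_rhs_norm[of n x B, OF inn x, folded \<kappa>_def]
    have "coord (H x) (n, True) = inner_rhs (\<lambda>_. 0) x n False - of_nat p * (x (n, True) + x (n,
        False))"
      by (simp add: coord_def H_inner add.commute)
    then have "cmod (coord (H x) (n, True)) \<le> \<kappa> * B + real p * cmod (x (n, True) + x (n, False))"
      using norm_triangle_ineq4[of "inner_rhs (\<lambda>_. 0) x n False" "of_nat p * (x (n, True) + x (n,
          False))"]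
        r[of False] by (simp add: norm_mult)
    moreover have "real p * cmod (x (n, True) + x (n, False)) \<le> real p * (if n = m then e else 0)"
      by (intro mult_left_mono pair[OF inn]) simp
    ultimately have 1: "cmod (coord (H x) (n, True)) \<le> (if n = m then real p * e else 0) + \<kappa> * B"
      by (auto split: if_splits)
    \<comment> \<open>The block drops out of this coordinate: its values in the two components are
      opposite and cancel in the pair sum.\<close>
    have "coord (H x) (n, False) = - ((inner_rhs (\<lambda>_. 0) x n True +
        inner_rhs (\<lambda>_. 0) x n False) / of_real \<eta>)"
      by (simp add: coord_def H_inner add.commute minus_divide_left[symmetric] divide_inverse
          algebra_simps)
    moreover have "cmod (inner_rhs (\<lambda>_. 0) x n True + inner_rhs (\<lambda>_. 0) x n False) \<le> \<kappa> * B + \<kappa> * B"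
      by (rule order_trans[OF norm_triangle_ineq add_mono[OF r r]])
    ultimately have "cmod (coord (H x) (n, False)) \<le> (\<kappa> * B + \<kappa> * B) / \<eta>"
      using eta(1) by (simp add: norm_divide divide_right_mono)
    with 1 show ?thesis by (simp add: algebra_simps add_divide_distrib)
  qed
  have "(\<Sum>k\<in>I. cmod (coord (H x) k)) \<le> (\<Sum>n\<in>{a..b}. (if n =
      m then real p * e else 0) + \<kappa> * (1 + 2 / \<eta>) * B)"
    unfolding sum_I by (rule sum_mono[OF t])
  also have "\<dots> = (\<Sum>n\<in>{a..b}. if n = m then real p * e else 0) + real (card {a..b}) * (\<kappa> * (1 +
      2 / \<eta>)) * B"
    by (simp add: sum.distrib)
  also have "\<dots> \<le> real p * e + 1/32 * B"
    using mult_right_mono[OF kappa(3) B] e by (intro add_mono) auto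
  finally show ?thesis by simp
qed

lemma coord_H_outer_sum:
  assumes "l2_le x B" shows "(\<Sum>k\<in>I. cmod (coord (H (outer x)) k)) \<le> B / 32"
  using coord_H_sum[of "outer x" B a 0] l2_le_pointwise[OF assms] l2_le_nonneg[OF assms]
  by (auto simp: outer_def)

lemma coord_sum_l2:
  assumes "l2_le x B" shows "(\<Sum>k\<in>I. cmod (coord x k)) \<le> real (card {a..b}) * (1 + 2 / \<eta>) * B"
proof -
  have "cmod (coord x (n, True)) + cmod (coord x (n, False)) \<le> (1 + 2 / \<eta>) * B" for n
  proof -
    note p = l2_le_pointwise[OF assms]
    have "cmod (coord x (n, False)) \<le> (B + B) / \<eta>"
      using norm_triangle_ineq[of "x (n, True)" "x (n, False)"] p[of "(n, True)"] p[of "(n,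
          False)"] eta(1)
      by (simp add: coord_def norm_divide divide_right_mono)
    then show ?thesis using p[of "(n, False)"] by (simp add: coord_def algebra_simps)
  qed
  then have "(\<Sum>k\<in>I. cmod (coord x k)) \<le> (\<Sum>n\<in>{a..b}. (1 + 2 / \<eta>) * B)"
    unfolding sum_I by (intro sum_mono)
  then show ?thesis by simp
qed

lemma combination_l2:
  assumes X: "\<And>j. l2_le (\<lambda>i. X (j, i)) B" and t: "(\<Sum>k\<in>I. cmod (t k)) \<le> T"
  shows "l2_le (\<lambda>i. \<Sum>k\<in>I. t k * X (k, i)) (T * B)"
proof -
  have "l2_le (\<lambda>i. \<Sum>k\<in>I. t k * X (k, i)) (\<Sum>k\<in>I. cmod (t k) * B)"
    by (intro l2_le_sum l2_le_mult X) simp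
  moreover have "(\<Sum>k\<in>I. cmod (t k) * B) \<le> T * B"
    using mult_right_mono[OF t l2_le_nonneg[OF X]] by (simp add: sum_distrib_right)
  ultimately show ?thesis by (rule l2_le_mono)
qed

section \<open>The Riccati equation for the invariant graph\<close>

definition graph_vec :: "((int \<times> bool) \<times> (int \<times> bool) \<Rightarrow> complex) \<Rightarrow> int \<times> bool \<Rightarrow> int \<times> bool \<Rightarrow>
    complex" where
  "graph_vec X j i = block_vec j i + outer (\<lambda>i. X (j, i)) i"

text \<open>At an outer site, \<open>H (w j) \<in> span w\<close> reads
  \<open>sg * X + rest = \<Sum>k. coord (H (w j)) k * X k\<close>. Solving for the term
  \<open>sg * X\<close>, with \<open>sg\<close> its own inverse, yields this fixed point form.
  Entries that do not map an excited state outwards are set to zero.\<close>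

definition riccati :: "((int \<times> bool) \<times> (int \<times> bool) \<Rightarrow> complex) \<Rightarrow> (int \<times> bool) \<times> (int \<times> bool) \<Rightarrow>
    complex" where
  "riccati X = (\<lambda>(j, i). if j \<in> I \<and> \<not> inner (fst i)
     then sg (snd i) * ((\<Sum>k\<in>I. coord (H (graph_vec X j)) k * X (k,
         i)) - rest (graph_vec X j) i) else 0)"

lemma graph_vec_l2:
  assumes "\<And>j. l2_le (\<lambda>i. X (j, i)) 1" shows "l2_le (graph_vec X j) 3"
proof -
  have "l2_le (\<lambda>i. block_vec j i + outer (\<lambda>i. X (j, i)) i) (2 + 1)"
    by (intro l2_le_add block_vec_l2 outer_l2 assms)
  then show ?thesis by (simp add: graph_vec_def[abs_def])
qed

text \<open>The sum is \<open>p * \<eta> \<le> 1/16\<close> from the nilpotent entry plus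
  \<open>2/32\<close> from the perturbation acting on vectors bounded by \<open>2\<close>. This
  column sum both makes \<open>riccati\<close> contractive and bounds the eigenvalues on the
  graph.\<close>

lemma graph_vec_coord_sum:
  assumes X: "\<And>j. l2_le (\<lambda>i. X (j, i)) 1" and j: "j \<in> I"
  shows "(\<Sum>k\<in>I. cmod (coord (H (graph_vec X j)) k)) \<le> 1/8"
proof -
  have b: "cmod (graph_vec X j i) \<le> 2" for i
    using norm_triangle_ineq[of "block_vec j i" "outer (\<lambda>i. X (j, i)) i"] block_vec_norm[of j i]
      l2_le_pointwise[OF outer_l2[OF X], of j i] by (simp add: graph_vec_def)
  have "(\<Sum>k\<in>I. cmod (coord (H (graph_vec X j)) k)) \<le> real p * \<eta> + 2 / 32"
    by (rule coord_H_sum[of "graph_vec X j" 2 "fst j" \<eta>,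
        OF b]) (use eta(1) in \<open>auto simp: graph_vec_def block_vec_def outer_def\<close>)
  then show ?thesis using eta(3) by simp
qed

lemma graph_vec_diff: "(\<lambda>i. graph_vec X j i - graph_vec Y j i) = outer (\<lambda>i. X (j, i) - Y (j, i))"
  by (auto simp: graph_vec_def outer_def)

lemma riccati_eq_outer:
  "j \<in> I \<Longrightarrow> riccati X (j, i) = sg (snd i) * (outer (\<lambda>i. \<Sum>k\<in>I. coord (H (graph_vec X j)) k * X (k,
      i)) i
     - outer (rest (graph_vec X j)) i)"
  by (simp add: riccati_def outer_def)

lemma sg_l2: "l2_le f B \<Longrightarrow> l2_le (\<lambda>i. sg (snd i) * f i) B"
  by (erule l2_le_dominated) (simp add: norm_mult)

lemma riccati_ball:
  assumes X: "\<And>j. l2_le (\<lambda>i. X (j, i)) 1" shows "l2_le (\<lambda>i. riccati X (j, i)) 1"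
proof (cases "j \<in> I")
  case True
  have "l2_le (\<lambda>i. riccati X (j, i)) (1/8 * 1 + \<kappa> * 3)"
    unfolding riccati_eq_outer[OF True]
    by (intro sg_l2 l2_le_diff outer_l2 rest_l2 combination_l2 X graph_vec_coord_sum[OF X True]
        graph_vec_l2)
  then show ?thesis by (rule l2_le_mono) (use kappa(2) in simp)
next
  case False
  then show ?thesis using l2_le_mono[OF l2_le_zero, of 1] by (simp add: riccati_def)
qed

lemma riccati_contract:
  assumes X: "\<And>j. l2_le (\<lambda>i. X (j, i)) 1" and Y: "\<And>j. l2_le (\<lambda>i. Y (j, i)) 1"
    and XY: "\<And>j. l2_le (\<lambda>i. X (j, i) - Y (j, i)) C"
  shows "l2_le (\<lambda>i. riccati X (j, i) - riccati Y (j, i)) (1/2 * C)"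
proof (cases "j \<in> I")
  case True
  have C: "0 \<le> C" using l2_le_nonneg[OF XY] .
  let ?d = "\<lambda>i. X (j, i) - Y (j, i)"
  let ?A = "\<lambda>k. coord (H (graph_vec X j)) k"
  let ?B = "\<lambda>k. coord (H (outer ?d)) k"
  have AB: "?A k - coord (H (graph_vec Y j)) k = ?B k" for k
    unfolding graph_vec_diff[of X j Y, symmetric] coord_diff[symmetric] H_diff[symmetric,
        abs_def] ..
  \<comment> \<open>The quadratic term is split as
    \<open>A * X - A' * Y = A * (X - Y) + (A - A') * Y\<close>, where \<open>A - A'\<close> is
    linear in the difference.\<close>
  have eq: "riccati X (j, i) - riccati Y (j, i) = sg (snd i) *
      (outer (\<lambda>i. \<Sum>k\<in>I. ?A k * (X (k, i) - Y (k, i))) i + outer (\<lambda>i. \<Sum>k\<in>I. ?B k * Y (k, i)) i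
       - outer (rest (outer ?d)) i)" for i
  proof -
    have "(\<Sum>k\<in>I. ?A k * X (k, i)) - (\<Sum>k\<in>I. coord (H (graph_vec Y j)) k * Y (k, i)) =
      (\<Sum>k\<in>I. ?A k * (X (k, i) - Y (k, i))) + (\<Sum>k\<in>I. ?B k * Y (k, i))"
      unfolding AB[symmetric] sum.distrib[symmetric] sum_subtractf[symmetric]
      by (rule sum.cong) (auto simp: algebra_simps)
    moreover have "rest (graph_vec X j) i - rest (graph_vec Y j) i = rest (outer ?d) i"
      unfolding graph_vec_diff[of X j Y, symmetric] rest_diff ..
    moreover have "t * (u - u') - t * (v - v') = t * ((u - v) - (u' - v'))" for t u u' v v' ::
        complex
      by (simp add: algebra_simps)
    ultimately show ?thesis
      unfolding riccati_eq_outer[OF True] outer_def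
          by (cases "inner (fst i)") (simp_all only: if_True if_False simp_thms diff_self
          mult_zero_right add_0)
  qed
  have "l2_le (\<lambda>i. riccati X (j, i) - riccati Y (j, i)) (1/8 * C + C / 32 * 1 + \<kappa> * C)"
    unfolding eq
  proof (rule sg_l2, rule l2_le_diff[OF l2_le_add[OF outer_l2 outer_l2] rest_l2[OF outer_l2[OF
      XY]]])
    show "l2_le (\<lambda>i. \<Sum>k\<in>I. ?A k * (X (k, i) - Y (k, i))) (1/8 * C)"
      by (rule combination_l2[of "\<lambda>ji. X ji - Y ji", OF XY graph_vec_coord_sum[OF X True]])
    show "l2_le (\<lambda>i. \<Sum>k\<in>I. ?B k * Y (k, i)) (C / 32 * 1)"
      by (rule combination_l2[OF Y coord_H_outer_sum[OF XY]])
  qed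
  moreover have "1/8 * C + C / 32 * 1 + \<kappa> * C \<le> 1/2 * C"
    using mult_right_mono[OF kappa(2) C] C by simp
  ultimately show ?thesis by (rule l2_le_mono)
next
  case False
  then show ?thesis
    using l2_le_mono[OF l2_le_zero, of "1/2 * C"] l2_le_nonneg[OF XY] by (simp add: riccati_def)
qed

lemma riccati_solution: "\<exists>X. (\<forall>j. l2_le (\<lambda>i. X (j, i)) 1) \<and> riccati X = X"
proof -
  interpret col: pointwise_norm "\<lambda>X B. \<forall>j::int \<times> bool. l2_le (\<lambda>i::int \<times> bool. X (j, i)) B" "\<lambda>_. 1"
    by (rule pointwise_norm_column_l2_le)
  have "\<exists>X. (\<forall>j. l2_le (\<lambda>i. X (j, i)) 1) \<and> riccati X = X \<and>
      (\<forall>k. \<forall>j. l2_le (\<lambda>i. X (j, i) - (riccati ^^ k) (\<lambda>_. 0) (j, i)) ((1/2) ^ k * 1 / (1 - 1/2)))"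
  proof (rule col.contraction_fixed_point)
    show "\<forall>j. l2_le (\<lambda>i. riccati X (j, i)) 1" if "\<forall>j. l2_le (\<lambda>i. X (j, i)) 1" for X
      using riccati_ball[of X] that by blast
    show "\<forall>j. l2_le (\<lambda>i. riccati X (j, i) - riccati Y (j, i)) (1/2 * C)"
      if "\<forall>j. l2_le (\<lambda>i. X (j, i)) 1" "\<forall>j. l2_le (\<lambda>i. Y (j, i)) 1"
        "\<forall>j. l2_le (\<lambda>i. X (j, i) - Y (j, i)) C" for X Y C
      using riccati_contract[of X Y C] that by blast
  qed auto
  then show ?thesis by blast
qed

definition X :: "(int \<times> bool) \<times> (int \<times> bool) \<Rightarrow> complex" where
  "X = (SOME X. (\<forall>j. l2_le (\<lambda>i. X (j, i)) 1) \<and> riccati X = X)"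

lemma X_l2: "l2_le (\<lambda>i. X (j, i)) 1" and X_riccati: "riccati X = X"
proof -
  have "(\<forall>j. l2_le (\<lambda>i. X (j, i)) 1) \<and> riccati X = X"
    unfolding X_def by (rule someI_ex[OF riccati_solution])
  then show "l2_le (\<lambda>i. X (j, i)) 1" "riccati X = X" by blast+
qed

section \<open>The invariant subspace and the eigenvalues on it\<close>

definition w :: "int \<times> bool \<Rightarrow> int \<times> bool \<Rightarrow> complex" where "w j = graph_vec X j"

lemma w_l2: "l2_le (w j) 3"
  unfolding w_def by (rule graph_vec_l2[OF X_l2])

lemma coord_w: "j \<in> I \<Longrightarrow> coord (w k) j = (if j = k then 1 else 0)"
  unfolding w_def graph_vec_def[abs_def] by (simp add: coord_add coord_block_vec coord_outer)

text \<open>At excited sites this is the expansion of an arbitrary state in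
  \<open>block_vec\<close>; at the other sites it is the Riccati equation.\<close>

lemma H_w:
  assumes j: "j \<in> I" shows "H (w j) i = (\<Sum>k\<in>I. coord (H (w j)) k * w k i)"
proof (cases "inner (fst i)")
  case True
  have "w k i = block_vec k i" for k using True by (simp add: w_def graph_vec_def outer_def)
  then show ?thesis using block_expansion[OF True] by simp
next
  case False
  have wX: "w k i = X (k, i)" if "k \<in> I" for k
    using False block_vec_outer[OF that False] by (simp add: w_def graph_vec_def outer_def)
  have "X (j, i) = sg (snd i) * ((\<Sum>k\<in>I. coord (H (w j)) k * X (k, i)) - rest (w j) i)"
    using fun_cong[OF X_riccati, of "(j, i)"] j False by (simp add: riccati_def w_def)
  then have "sg (snd i) * X (j, i) = (\<Sum>k\<in>I. coord (H (w j)) k * X (k, i)) - rest (w j) i" by simp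
  then have "H (w j) i = (\<Sum>k\<in>I. coord (H (w j)) k * X (k, i))"
    using wX[OF j] by (simp add: rest_def)
  then show ?thesis using wX by simp
qed

text \<open>The span of the \<open>w j\<close> for \<open>j \<in> I\<close>. The coefficients can be
  read off from \<open>x\<close> itself, since \<open>coord\<close> is dual to
  \<open>w\<close>.\<close>

definition W :: "(int \<times> bool \<Rightarrow> complex) set" where
  "W = {x. x = (\<lambda>i. \<Sum>j\<in>I. coord x j * w j i)}"

lemma combination_in_W: "(\<lambda>i. \<Sum>j\<in>I. t j * w j i) \<in> W"
proof -
  have "coord (\<lambda>i. \<Sum>j\<in>I. t j * w j i) k = t k" if "k \<in> I" for k
  proof -
    have "coord (\<lambda>i. \<Sum>j\<in>I. t j * w j i) k = (\<Sum>j\<in>I. if k = j then t j else 0)"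
      unfolding coord_sum[OF finite_I] using that by (intro sum.cong) (auto simp: coord_w)
    then show ?thesis using that by simp
  qed
  then show ?thesis by (simp add: W_def)
qed

text \<open>The expansion holds at excited sites for every state, so membership in the graph is a
  linear condition on the values outside.\<close>

lemma W_outer: "x \<in> W \<longleftrightarrow> (\<forall>i. \<not> inner (fst i) \<longrightarrow> x i = (\<Sum>j\<in>I. coord x j * X (j, i)))"
proof -
  have 1: "(\<Sum>j\<in>I. coord x j * w j i) = (\<Sum>j\<in>I. coord x j * X (j, i))" if "\<not> inner (fst i)" for i
    by (rule sum.cong) (use that block_vec_outer[OF _ that] in \<open>auto simp: w_def graph_vec_def
        outer_def\<close>)
  have 2: "(\<Sum>j\<in>I. coord x j * w j i) = x i" if "inner (fst i)" for i
    using block_expansion[OF that, of x] that by (simp add: w_def graph_vec_def outer_def)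
  have "x i = (\<Sum>j\<in>I. coord x j * w j i) \<longleftrightarrow>
      (\<not> inner (fst i) \<longrightarrow> x i = (\<Sum>j\<in>I. coord x j * X (j, i)))" for i
    using 1[of i] 2[of i] by (cases "inner (fst i)") auto
  then show ?thesis unfolding W_def mem_Collect_eq fun_eq_iff by (simp only:)
qed

lemma W_combination: "x \<in> W \<Longrightarrow> x i = (\<Sum>j\<in>I. coord x j * w j i)"
  unfolding W_def mem_Collect_eq by (rule fun_cong)

lemma W_add: "x \<in> W \<Longrightarrow> y \<in> W \<Longrightarrow> (\<lambda>i. x i + y i) \<in> W"
  by (simp add: W_outer coord_add distrib_right sum.distrib)

lemma W_scale: "x \<in> W \<Longrightarrow> (\<lambda>i. t * x i) \<in> W"
  by (simp add: W_outer coord_scale sum_distrib_left mult.assoc)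

lemma W_diff: "x \<in> W \<Longrightarrow> y \<in> W \<Longrightarrow> (\<lambda>i. x i - y i) \<in> W"
  by (simp add: W_outer coord_diff left_diff_distrib sum_subtractf)

lemma W_l2: "x \<in> W \<Longrightarrow> \<exists>B. l2_le x B"
proof -
  assume x: "x \<in> W"
  have "l2_le (\<lambda>i. \<Sum>j\<in>I. coord x j * w j i) (\<Sum>j\<in>I. cmod (coord x j) * 3)"
    by (intro l2_le_sum l2_le_mult w_l2) simp
  then show ?thesis using x unfolding W_def by auto
qed

lemma H_W: assumes x: "x \<in> W" shows "H x \<in> W"
proof -
  have "H x i = (\<Sum>j\<in>I. coord x j * (\<Sum>k\<in>I. coord (H (w j)) k * w k i))" for i
  proof -
    have "H x i = H (\<lambda>i. \<Sum>j\<in>I. coord x j * w j i) i" using x unfolding W_def by simp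
    also have "\<dots> = (\<Sum>j\<in>I. coord x j * H (w j) i)" by (rule H_sum) simp
    finally show ?thesis by (simp add: H_w)
  qed
  also have "(\<Sum>j\<in>I. coord x j * (\<Sum>k\<in>I. coord (H (w j)) k * w k i)) =
      (\<Sum>k\<in>I. (\<Sum>j\<in>I. coord x j * coord (H (w j)) k) * w k i)" for i
    unfolding sum_distrib_left sum_distrib_right by (subst sum.swap) (simp add: mult.assoc)
  finally have "H x = (\<lambda>i. \<Sum>k\<in>I. (\<Sum>j\<in>I. coord x j * coord (H (w j)) k) * w k i)" by auto
  then show ?thesis using combination_in_W by simp
qed

text \<open>The matrix of \<open>H\<close> in the basis \<open>w\<close> has column sums at most
  \<open>1/8\<close>, which bounds it in the norm \<open>\<Sum>k. |coord x k|\<close>.\<close>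

theorem W_eigenvalue_small:
  assumes x: "x \<in> W" "x \<noteq> (\<lambda>_. 0)" and ev: "\<And>i. H x i = z * x i"
  shows "cmod z \<le> 1/8"
proof -
  let ?S = "\<Sum>k\<in>I. cmod (coord x k)"
  have S: "0 < ?S"
  proof (rule ccontr)
    assume "\<not> 0 < ?S"
    then have "?S = 0" using sum_nonneg[of I "\<lambda>k. cmod (coord x k)"] by simp
    then have "\<forall>k\<in>I. coord x k = 0" by (simp add: sum_nonneg_eq_0_iff)
    then have "x = (\<lambda>_. 0)" using x(1) W_combination[OF x(1)] by (simp add: fun_eq_iff)
    then show False using x(2) by simp
  qed
  have ck: "z * coord x k = (\<Sum>j\<in>I. coord x j * coord (H (w j)) k)" for k
  proof -
    have "z * coord x k = coord (\<lambda>i. z * x i) k" by (simp add: coord_scale)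
    also have "(\<lambda>i. z * x i) = (\<lambda>i. \<Sum>j\<in>I. coord x j * H (w j) i)"
    proof
      fix i
      have "H x i = H (\<lambda>i. \<Sum>j\<in>I. coord x j * w j i) i" using x(1) unfolding W_def by simp
      then show "z * x i = (\<Sum>j\<in>I. coord x j * H (w j) i)" using ev[of i] by (simp add: H_sum)
    qed
    also have "coord \<dots> k = (\<Sum>j\<in>I. coord x j * coord (H (w j)) k)" by (rule coord_sum) simp
    finally show ?thesis .
  qed
  have "cmod z * ?S = (\<Sum>k\<in>I. cmod (\<Sum>j\<in>I. coord x j * coord (H (w j)) k))"
    by (simp add: sum_distrib_left norm_mult[symmetric] ck)
  also have "\<dots> \<le> (\<Sum>k\<in>I. \<Sum>j\<in>I. cmod (coord x j) * cmod (coord (H (w j)) k))"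
    by (intro sum_mono order_trans[OF norm_sum]) (simp add: norm_mult)
  also have "\<dots> = (\<Sum>j\<in>I. cmod (coord x j) * (\<Sum>k\<in>I. cmod (coord (H (w j)) k)))"
    by (subst sum.swap) (simp add: sum_distrib_left)
  also have "\<dots> \<le> (\<Sum>j\<in>I. cmod (coord x j) * (1/8))"
    unfolding w_def by (intro sum_mono mult_left_mono graph_vec_coord_sum[OF X_l2]) auto
  also have "\<dots> = 1/8 * ?S" unfolding sum_distrib_right[symmetric] by simp
  finally show ?thesis using S by simp
qed

text \<open>Its fixed points are the \<open>y\<close> vanishing at excited sites with
  \<open>g - (H - \<Omega>) y \<in> W\<close>. By \<open>W_outer\<close> this means \<open>g - rest
  y - \<Sum>k. coord (g - H y) k * X k = (sg - \<Omega>) y\<close> outside, and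
  \<open>sg - \<Omega>\<close> has modulus at least \<open>1/2\<close>.\<close>

definition complement_map :: "complex \<Rightarrow> (int \<times> bool \<Rightarrow> complex) \<Rightarrow> (int \<times> bool \<Rightarrow> complex) \<Rightarrow> int \<times>
    bool \<Rightarrow> complex" where
  "complement_map \<Omega> g y i = outer (\<lambda>i. g i - outer (rest (outer y)) i
     - (\<Sum>k\<in>I. coord (\<lambda>i. g i - H (outer y) i) k * X (k, i))) i / (sg (snd i) - \<Omega>)"

lemma sg_minus_ge: "cmod \<Omega> < 1/2 \<Longrightarrow> 1/2 \<le> cmod (sg s - \<Omega>)"
  using norm_triangle_ineq2[of "sg s" \<Omega>] by simp

lemma divide_sg_l2:
  assumes \<Omega>: "cmod \<Omega> < 1/2" and f: "l2_le f B" shows "l2_le (\<lambda>i. f i / (sg (snd i) - \<Omega>)) (2 * B)"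
proof -
  have "l2_le (\<lambda>i. 2 * f i) (cmod 2 * B)" by (rule l2_le_mult[OF f])
  then have "l2_le (\<lambda>i. 2 * f i) (2 * B)" by simp
  then show ?thesis
  proof (rule l2_le_dominated)
    fix i
    have "cmod (f i) / cmod (sg (snd i) - \<Omega>) \<le> cmod (f i) / (1/2)"
      using sg_minus_ge[OF \<Omega>, of "snd i"] by (intro divide_left_mono) auto
    then show "cmod (f i / (sg (snd i) - \<Omega>)) \<le> cmod (2 * f i)" by (simp add: norm_divide norm_mult)
  qed
qed

lemma complement_contract:
  assumes \<Omega>: "cmod \<Omega> < 1/2" and xy: "l2_le (\<lambda>i. x i - y i) C"
  shows "l2_le (\<lambda>i. complement_map \<Omega> g x i - complement_map \<Omega> g y i) (1/2 * C)"
proof -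
  have C: "0 \<le> C" using l2_le_nonneg[OF xy] .
  let ?d = "outer (\<lambda>i. x i - y i)"
  have od: "?d = (\<lambda>i. outer x i - outer y i)" by (auto simp: outer_def)
  have Hd: "H ?d = (\<lambda>i. H (outer x) i - H (outer y) i)" unfolding od by (rule ext) (rule H_diff)
  have rd: "rest ?d i = rest (outer x) i - rest (outer y) i" for i unfolding od by (rule rest_diff)
  have eq: "complement_map \<Omega> g x i - complement_map \<Omega> g y i =
    outer (\<lambda>i. (\<Sum>k\<in>I. coord (H ?d) k * X (k, i)) - outer (rest ?d) i) i / (sg (snd i) - \<Omega>)" for i
  proof -
    have "(\<Sum>k\<in>I. coord (\<lambda>i. g i - H (outer y) i) k * X (k,
        i)) - (\<Sum>k\<in>I. coord (\<lambda>i. g i - H (outer x) i) k * X (k, i))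
      = (\<Sum>k\<in>I. coord (H ?d) k * X (k, i))"
      unfolding Hd sum_subtractf[symmetric] coord_diff
      by (rule sum.cong) (auto simp: algebra_simps)
    then show ?thesis
      unfolding complement_map_def diff_divide_distrib[symmetric]
      by (auto simp: outer_def rd algebra_simps)
  qed
  have "l2_le (\<lambda>i. complement_map \<Omega> g x i - complement_map \<Omega> g y i) (2 * (C / 32 * 1 + \<kappa> * C))"
    unfolding eq
    by (rule divide_sg_l2[OF \<Omega> outer_l2[OF l2_le_diff[OF combination_l2[OF X_l2
        coord_H_outer_sum[OF xy]]
          rest_l2[OF outer_l2[OF xy]]]]])
  moreover have "2 * (C / 32 * 1 + \<kappa> * C) \<le> 1/2 * C"
    using mult_right_mono[OF kappa(2) C] C by simp
  ultimately show ?thesis by (rule l2_le_mono)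
qed

lemma complement_zero:
  assumes \<Omega>: "cmod \<Omega> < 1/2" and g: "l2_le g G"
  shows "l2_le (complement_map \<Omega> g (\<lambda>_. 0)) (2 * ((1 + real (card {a..b}) * (1 + 2 / \<eta>)) * G))"
proof -
  have o0: "outer (\<lambda>_. 0) = (\<lambda>_. 0)" by (auto simp: outer_def)
  have H0: "H (\<lambda>_. 0) = (\<lambda>_. 0)" by (auto simp: H_def)
  have r0: "rest (\<lambda>_. 0) = (\<lambda>_. 0)" by (auto simp: rest_def H0)
  have eq: "complement_map \<Omega> g (\<lambda>_. 0) = (\<lambda>i. outer (\<lambda>i. g i - (\<Sum>k\<in>I. coord g k * X (k,
      i))) i / (sg (snd i) - \<Omega>))"
    by (rule ext) (simp add: complement_map_def o0 H0 r0)
  have "l2_le (complement_map \<Omega> g (\<lambda>_. 0)) (2 * (G + real (card {a..b}) * (1 + 2 / \<eta>) * G * 1))"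
    unfolding eq
    by (intro divide_sg_l2[OF \<Omega>] outer_l2 l2_le_diff g combination_l2[OF X_l2] coord_sum_l2)
  then show ?thesis by (simp add: distrib_right mult.assoc)
qed

lemma complement_fixed_iff:
  assumes \<Omega>: "cmod \<Omega> < 1/2" and y: "y = outer y"
  shows "complement_map \<Omega> g y = y \<longleftrightarrow> (\<lambda>i. g i - (H y i - \<Omega> * y i)) \<in> W"
proof -
  \<comment> \<open>The term \<open>\<Omega> * y\<close> has no coordinates because \<open>y\<close>
    vanishes at excited sites.\<close>
  have coord: "coord (\<lambda>i. g i - (H y i - \<Omega> * y i)) k = coord (\<lambda>i. g i - H y i) k" if "k \<in> I" for k
  proof -
    have "coord (\<lambda>i. g i - (H y i - \<Omega> * y i)) k = coord (\<lambda>i. (g i - H y i) + \<Omega> * outer y i) k"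
      by (rule arg_cong[of _ _ "\<lambda>f. coord f k"]) (simp add: y[symmetric] algebra_simps)
    then show ?thesis unfolding coord_add coord_scale using coord_outer[OF that] by simp
  qed
  have ne: "sg (snd i) - \<Omega> \<noteq> 0" for i :: "int \<times> bool"
    using sg_minus_ge[OF \<Omega>, of "snd i"] by auto
  have "complement_map \<Omega> g y i = y i \<longleftrightarrow> inner (fst i) \<or>
      g i - (H y i - \<Omega> * y i) = (\<Sum>k\<in>I. coord (\<lambda>i. g i - (H y i - \<Omega> * y i)) k * X (k, i))" for i
  proof (cases "inner (fst i)")
    case True
    have "y i = 0" using fun_cong[OF y, of i] True by (simp add: outer_def)
    then show ?thesis using True by (simp add: complement_map_def outer_def)
  next
    case False
    have "complement_map \<Omega> g y i = (g i - rest y i - (\<Sum>k\<in>I. coord (\<lambda>i. g i - H y i) k * X (k,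
        i))) / (sg (snd i) - \<Omega>)"
      using False by (simp add: complement_map_def y[symmetric]) (simp add: outer_def)
    also have "\<dots> = y i \<longleftrightarrow> g i - rest y i - (\<Sum>k\<in>I. coord (\<lambda>i. g i - H y i) k * X (k, i)) =
        y i * (sg (snd i) - \<Omega>)"
      using ne[of i] by (simp add: divide_eq_eq)
    also have "\<dots> \<longleftrightarrow> g i - (H y i - \<Omega> * y i) = (\<Sum>k\<in>I. coord (\<lambda>i. g i - H y i) k * X (k, i))"
      by (auto simp: rest_def algebra_simps)
    also have "(\<Sum>k\<in>I. coord (\<lambda>i. g i - H y i) k * X (k, i)) =
        (\<Sum>k\<in>I. coord (\<lambda>i. g i - (H y i - \<Omega> * y i)) k * X (k, i))"
      by (rule sum.cong) (simp_all add: coord)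
    finally show ?thesis using False by simp
  qed
  then show ?thesis unfolding fun_eq_iff W_outer by blast
qed

lemma complement_map_outer: "outer (complement_map \<Omega> g y) = complement_map \<Omega> g y"
  by (auto simp: complement_map_def outer_def)

text \<open>Solvability modulo \<open>W\<close>, with a bound uniform in \<open>\<Omega>\<close>.
  What is left of \<open>g\<close> lies in a finite-dimensional space.\<close>

theorem complement_solution:
  assumes \<Omega>: "cmod \<Omega> < 1/2" and g: "l2_le g G"
  shows "\<exists>y. l2_le y (4 * (1 + real (card {a..b}) * (1 + 2 / \<eta>)) * G) \<and>
      (\<lambda>i. g i - (H y i - \<Omega> * y i)) \<in> W"
proof -
  interpret l2: pointwise_norm "l2_le :: (int \<times> bool \<Rightarrow> complex) \<Rightarrow> real \<Rightarrow> bool" "\<lambda>_. 1"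
    by (rule pointwise_norm_l2_le)
  define D where "D = 2 * ((1 + real (card {a..b}) * (1 + 2 / \<eta>)) * G)"
  note D = complement_zero[OF \<Omega> g, folded D_def]
  have D0: "0 \<le> 2 * D" using l2_le_nonneg[OF D] by simp
  have ball: "l2_le (complement_map \<Omega> g x) (2 * D)" if "l2_le x (2 * D)" for x
  proof -
    have "l2_le (\<lambda>i. complement_map \<Omega> g x i - complement_map \<Omega> g (\<lambda>_. 0) i) (1/2 * (2 * D))"
      by (rule complement_contract[OF \<Omega>]) (use that in simp)
    from l2_le_add[OF this D] show ?thesis by simp
  qed
  have "\<exists>y. l2_le y (2 * D) \<and> complement_map \<Omega> g y = y \<and>
      (\<forall>k. l2_le (\<lambda>i. y i - (complement_map \<Omega> g ^^ k) (\<lambda>_. 0) i) ((1/2) ^ k * (2 * D) / (1 - 1/2)))"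
    by (rule l2.contraction_fixed_point) (use D0 ball complement_contract[OF \<Omega>] in auto)
  then obtain y where y: "l2_le y (2 * D)" "complement_map \<Omega> g y = y" by blast
  have "y = outer y" using complement_map_outer[of \<Omega> g y] y(2) by simp
  then have "(\<lambda>i. g i - (H y i - \<Omega> * y i)) \<in> W" using complement_fixed_iff[OF \<Omega>] y(2) by blast
  moreover have "2 * D = 4 * (1 + real (card {a..b}) * (1 + 2 / \<eta>)) * G" by (simp add: D_def)
  ultimately show ?thesis using y(1) by metis
qed

text \<open>Injectivity modulo \<open>W\<close>: subtracting the element \<open>v\<close> of
  \<open>W\<close> that agrees with \<open>x\<close> at excited sites leaves a fixed point of the
  complement map for \<open>g = 0\<close>, which vanishes by contraction. Hence kernels of powers of
  \<open>H - \<Omega>\<close> lie in \<open>W\<close>.\<close>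

theorem complement_injective:
  assumes \<Omega>: "cmod \<Omega> < 1/2" and x: "l2_le x B" and HW: "(\<lambda>i. H x i - \<Omega> * x i) \<in> W"
  shows "x \<in> W"
proof -
  interpret l2: pointwise_norm "l2_le :: (int \<times> bool \<Rightarrow> complex) \<Rightarrow> real \<Rightarrow> bool" "\<lambda>_. 1"
    by (rule pointwise_norm_l2_le)
  define v where "v = (\<lambda>i. \<Sum>j\<in>I. coord x j * w j i)"
  define y where "y i = x i - v i" for i
  have v: "v \<in> W" unfolding v_def by (rule combination_in_W)
  obtain V where V: "l2_le v V" using W_l2[OF v] by blast
  have y2: "l2_le y (B + V)" unfolding y_def[abs_def] by (rule l2_le_diff[OF x V])
  have yo: "y = outer y"
  proof
    fix i
    have "v i = x i" if "inner (fst i)"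
      using block_expansion[OF that, of x] that by (simp add: v_def w_def graph_vec_def outer_def)
    then show "y i = outer y i" by (simp add: y_def outer_def)
  qed
  have "(\<lambda>i. (- 1) * ((H x i - \<Omega> * x i) - (H v i - \<Omega> * v i))) \<in> W"
    by (intro W_scale W_diff HW H_W v)
  moreover have "(\<lambda>i. (- 1) * ((H x i - \<Omega> * x i) - (H v i - \<Omega> * v i))) =
      (\<lambda>i. 0 - (H y i - \<Omega> * y i))"
  proof
    fix i
    have "H y i = H x i - H v i" unfolding y_def[abs_def] by (rule H_diff)
    then show "(- 1) * ((H x i - \<Omega> * x i) - (H v i - \<Omega> * v i)) = 0 - (H y i - \<Omega> * y i)"
      by (simp add: y_def algebra_simps)
  qed
  ultimately have fixed: "complement_map \<Omega> (\<lambda>_. 0) y = y"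
    using complement_fixed_iff[OF \<Omega> yo, of "\<lambda>_. 0"] by simp
  have z0: "outer (\<lambda>_. 0) = (\<lambda>_. 0)" by (auto simp: outer_def)
  have "(\<lambda>_. 0) \<in> W" using W_scale[OF v, of 0] by simp
  then have fixed0: "complement_map \<Omega> (\<lambda>_. 0) (\<lambda>_. 0) = (\<lambda>_. 0)"
    using complement_fixed_iff[OF \<Omega> z0[symmetric], of "\<lambda>_. 0"] by (simp add: H_def case_prod_beta)
  have R: "0 \<le> B + V" by (rule l2_le_nonneg[OF y2])
  have ball: "l2_le (complement_map \<Omega> (\<lambda>_. 0) u) (B + V)" if "l2_le u (B + V)" for u
  proof -
    have "l2_le (\<lambda>i. complement_map \<Omega> (\<lambda>_. 0) u i - complement_map \<Omega> (\<lambda>_. 0) (\<lambda>_. 0) i) (1/2 * (B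
        + V))"
      by (rule complement_contract[OF \<Omega>]) (use that in simp)
    then have "l2_le (complement_map \<Omega> (\<lambda>_. 0) u) (1/2 * (B + V))" unfolding fixed0 by simp
    then show ?thesis by (rule l2_le_mono) (use R in simp)
  qed
  have "y = (\<lambda>_. 0)"
    by (rule l2.contraction_unique[of "1/2" "B + V" "complement_map \<Omega> (\<lambda>_. 0)"])
      (use R ball complement_contract[OF \<Omega>] y2 fixed fixed0 l2_le_mono[OF l2_le_zero R] in auto)
  then have "x = v" by (auto simp: y_def fun_eq_iff)
  then show ?thesis using v by simp
qed

end

section \<open>Roots in the unit disk\<close>

text \<open>The roots \<open>c + s\<close> and \<open>c - s\<close> have product \<open>1\<close>.
  If one had modulus \<open>1\<close>, the other would be its conjugate and \<open>c\<close> would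
  be its real part, a point of \<open>[-1, 1]\<close>.\<close>

lemma small_root_exists:
  assumes c: "c \<notin> complex_of_real ` {-1..1}"
  shows "\<exists>z. z \<noteq> 0 \<and> cmod z < 1 \<and> 1 + z\<^sup>2 = 2 * c * z"
proof -
  define s where "s = csqrt (c\<^sup>2 - 1)"
  have s2: "s\<^sup>2 = c\<^sup>2 - 1" by (simp add: s_def)
  have prod: "(c + s) * (c - s) = 1" using s2 by (simp add: algebra_simps power2_eq_square)
  then have ne: "c + s \<noteq> 0" "c - s \<noteq> 0" by auto
  have root: "1 + (c + s)\<^sup>2 = 2 * c * (c + s)" "1 + (c - s)\<^sup>2 = 2 * c * (c - s)"
    using s2 by (simp_all add: algebra_simps power2_eq_square)
  have norms: "cmod (c + s) * cmod (c - s) = 1" using prod by (metis norm_mult norm_one)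
  have "cmod (c + s) \<noteq> 1"
  proof
    assume 1: "cmod (c + s) = 1"
    then have "(c + s) * cnj (c + s) = 1" using complex_norm_square[of "c + s"] by simp
    then have "cnj (c + s) = c - s" using prod ne(1) by (metis mult_left_cancel)
    then have "c = (c + s + cnj (c + s)) / 2" by (simp only:) simp
    moreover have "complex_of_real (2 * Re (c + s)) / 2 = of_real (Re (c + s))" by simp
    ultimately have e: "c = of_real (Re (c + s))" unfolding complex_add_cnj by (rule trans)
    have "\<bar>Re (c + s)\<bar> \<le> 1" using abs_Re_le_cmod[of "c + s"] 1 by simp
    then have "Re (c + s) \<in> {-1..1}" by auto
    then show False using c e by blast
  qed
  then consider "cmod (c + s) < 1" | "1 < cmod (c + s)" by linarith
  then show ?thesis
  proof cases
    case 1
    then show ?thesis using ne root by blast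
  next
    case 2
    have "cmod (c - s) < 1"
    proof (rule ccontr)
      assume "\<not> cmod (c - s) < 1"
      then have "cmod (c + s) * 1 \<le> cmod (c + s) * cmod (c - s)" by (intro mult_left_mono) auto
      then show False using norms 2 by simp
    qed
    then show ?thesis using ne root by blast
  qed
qed

text \<open>The branch point \<open>x = 0\<close> corresponds to the ends of the bands; there the
  modulus of the square root is enough.\<close>

lemma csqrt_tendsto_nonneg:
  assumes f: "(f \<longlongrightarrow> complex_of_real x) F" and x: "0 \<le> x"
  shows "((\<lambda>t. csqrt (f t)) \<longlongrightarrow> csqrt (of_real x)) F"
proof (cases "x = 0")
  case True
  have "((\<lambda>t. sqrt (cmod (f t))) \<longlongrightarrow> sqrt (cmod 0)) F"
    using f True by (intro tendsto_intros) auto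
  then have "((\<lambda>t. cmod (csqrt (f t))) \<longlongrightarrow> 0) F" by (simp add: norm_csqrt)
  then have "((\<lambda>t. csqrt (f t)) \<longlongrightarrow> 0) F" by (rule tendsto_norm_zero_cancel)
  then show ?thesis using True by simp
next
  case False
  then have "complex_of_real x \<notin> \<real>\<^sub>\<le>\<^sub>0" using x by (auto simp: complex_nonpos_Reals_iff)
  then have "isCont csqrt (of_real x)" by (rule continuous_at_csqrt)
  then show ?thesis using f by (rule isCont_tendsto_compose)
qed

text \<open>The root in the unit disk, with its limit as the spectral parameter reaches the band
  from one side. On the band, Joukowski's formula \<open>c - i \<surd>(1 - c\<^sup>2)\<close> selects it.\<close>

lemma small_root_limit_pos:
  fixes \<alpha> \<beta> :: real
  assumes b: "0 < \<beta>" and a: "\<bar>\<alpha>\<bar> \<le> 1"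
  shows "\<exists>\<zeta> \<zeta>0. (\<forall>\<mu>>0. \<zeta> \<mu> \<noteq> 0 \<and> cmod (\<zeta> \<mu>) < 1 \<and> 1 + (\<zeta> \<mu>)\<^sup>2 = 2 * Complex \<alpha> (\<beta> * \<mu>) * \<zeta> \<mu>) \<and>
    (\<zeta> \<longlongrightarrow> \<zeta>0) (at_right 0)"
proof -
  define c where "c \<mu> = Complex \<alpha> (\<beta> * \<mu>)" for \<mu>
  define s where "s \<mu> = csqrt (1 - (c \<mu>)\<^sup>2)" for \<mu>
  define \<zeta> where "\<zeta> \<mu> = c \<mu> - \<i> * s \<mu>" for \<mu>
  have s2: "(s \<mu>)\<^sup>2 = 1 - (c \<mu>)\<^sup>2" for \<mu> by (simp add: s_def)
  have prod: "\<zeta> \<mu> * (c \<mu> + \<i> * s \<mu>) = 1" for \<mu>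
    using s2[of \<mu>] by (simp add: \<zeta>_def algebra_simps power2_eq_square)
  have root: "1 + (\<zeta> \<mu>)\<^sup>2 = 2 * c \<mu> * \<zeta> \<mu>" for \<mu>
    using s2[of \<mu>] by (simp add: \<zeta>_def algebra_simps power2_eq_square)
  have lt: "cmod (\<zeta> \<mu>) < 1" if \<mu>: "0 < \<mu>" for \<mu>
  proof -
    let ?y = "c \<mu> + \<i> * s \<mu>"
    have Rs: "0 \<le> Re (s \<mu>)" unfolding s_def by (rule Re_csqrt)
    have Iy: "0 < Im ?y" using Rs b \<mu> by (simp add: c_def add_pos_nonneg)
    \<comment> \<open>Multiplying \<open>\<zeta> * y = 1\<close> by the conjugate of
      \<open>\<zeta>\<close> gives \<open>|\<zeta>|^2 * Im y = - Im \<zeta>\<close>. Together with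
      this sum, \<open>(1 - |\<zeta>|^2) * Im y = 2 * \<beta> * \<mu> > 0\<close>, and
      \<open>Im y > 0\<close> by the principal branch.\<close>
    have sum: "Im (\<zeta> \<mu>) + Im ?y = 2 * \<beta> * \<mu>" by (simp add: \<zeta>_def c_def)
    have "\<zeta> \<mu> * ?y = 1" by (rule prod)
    moreover have "of_real ((cmod (\<zeta> \<mu>))\<^sup>2) * ?y = cnj (\<zeta> \<mu>) * (\<zeta> \<mu> * ?y)"
      unfolding complex_norm_square by (simp only: mult_ac)
    ultimately have "of_real ((cmod (\<zeta> \<mu>))\<^sup>2) * ?y = cnj (\<zeta> \<mu>)" by simp
    then have "Im (of_real ((cmod (\<zeta> \<mu>))\<^sup>2) * ?y) = Im (cnj (\<zeta> \<mu>))" by (rule arg_cong)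
    moreover have "Im (of_real t * y) = t * Im y" for t y by simp
    ultimately have "(cmod (\<zeta> \<mu>))\<^sup>2 * Im ?y = - Im (\<zeta> \<mu>)" by (simp only: cnj.sel)
    then have "(1 - (cmod (\<zeta> \<mu>))\<^sup>2) * Im ?y = 2 * \<beta> * \<mu>" using sum by (simp add: left_diff_distrib)
    then have "0 < (1 - (cmod (\<zeta> \<mu>))\<^sup>2) * Im ?y" using b \<mu> by simp
    then have "(cmod (\<zeta> \<mu>))\<^sup>2 < 1" using Iy by (simp add: zero_less_mult_iff)
    then show ?thesis by (simp add: power_less_one_iff)
  qed
  have cl: "(c \<longlongrightarrow> of_real \<alpha>) (at_right 0)"
  proof -
    have "((\<lambda>\<mu>. of_real \<alpha> + \<i> * of_real (\<beta> * \<mu>)) \<longlongrightarrow> of_real \<alpha> + \<i> * of_real (\<beta> * 0)) (at_right 0)"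
      by (intro tendsto_intros)
    moreover have "c = (\<lambda>\<mu>. of_real \<alpha> + \<i> * of_real (\<beta> * \<mu>))"
      by (simp add: c_def fun_eq_iff complex_eq_iff)
    ultimately show ?thesis by simp
  qed
  have "((\<lambda>\<mu>. 1 - (c \<mu>)\<^sup>2) \<longlongrightarrow> 1 - (of_real \<alpha>)\<^sup>2) (at_right 0)" by (intro tendsto_intros cl)
  then have "((\<lambda>\<mu>. 1 - (c \<mu>)\<^sup>2) \<longlongrightarrow> of_real (1 - \<alpha>\<^sup>2)) (at_right 0)" by simp
  moreover have "0 \<le> 1 - \<alpha>\<^sup>2" using a by (simp add: abs_square_le_1)
  ultimately have "(s \<longlongrightarrow> csqrt (of_real (1 - \<alpha>\<^sup>2))) (at_right 0)"
    unfolding s_def by (rule csqrt_tendsto_nonneg)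
  then have "(\<zeta> \<longlongrightarrow> of_real \<alpha> - \<i> * csqrt (of_real (1 - \<alpha>\<^sup>2))) (at_right 0)"
    unfolding \<zeta>_def by (intro tendsto_intros cl)
  moreover have "\<zeta> \<mu> \<noteq> 0" for \<mu> using prod[of \<mu>] by auto
  ultimately show ?thesis using lt root unfolding c_def by blast
qed

text \<open>Conjugation reverses the sign of \<open>\<beta>\<close>. The case
  \<open>|\<alpha>| > 1\<close> is the component whose band does not contain the spectral point; its
  limiting root lies strictly inside the disk.\<close>

lemma small_root_limit:
  fixes \<alpha> \<beta> :: real
  assumes b: "\<beta> \<noteq> 0"
  shows "\<exists>\<zeta> \<zeta>0. (\<forall>\<mu>>0. \<zeta> \<mu> \<noteq> 0 \<and> cmod (\<zeta> \<mu>) < 1 \<and> 1 + (\<zeta> \<mu>)\<^sup>2 = 2 * Complex \<alpha> (\<beta> * \<mu>) * \<zeta> \<mu>) \<and>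
    (\<zeta> \<longlongrightarrow> \<zeta>0) (at_right 0)"
proof (cases "\<bar>\<alpha>\<bar> \<le> 1")
  case True
  show ?thesis
  proof (cases "0 < \<beta>")
    case True
    then show ?thesis using small_root_limit_pos \<open>\<bar>\<alpha>\<bar> \<le> 1\<close> by blast
  next
    case False
    then have "0 < - \<beta>" using b by simp
    from small_root_limit_pos[OF this True] obtain \<zeta> \<zeta>0 where
      z: "\<And>\<mu>. \<mu> > 0 \<Longrightarrow> \<zeta> \<mu> \<noteq> 0 \<and> cmod (\<zeta> \<mu>) < 1 \<and> 1 + (\<zeta> \<mu>)\<^sup>2 = 2 * Complex \<alpha> (- \<beta> * \<mu>) * \<zeta> \<mu>"
      and l: "(\<zeta> \<longlongrightarrow> \<zeta>0) (at_right 0)" by blast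
    have "1 + (cnj (\<zeta> \<mu>))\<^sup>2 = 2 * Complex \<alpha> (\<beta> * \<mu>) * cnj (\<zeta> \<mu>)" if "\<mu> > 0" for \<mu>
    proof -
      have "cnj (1 + (\<zeta> \<mu>)\<^sup>2) = cnj (2 * Complex \<alpha> (- \<beta> * \<mu>) * \<zeta> \<mu>)" using z[OF that] by simp
      moreover have "cnj (Complex \<alpha> (- \<beta> * \<mu>)) = Complex \<alpha> (\<beta> * \<mu>)" by (simp add: complex_eq_iff)
      ultimately show ?thesis by simp
    qed
    then have "\<forall>\<mu>>0. cnj (\<zeta> \<mu>) \<noteq> 0 \<and> cmod (cnj (\<zeta> \<mu>)) < 1 \<and>
        1 + (cnj (\<zeta> \<mu>))\<^sup>2 = 2 * Complex \<alpha> (\<beta> * \<mu>) * cnj (\<zeta> \<mu>)"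
      using z by simp
    moreover have "((\<lambda>\<mu>. cnj (\<zeta> \<mu>)) \<longlongrightarrow> cnj \<zeta>0) (at_right 0)" using l by (rule tendsto_cnj)
    ultimately show ?thesis by (intro exI[of _ "\<lambda>\<mu>. cnj (\<zeta> \<mu>)"] exI[of _ "cnj \<zeta>0"]) simp
  qed
next
  case False
  have "complex_of_real \<alpha> \<notin> complex_of_real ` {-1..1}" using False by auto
  then obtain \<zeta>0 where z0: "\<zeta>0 \<noteq> 0" "cmod \<zeta>0 < 1" "1 + \<zeta>0\<^sup>2 = 2 * of_real \<alpha> * \<zeta>0"
    using small_root_exists by blast
  have "\<exists>z. z \<noteq> 0 \<and> cmod z < 1 \<and> 1 + z\<^sup>2 = 2 * Complex \<alpha> (\<beta> * \<mu>) * z" if "\<mu> > 0" for \<mu>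
  proof (rule small_root_exists)
    show "Complex \<alpha> (\<beta> * \<mu>) \<notin> complex_of_real ` {-1..1}"
      using b that by (auto simp: complex_eq_iff)
  qed
  then obtain \<zeta> where z: "\<And>\<mu>. \<mu> > 0 \<Longrightarrow> \<zeta> \<mu> \<noteq> 0 \<and> cmod (\<zeta> \<mu>) < 1 \<and>
      1 + (\<zeta> \<mu>)\<^sup>2 = 2 * Complex \<alpha> (\<beta> * \<mu>) * \<zeta> \<mu>"
    by metis
  \<comment> \<open>The other limiting root \<open>1 / \<zeta>0\<close> is at distance at least
    \<open>m\<close> from every point of the unit disk, so in the factored equation the small factor
    must be \<open>\<zeta> \<mu> - \<zeta>0\<close>.\<close>
  define m where "m = 1 / cmod \<zeta>0 - 1"
  have m: "0 < m" using z0 by (simp add: m_def)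
  have "(\<zeta> \<longlongrightarrow> \<zeta>0) (at_right 0)"
  proof (rule LIM_zero_cancel, rule Lim_transform_bound)
    show "\<forall>\<^sub>F \<mu> in at_right 0. cmod (\<zeta> \<mu> - \<zeta>0) \<le> cmod (of_real (2 * \<bar>\<beta>\<bar> / m * \<mu>) :: complex)"
      unfolding eventually_at_right_field
    proof (intro exI[of _ 1] conjI allI impI)
      fix \<mu> :: real assume \<mu>: "0 < \<mu>"
      note zm = z[OF \<mu>]
      have inv: "1 / \<zeta>0 + \<zeta>0 = 2 * of_real \<alpha>" using z0 by (simp add: field_simps power2_eq_square)
      have "(\<zeta> \<mu> - \<zeta>0) * (\<zeta> \<mu> - 1 / \<zeta>0) = 1 + (\<zeta> \<mu>)\<^sup>2 - (1 / \<zeta>0 + \<zeta>0) * \<zeta> \<mu>"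
        using z0(1) by (simp add: algebra_simps power2_eq_square)
      also have "\<dots> = 2 * (Complex \<alpha> (\<beta> * \<mu>) - of_real \<alpha>) * \<zeta> \<mu>"
        unfolding inv using zm by (simp add: algebra_simps)
      also have "Complex \<alpha> (\<beta> * \<mu>) - of_real \<alpha> = \<i> * of_real (\<beta> * \<mu>)" by (simp add: complex_eq_iff)
      finally have "cmod (\<zeta> \<mu> - \<zeta>0) * cmod (\<zeta> \<mu> - 1 / \<zeta>0) = 2 * (\<bar>\<beta>\<bar> * \<mu>) * cmod (\<zeta> \<mu>)"
        using \<mu> by (simp add: norm_mult[symmetric]) (simp add: norm_mult abs_mult)
      also have "\<dots> \<le> 2 * (\<bar>\<beta>\<bar> * \<mu>) * 1" using zm \<mu> by (intro mult_left_mono) auto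
      finally have 1: "cmod (\<zeta> \<mu> - \<zeta>0) * cmod (\<zeta> \<mu> - 1 / \<zeta>0) \<le> 2 * \<bar>\<beta>\<bar> * \<mu>" by simp
      have "m \<le> cmod (\<zeta> \<mu> - 1 / \<zeta>0)"
        using norm_triangle_ineq2[of "1 / \<zeta>0" "\<zeta> \<mu>"] zm
        by (simp add: m_def norm_divide norm_minus_commute)
      then have "cmod (\<zeta> \<mu> - \<zeta>0) * m \<le> cmod (\<zeta> \<mu> - \<zeta>0) * cmod (\<zeta> \<mu> - 1 / \<zeta>0)"
        by (intro mult_left_mono) auto
      then have "cmod (\<zeta> \<mu> - \<zeta>0) * m \<le> 2 * \<bar>\<beta>\<bar> * \<mu>" using 1 by linarith
      then have "cmod (\<zeta> \<mu> - \<zeta>0) \<le> 2 * \<bar>\<beta>\<bar> * \<mu> / m" using m by (simp add: pos_le_divide_eq)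
      then show "cmod (\<zeta> \<mu> - \<zeta>0) \<le> cmod (of_real (2 * \<bar>\<beta>\<bar> / m * \<mu>) :: complex)"
        unfolding norm_of_real using m \<mu> by simp
    qed simp
    have "((\<lambda>\<mu>. complex_of_real (2 * \<bar>\<beta>\<bar> / m * \<mu>)) \<longlongrightarrow> of_real (2 * \<bar>\<beta>\<bar> / m * 0)) (at_right 0)"
      by (intro tendsto_intros)
    then show "((\<lambda>\<mu>. complex_of_real (2 * \<bar>\<beta>\<bar> / m * \<mu>)) \<longlongrightarrow> 0) (at_right 0)" by simp
  qed
  then show ?thesis using z by blast
qed

context dnls_lattice
begin

lemma band_roots_iff:
  "band_roots \<Omega> z \<longleftrightarrow> (\<forall>s. z s \<noteq> 0 \<and> 1 + (z s)\<^sup>2 = 2 * ((2 * of_real \<epsilon> +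
      1 - sg s * \<Omega>) / of_real (2 * \<epsilon>)) * z s)"
proof -
  have "of_real \<epsilon> * (1 + y\<^sup>2) = y * v \<longleftrightarrow> 1 + y\<^sup>2 = 2 * (v / of_real (2 * \<epsilon>)) * y" for y v :: complex
    using eps by (simp add: field_simps)
  then show ?thesis unfolding band_roots_def by (simp only:)
qed

lemma band_roots_exist:
  assumes "\<Omega> \<notin> spectral_bands \<epsilon>"
  shows "\<exists>z. band_roots \<Omega> z \<and> (\<forall>s. cmod (z s) < 1)"
proof -
  have "\<exists>z. z \<noteq> 0 \<and> cmod z < 1 \<and> 1 + z\<^sup>2 = 2 * ((2 * of_real \<epsilon> +
      1 - sg s * \<Omega>) / of_real (2 * \<epsilon>)) * z" for s
  proof (rule small_root_exists, rule notI)
    assume "(2 * of_real \<epsilon> + 1 - sg s * \<Omega>) / of_real (2 * \<epsilon>) \<in> complex_of_real ` {-1..1}"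
    then obtain t where t: "t \<in> {-1..1}" "(2 * of_real \<epsilon> + 1 - sg s * \<Omega>) / of_real (2 * \<epsilon>) =
        complex_of_real t" by blast
    have "2 * of_real \<epsilon> + 1 - sg s * \<Omega> = of_real (2 * \<epsilon> * t)"
      using t(2) eps by (simp add: field_simps)
    then have "sg s * \<Omega> = of_real (1 + 2 * \<epsilon> - 2 * \<epsilon> * t)" by (simp add: algebra_simps)
    moreover have "\<Omega> = sg s * (sg s * \<Omega>)" by simp
    ultimately have O: "\<Omega> = sg s * of_real (1 + 2 * \<epsilon> - 2 * \<epsilon> * t)" by simp
    have "\<epsilon> * t \<le> \<epsilon> * 1" "\<epsilon> * (-1) \<le> \<epsilon> * t" using t(1) eps by (intro mult_left_mono; simp)+
    then have "1 + 2 * \<epsilon> - 2 * \<epsilon> * t \<in> {1..1 + 4 * \<epsilon>}" "- (1 +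
        2 * \<epsilon> - 2 * \<epsilon> * t) \<in> {-1 - 4 * \<epsilon>..-1}"
      by auto
    moreover have "\<Omega> = of_real (1 + 2 * \<epsilon> - 2 * \<epsilon> * t) \<or> \<Omega> = of_real (- (1 + 2 * \<epsilon> - 2 * \<epsilon> * t))"
      using O by (cases s) auto
    ultimately have "\<Omega> \<in> spectral_bands \<epsilon>" unfolding spectral_bands_def by blast
    then show False using assms by simp
  qed
  then show ?thesis unfolding band_roots_iff by metis
qed

text \<open>The imaginary part of the parameter is
  \<open>- sg s * \<sigma> * \<mu> / (2 * \<epsilon>)\<close>: the two components approach the real
  axis from opposite sides.\<close>

lemma band_roots_limit:
  fixes \<omega> \<sigma> :: real
  assumes \<sigma>: "\<sigma> \<noteq> 0"
  shows "\<exists>z z0. (\<forall>\<mu>>0. band_roots (of_real \<omega> + \<i> * of_real (\<sigma> * \<mu>)) (z \<mu>) \<and>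
      (\<forall>s. cmod (z \<mu> s) < 1)) \<and>
    (\<forall>s. ((\<lambda>\<mu>. z \<mu> s) \<longlongrightarrow> z0 s) (at_right 0))"
proof -
  let ?g = "\<lambda>s. if s then 1 else - 1 :: real"
  have eq: "(2 * of_real \<epsilon> + 1 - sg s * (of_real \<omega> + \<i> * of_real (\<sigma> * \<mu>))) / of_real (2 * \<epsilon>) =
      Complex ((2 * \<epsilon> + 1 - ?g s * \<omega>) / (2 * \<epsilon>)) (- (?g s * \<sigma> / (2 * \<epsilon>)) * \<mu>)" for s \<mu>
    using eps by (cases s) (simp_all add: complex_eq_iff)
  have "\<exists>\<zeta> \<zeta>0. (\<forall>\<mu>>0. \<zeta> \<mu> \<noteq> 0 \<and> cmod (\<zeta> \<mu>) < 1 \<and>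
      1 + (\<zeta> \<mu>)\<^sup>2 = 2 * Complex ((2 * \<epsilon> + 1 - ?g s * \<omega>) / (2 * \<epsilon>)) (- (?g s * \<sigma> / (2 * \<epsilon>)) * \<mu>) *
          \<zeta> \<mu>) \<and>
    (\<zeta> \<longlongrightarrow> \<zeta>0) (at_right 0)" for s
    by (rule small_root_limit) (use eps \<sigma> in simp)
  then obtain \<zeta> \<zeta>0 where z: "\<And>s \<mu>. \<mu> > 0 \<Longrightarrow> \<zeta> s \<mu> \<noteq> 0 \<and> cmod (\<zeta> s \<mu>) < 1 \<and>
      1 + (\<zeta> s \<mu>)\<^sup>2 = 2 * Complex ((2 * \<epsilon> + 1 - ?g s * \<omega>) / (2 * \<epsilon>)) (- (?g s * \<sigma> / (2 * \<epsilon>)) * \<mu>)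
          * \<zeta> s \<mu>"
    "\<And>s. (\<zeta> s \<longlongrightarrow> \<zeta>0 s) (at_right 0)"
    by metis
  have "band_roots (of_real \<omega> + \<i> * of_real (\<sigma> * \<mu>)) (\<lambda>s. \<zeta> s \<mu>)" if "\<mu> > 0" for \<mu>
    unfolding band_roots_iff eq using z(1)[OF that] by blast
  then show ?thesis
    using z by (intro exI[of _ "\<lambda>\<mu> s. \<zeta> s \<mu>"] exI[of _ \<zeta>0]) blast
qed

end

section \<open>Estimates for the soliton\<close>

lemma lq_weight_0 [simp]: "lq_weight 0 n = 1"
  by (simp add: lq_weight_def add_nonneg_eq_0_iff)

lemma lq_space_2_0: "u \<in> lq_space 2 0 \<longleftrightarrow> (\<lambda>n. (norm (u n))\<^sup>2) summable_on UNIV"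
  by (simp add: lq_space_def)

lemma lq_norm_2_0: "lq_norm 2 0 u = sqrt (\<Sum>\<^sub>\<infinity>n. (norm (u n))\<^sup>2)"
  by (simp add: lq_norm_def powr_half_sqrt infsum_nonneg)

lemma norm_le_lq_norm_2_0:
  assumes "u \<in> lq_space 2 0" shows "norm (u n) \<le> lq_norm 2 0 u"
proof -
  have "(\<Sum>n\<in>{n}. (norm (u n))\<^sup>2) \<le> (\<Sum>\<^sub>\<infinity>n. (norm (u n))\<^sup>2)"
    using assms by (intro finite_sum_le_infsum) (auto simp: lq_space_2_0)
  then have "(norm (u n))\<^sup>2 \<le> (\<Sum>\<^sub>\<infinity>n. (norm (u n))\<^sup>2)" by simp
  then show ?thesis unfolding lq_norm_2_0 by (rule real_le_rsqrt)
qed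

lemma lq_space_2_0_diff_finite:
  fixes u v :: "int \<Rightarrow> real"
  assumes u: "u \<in> lq_space 2 0" and A: "finite A" "\<And>n. n \<notin> A \<Longrightarrow> v n = 0"
  shows "u - v \<in> lq_space 2 0"
proof -
  have "(\<lambda>n. (norm (u n))\<^sup>2) summable_on (- A)"
    using u summable_on_subset_banach unfolding lq_space_2_0 by blast
  also have "?this \<longleftrightarrow> (\<lambda>n. (norm ((u - v) n))\<^sup>2) summable_on (- A)"
    by (rule summable_on_cong) (simp add: A)
  finally have "(\<lambda>n. (norm ((u - v) n))\<^sup>2) summable_on (- A \<union> A)"
    by (rule summable_on_Un_disjoint[OF _ summable_on_finite[OF A(1)]]) auto
  then show ?thesis by (simp add: lq_space_2_0)
qed

text \<open>Each use of the recursion gains the factor \<open>2 * \<theta> \<le> 1/2\<close>, but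
  only one site further out. The induction is over the number \<open>m\<close> of gains, whence the
  exponent \<open>min k m\<close>.\<close>

lemma half_power_decay:
  fixes s :: "nat \<Rightarrow> real"
  assumes B: "\<And>k. s k \<le> B" and s: "\<And>k. s (Suc k) \<le> \<theta> * (s k + s (Suc (Suc k)))"
    and t: "0 \<le> \<theta>" "\<theta> \<le> 1/4" and B0: "0 \<le> B"
  shows "s k \<le> B * (1/2) ^ k"
proof -
  have "s k \<le> B * (1/2) ^ min k m" for k m
  proof (induction m arbitrary: k)
    case 0 then show ?case using B by simp
  next
    case (Suc m)
    show ?case
    proof (cases "k \<le> m")
      case True
      then show ?thesis using Suc[of k] by (simp add: min_def)
    next
      case False
      then obtain l where k: "k = Suc l" "m \<le> l" by (cases k) auto
      have "s k \<le> \<theta> * (s l + s (Suc (Suc l)))" using s k by simp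
      also have "\<dots> \<le> \<theta> * (B * (1/2) ^ m + B * (1/2) ^ m)"
        using Suc[of l] Suc[of "Suc (Suc l)"] k t
            by (intro mult_left_mono add_mono) (auto simp: min.absorb2)
      also have "\<dots> \<le> 1/4 * (B * (1/2) ^ m + B * (1/2) ^ m)"
        using t B0 by (intro mult_right_mono) auto
      also have "\<dots> = B * (1/2) ^ Suc m" by simp
      finally have "s k \<le> B * (1/2) ^ Suc m" .
      moreover have "min k (Suc m) = Suc m" using False by simp
      ultimately show ?thesis by (simp only:)
    qed
  qed
  from this[of k k] show ?thesis by simp
qed

lemma power_minus_one_le:
  fixes t :: real
  assumes "0 \<le> t" "t \<le> 2" shows "\<bar>t ^ m - 1\<bar> \<le> real m * 2 ^ m * \<bar>t - 1\<bar>"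
proof (induction m)
  case (Suc m)
  have "t ^ Suc m - 1 = t * (t ^ m - 1) + (t - 1)" by (simp add: algebra_simps)
  then have "\<bar>t ^ Suc m - 1\<bar> \<le> \<bar>t * (t ^ m - 1)\<bar> + \<bar>t - 1\<bar>" by (metis abs_triangle_ineq)
  moreover have "\<bar>t * (t ^ m - 1)\<bar> \<le> 2 * (real m * 2 ^ m * \<bar>t - 1\<bar>)"
    unfolding abs_mult using assms Suc by (intro mult_mono) auto
  moreover have "\<bar>t - 1\<bar> \<le> 2 ^ Suc m * \<bar>t - 1\<bar>"
    using mult_right_mono[of 1 "2 ^ Suc m" "\<bar>t - 1\<bar>"] one_le_power[of "2::real" "Suc m"] by simp
  moreover have "2 * (real m * 2 ^ m * \<bar>t - 1\<bar>) + 2 ^ Suc m * \<bar>t - 1\<bar> =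
      real (Suc m) * 2 ^ Suc m * \<bar>t - 1\<bar>"
    by (simp add: algebra_simps)
  ultimately show ?case by linarith
qed simp

lemma lattice_simply_connected_interval:
  assumes S: "lattice_simply_connected S" "finite S" "S \<noteq> {}"
  shows "S = {Min S..Max S}"
proof
  show "S \<subseteq> {Min S..Max S}" using S by auto
  show "{Min S..Max S} \<subseteq> S"
  proof
    fix m assume m: "m \<in> {Min S..Max S}"
    show "m \<in> S"
    proof (rule ccontr)
      assume "m \<notin> S"
      moreover have "Min S \<in> S" "Max S \<in> S" using S by auto
      ultimately have "Min S < m" "m < Max S" using m by (metis atLeastAtMost_iff order_le_less)+
      then show False
        using S(1) \<open>m \<notin> S\<close> \<open>Min S \<in> S\<close> \<open>Max S \<in> S\<close> unfolding lattice_simply_connected_def by blast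
    qed
  qed
qed

text \<open>At excited sites \<open>|\<phi>|\<close> is within \<open>C * \<epsilon>\<close> of
  \<open>1\<close>. Outside it is at most \<open>C * \<epsilon>\<close>, and the stationary equation
  solved for the middle site turns this bound into geometric decay; the power
  \<open>2 * p \<ge> 2\<close> supplies \<open>\<epsilon>^2\<close>.\<close>

lemma soliton_estimates:
  assumes p: "1 \<le> p" and disj: "Up \<inter> Um = {}" and U: "Up \<union> Um = {a..b}"
    and sol: "soliton_branch p Up Um \<phi>"
  shows "\<exists>\<epsilon>1>0. \<exists>c>0. \<forall>\<epsilon>. 0 < \<epsilon> \<longrightarrow> \<epsilon> < \<epsilon>1 \<longrightarrow>
    (\<forall>n. a \<le> n \<longrightarrow> n \<le> b \<longrightarrow> \<bar>\<phi> \<epsilon> n ^ (2 * p) - 1\<bar> \<le> c * \<epsilon>) \<and>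
    (\<forall>k::nat. \<bar>\<phi> \<epsilon> (b + 1 + int k) ^ (2 * p)\<bar> \<le> c * \<epsilon>\<^sup>2 * (1/2) ^ k) \<and>
    (\<forall>k::nat. \<bar>\<phi> \<epsilon> (a - 1 - int k) ^ (2 * p)\<bar> \<le> c * \<epsilon>\<^sup>2 * (1/2) ^ k)"
proof -
  obtain \<epsilon>2 C where e2: "\<epsilon>2 > 0" "C > 0" and br: "\<And>\<epsilon>. \<bar>\<epsilon>\<bar> < \<epsilon>2 \<Longrightarrow> \<phi> \<epsilon> \<in> lq_space 2 0 \<and>
     (\<forall>n. (1 - \<phi> \<epsilon> n ^ (2 * p)) * \<phi> \<epsilon> n = \<epsilon> * discrete_laplacian (\<phi> \<epsilon>) n) \<and>
     lq_norm 2 0 (\<phi> \<epsilon> - anticontinuum_soliton Up Um) \<le> C * \<bar>\<epsilon>\<bar>"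
    using sol unfolding soliton_branch_def by blast
  define c where "c = C\<^sup>2 + real (2 * p) * 2 ^ (2 * p) * C"
  \<comment> \<open>\<open>1/8\<close> gives \<open>2 * \<epsilon> \<le> 1/4\<close>, as
    \<open>half_power_decay\<close> demands; \<open>1 / (4 * C)\<close> keeps
    \<open>|\<phi>| \<le> 1/4\<close> outside, so that the coefficient
    \<open>1 - \<phi>^(2 p) + 2 * \<epsilon>\<close> is at least \<open>1/2\<close>.\<close>
  define \<epsilon>1 where "\<epsilon>1 = min \<epsilon>2 (min (1/8) (1 / (4 * C)))"
  have c0: "c > 0" using e2 by (simp add: c_def add_pos_nonneg)
  have e1: "\<epsilon>1 > 0" using e2 by (simp add: \<epsilon>1_def)
  have main: "(\<forall>n. a \<le> n \<longrightarrow> n \<le> b \<longrightarrow> \<bar>\<phi> \<epsilon> n ^ (2 * p) - 1\<bar> \<le> c * \<epsilon>) \<and>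
    (\<forall>k::nat. \<bar>\<phi> \<epsilon> (b + 1 + int k) ^ (2 * p)\<bar> \<le> c * \<epsilon>\<^sup>2 * (1/2) ^ k) \<and>
    (\<forall>k::nat. \<bar>\<phi> \<epsilon> (a - 1 - int k) ^ (2 * p)\<bar> \<le> c * \<epsilon>\<^sup>2 * (1/2) ^ k)"
    if eps: "0 < \<epsilon>" "\<epsilon> < \<epsilon>1" for \<epsilon>
  proof -
    define f where "f = \<phi> \<epsilon>"
    have ee: "\<epsilon> < \<epsilon>2" "\<epsilon> \<le> 1/8" "C * \<epsilon> \<le> 1/4"
      using eps e2 by (auto simp: \<epsilon>1_def field_simps)
    have sp: "f \<in> lq_space 2 0" and eqn: "\<And>n. (1 - f n ^ (2 * p)) * f n =
        \<epsilon> * discrete_laplacian f n"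
      and nrm: "lq_norm 2 0 (f - anticontinuum_soliton Up Um) \<le> C * \<epsilon>"
      using br[of \<epsilon>] eps ee by (auto simp: f_def)
    have "finite (Up \<union> Um)" unfolding U by simp
    then have "f - anticontinuum_soliton Up Um \<in> lq_space 2 0"
      by (rule lq_space_2_0_diff_finite[OF sp]) (simp add: anticontinuum_soliton_def)
    from norm_le_lq_norm_2_0[OF this] nrm
    have close: "\<bar>f n - anticontinuum_soliton Up Um n\<bar> \<le> C * \<epsilon>" for n by (force intro: order_trans)
    have inn: "\<bar>f n ^ (2 * p) - 1\<bar> \<le> c * \<epsilon>" if n: "a \<le> n" "n \<le> b" for n
    proof -
      have "n \<in> Up \<union> Um" unfolding U using n by simp
      then have "\<bar>anticontinuum_soliton Up Um n\<bar> = 1" by (auto simp: anticontinuum_soliton_def)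
      then have t: "\<bar>\<bar>f n\<bar> - 1\<bar> \<le> C * \<epsilon>" using close[of n] by linarith
      then have "\<bar>f n\<bar> \<le> 2" using ee(3) by linarith
      have "f n ^ (2 * p) = \<bar>f n\<bar> ^ (2 * p)" by (simp add: power_even_abs)
      then have "\<bar>f n ^ (2 * p) - 1\<bar> \<le> real (2 * p) * 2 ^ (2 * p) * \<bar>\<bar>f n\<bar> - 1\<bar>"
        using power_minus_one_le[of "\<bar>f n\<bar>" "2 * p"] \<open>\<bar>f n\<bar> \<le> 2\<close> by simp
      also have "\<dots> \<le> real (2 * p) * 2 ^ (2 * p) * (C * \<epsilon>)" by (intro mult_left_mono t) auto
      also have "\<dots> \<le> c * \<epsilon>" unfolding c_def using eps by (simp add: distrib_right mult.assoc)
      finally show ?thesis .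
    qed
    have out: "\<bar>f n\<bar> \<le> C * \<epsilon>" if "n \<notin> {a..b}" for n
    proof -
      have "n \<notin> Up \<union> Um" unfolding U using that .
      then show ?thesis using close[of n] by (simp add: anticontinuum_soliton_def)
    qed
    have rec: "\<bar>f n\<bar> \<le> 2 * \<epsilon> * (\<bar>f (n + 1)\<bar> + \<bar>f (n - 1)\<bar>)" if n: "n \<notin> {a..b}" for n
    proof -
      have fn: "\<bar>f n\<bar> \<le> 1/4" using out[OF n] ee(3) by linarith
      have "\<bar>f n ^ (2 * p)\<bar> = \<bar>f n\<bar> ^ (2 * p)" by (simp add: power_abs)
      also have "\<dots> \<le> \<bar>f n\<bar> ^ 1" using fn p by (intro power_decreasing) auto
      finally have pw: "\<bar>f n ^ (2 * p)\<bar> \<le> 1/4" using fn by simp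
      have "(1 - f n ^ (2 * p) + 2 * \<epsilon>) * f n = \<epsilon> * (f (n + 1) + f (n - 1))"
        using eqn[of n] by (simp add: discrete_laplacian_def algebra_simps)
      then have "\<bar>1 - f n ^ (2 * p) + 2 * \<epsilon>\<bar> * \<bar>f n\<bar> = \<epsilon> * \<bar>f (n + 1) + f (n - 1)\<bar>"
        using eps by (metis abs_mult abs_of_pos)
      also have "\<dots> \<le> \<epsilon> * (\<bar>f (n + 1)\<bar> + \<bar>f (n - 1)\<bar>)" using eps by (intro mult_left_mono) auto
      finally have "\<bar>1 - f n ^ (2 * p) + 2 * \<epsilon>\<bar> * \<bar>f n\<bar> \<le> \<epsilon> * (\<bar>f (n + 1)\<bar> + \<bar>f (n - 1)\<bar>)" .
      moreover have "1/2 * \<bar>f n\<bar> \<le> \<bar>1 - f n ^ (2 * p) + 2 * \<epsilon>\<bar> * \<bar>f n\<bar>"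
        using pw eps by (intro mult_right_mono) auto
      ultimately show ?thesis by simp
    qed
    \<comment> \<open>The sequence \<open>g\<close> walks away from the interval. Naming neighbours
      as a set treats both directions alike.\<close>
    have decay: "\<bar>f (g k) ^ (2 * p)\<bar> \<le> c * \<epsilon>\<^sup>2 * (1/2) ^ k"
      if g: "\<And>k. g k \<notin> {a..b}" "\<And>k. {g (Suc k) + 1, g (Suc k) - 1} =
          {g k, g (Suc (Suc k))}" for g :: "nat \<Rightarrow> int" and k
    proof -
      have fk: "\<bar>f (g k)\<bar> \<le> C * \<epsilon> * (1/2) ^ k"
      proof (rule half_power_decay)
        show "\<bar>f (g k)\<bar> \<le> C * \<epsilon>" for k by (rule out[OF g(1)])
        show "\<bar>f (g (Suc k))\<bar> \<le> 2 * \<epsilon> * (\<bar>f (g k)\<bar> + \<bar>f (g (Suc (Suc k)))\<bar>)" for k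
          using rec[OF g(1)[of "Suc k"]] g(2)[of k] unfolding doubleton_eq_iff
              by (auto simp: add.commute)
      qed (use eps ee e2 in auto)
      have "\<bar>f (g k) ^ (2 * p)\<bar> = \<bar>f (g k)\<bar> ^ (2 * p)" by (simp add: power_abs)
      also have "\<dots> \<le> \<bar>f (g k)\<bar> ^ 2"
        using out[OF g(1)[of k]] ee(3) p by (intro power_decreasing) auto
      also have "\<dots> \<le> (C * \<epsilon> * (1/2) ^ k)\<^sup>2" using fk by (intro power_mono) auto
      also have "\<dots> = C\<^sup>2 * \<epsilon>\<^sup>2 * ((1/2) ^ k * (1/2) ^ k)" by (simp add: power2_eq_square)
      also have "\<dots> \<le> c * \<epsilon>\<^sup>2 * (1/2) ^ k"
      proof (intro mult_mono)
        show "C\<^sup>2 \<le> c" using e2 by (simp add: c_def)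
        have "(1/2::real) ^ k * (1/2) ^ k \<le> 1 * (1/2) ^ k"
            by (intro mult_right_mono power_le_one) auto
        then show "(1/2::real) ^ k * (1/2) ^ k \<le> (1/2) ^ k" by simp
      qed (use c0 in auto)
      finally show ?thesis .
    qed
    have ab: "\<bar>f (b + 1 + int k) ^ (2 * p)\<bar> \<le> c * \<epsilon>\<^sup>2 * (1/2) ^ k" for k
      by (rule decay[of "\<lambda>k. b + 1 + int k"]) auto
    have aa: "\<bar>f (a - 1 - int k) ^ (2 * p)\<bar> \<le> c * \<epsilon>\<^sup>2 * (1/2) ^ k" for k
      by (rule decay[of "\<lambda>k. a - 1 - int k"]) auto
    show ?thesis using inn ab aa unfolding f_def by blast
  qed
  then show ?thesis using e1 c0 by blast
qed

section \<open>Spectrum of the linearized operator\<close>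

definition state :: "seq2 \<Rightarrow> int \<times> bool \<Rightarrow> complex" where
  "state x i = (if snd i then fst x (fst i) else snd x (fst i))"

definition of_state :: "(int \<times> bool \<Rightarrow> complex) \<Rightarrow> seq2" where
  "of_state f = ((\<lambda>n. f (n, True)), (\<lambda>n. f (n, False)))"

lemma state_of_state [simp]: "state (of_state f) = f"
  by (auto simp: state_def of_state_def fun_eq_iff)

lemma of_state_state [simp]: "of_state (state x) = x"
  by (simp add: state_def of_state_def)

lemma state_eq_iff: "state x = state y \<longleftrightarrow> x = y"
  by (metis of_state_state)

lemma state_add: "state (x + y) = (\<lambda>i. state x i + state y i)"
  by (auto simp: state_def)

lemma state_diff: "state (x - y) = (\<lambda>i. state x i - state y i)"
  by (auto simp: state_def)

lemma state_scale: "state (seq2_scale c x) = (\<lambda>i. c * state x i)"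
  by (auto simp: state_def seq2_scale_def)

lemma state_0: "state 0 = (\<lambda>_. 0)"
  by (auto simp: state_def)

lemma state_eq_0_iff: "state x = (\<lambda>_. 0) \<longleftrightarrow> x = 0"
  using state_eq_iff[of x 0] by (simp add: state_0)

lemma state_op_shift: "state (op_shift A \<Omega> x) = (\<lambda>i. state (A x) i - \<Omega> * state x i)"
  by (simp add: op_shift_def state_diff state_scale)

lemma sum_state_squares:
  "(\<Sum>i\<in>F \<times> UNIV. (cmod (state x i))\<^sup>2) = (\<Sum>n\<in>F. (cmod (fst x n))\<^sup>2 + (cmod (snd x n))\<^sup>2)"
proof -
  have "(\<Sum>i\<in>F \<times> UNIV. (cmod (state x i))\<^sup>2) = (\<Sum>n\<in>F. \<Sum>s\<in>UNIV. (cmod (state x (n, s)))\<^sup>2)"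
    by (simp add: sum.cartesian_product)
  then show ?thesis by (simp add: UNIV_bool state_def add.commute)
qed

lemma lq2_norm_2_0: "lq2_norm 2 0 x = sqrt ((\<Sum>\<^sub>\<infinity>n. (cmod (fst x n))\<^sup>2) +
    (\<Sum>\<^sub>\<infinity>n. (cmod (snd x n))\<^sup>2))"
  unfolding lq2_norm_def lq_norm_2_0 by (simp add: powr_half_sqrt infsum_nonneg)

lemma l2_pairs_iff:
  "x \<in> l2_pairs \<longleftrightarrow> (\<lambda>n. (cmod (fst x n))\<^sup>2) summable_on UNIV \<and>
      (\<lambda>n. (cmod (snd x n))\<^sup>2) summable_on UNIV"
  by (cases x) (simp add: lq2_space_def lq_space_2_0)

lemma l2_le_imp_l2_pairs:
  assumes "l2_le (state x) B" shows "x \<in> l2_pairs" "lq2_norm 2 0 x \<le> B"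
proof -
  have B: "0 \<le> B" by (rule l2_le_nonneg[OF assms])
  have fin: "(\<Sum>n\<in>F. (cmod (fst x n))\<^sup>2 + (cmod (snd x n))\<^sup>2) \<le> B\<^sup>2" if "finite F" for F
  proof -
    have "L2_set (\<lambda>i. cmod (state x i)) (F \<times> UNIV) \<le> B"
      using assms that unfolding l2_le_def by (auto intro!: finite_cartesian_product)
    then have "(\<Sum>i\<in>F \<times> UNIV. (cmod (state x i))\<^sup>2) \<le> B\<^sup>2"
      unfolding L2_set_def by (rule sqrt_le_D)
    then show ?thesis unfolding sum_state_squares .
  qed
  have s1: "(\<lambda>n. (cmod (fst x n))\<^sup>2) summable_on UNIV"
    by (rule nonneg_bounded_partial_sums_imp_summable_on[where C = "B\<^sup>2"])
      (auto intro!: eventually_finite_subsets_at_top_weakI order_trans[OF _ fin] sum_mono)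
  have s2: "(\<lambda>n. (cmod (snd x n))\<^sup>2) summable_on UNIV"
    by (rule nonneg_bounded_partial_sums_imp_summable_on[where C = "B\<^sup>2"])
      (auto intro!: eventually_finite_subsets_at_top_weakI order_trans[OF _ fin] sum_mono)
  show "x \<in> l2_pairs" using s1 s2 by (simp add: l2_pairs_iff)
  have "(\<Sum>\<^sub>\<infinity>n. (cmod (fst x n))\<^sup>2) + (\<Sum>\<^sub>\<infinity>n. (cmod (snd x n))\<^sup>2) =
      (\<Sum>\<^sub>\<infinity>n. (cmod (fst x n))\<^sup>2 + (cmod (snd x n))\<^sup>2)"
    by (rule infsum_add[OF s1 s2, symmetric])
  also have "\<dots> \<le> B\<^sup>2"
    by (rule infsum_le_finite_sums[OF summable_on_add[OF s1 s2]]) (rule fin)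
  finally show "lq2_norm 2 0 x \<le> B" unfolding lq2_norm_2_0 using B by (simp add: real_le_lsqrt)
qed

lemma l2_pairs_l2_le: assumes x: "x \<in> l2_pairs" shows "l2_le (state x) (lq2_norm 2 0 x)"
  unfolding l2_le_def
proof (intro allI impI)
  fix F :: "(int \<times> bool) set" assume F: "finite F"
  have s: "(\<lambda>n. (cmod (fst x n))\<^sup>2) summable_on UNIV" "(\<lambda>n. (cmod (snd x n))\<^sup>2) summable_on UNIV"
    using x by (auto simp: l2_pairs_iff)
  have "(\<Sum>i\<in>F. (cmod (state x i))\<^sup>2) \<le> (\<Sum>i\<in>fst ` F \<times> UNIV. (cmod (state x i))\<^sup>2)"
    using F by (intro sum_mono2) (auto intro: rev_image_eqI)
  also have "\<dots> = (\<Sum>n\<in>fst ` F. (cmod (fst x n))\<^sup>2 + (cmod (snd x n))\<^sup>2)" by (rule sum_state_squares)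
  also have "\<dots> \<le> (\<Sum>\<^sub>\<infinity>n. (cmod (fst x n))\<^sup>2 + (cmod (snd x n))\<^sup>2)"
    using F by (intro finite_sum_le_infsum summable_on_add s) auto
  also have "\<dots> = (\<Sum>\<^sub>\<infinity>n. (cmod (fst x n))\<^sup>2) + (\<Sum>\<^sub>\<infinity>n. (cmod (snd x n))\<^sup>2)"
    by (rule infsum_add[OF s])
  finally show "L2_set (\<lambda>i. cmod (state x i)) F \<le> lq2_norm 2 0 x"
    unfolding L2_set_def lq2_norm_2_0 by (rule real_sqrt_le_mono)
qed

lemma l2_pairs_iff_l2_le: "x \<in> l2_pairs \<longleftrightarrow> (\<exists>B. l2_le (state x) B)"
  using l2_le_imp_l2_pairs(1) l2_pairs_l2_le by blast

section \<open>The resolvent on pairs of square-summable sequences\<close>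

lemma resolvent_setI:
  assumes maps: "\<And>x. x \<in> l2_pairs \<Longrightarrow> op_shift A \<Omega> x \<in> l2_pairs"
    and inj: "inj_on (op_shift A \<Omega>) l2_pairs"
    and surj: "\<And>g. g \<in> l2_pairs \<Longrightarrow> \<exists>x\<in>l2_pairs. op_shift A \<Omega> x = g \<and>
        lq2_norm 2 0 x \<le> K * lq2_norm 2 0 g"
  shows "\<Omega> \<in> resolvent_set A"
    "op_norm_le l2_pairs (lq2_norm 2 0) l2_pairs (lq2_norm 2 0) (resolvent A \<Omega>) K"
proof -
  show bd: "op_norm_le l2_pairs (lq2_norm 2 0) l2_pairs (lq2_norm 2 0) (resolvent A \<Omega>) K"
    unfolding op_norm_le_def
  proof
    fix g assume "g \<in> l2_pairs"
    then obtain x where x: "x \<in> l2_pairs" "op_shift A \<Omega> x = g" "lq2_norm 2 0 x \<le> K * lq2_norm 2 0 g"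
      using surj by blast
    have "resolvent A \<Omega> g = x"
      unfolding resolvent_def x(2)[symmetric] by (rule inv_into_f_f[OF inj x(1)])
    then show "resolvent A \<Omega> g \<in> l2_pairs \<and> lq2_norm 2 0 (resolvent A \<Omega> g) \<le> K * lq2_norm 2 0 g"
      using x by simp
  qed
  have "op_shift A \<Omega> ` l2_pairs = l2_pairs"
  proof
    show "op_shift A \<Omega> ` l2_pairs \<subseteq> l2_pairs" using maps by blast
    show "l2_pairs \<subseteq> op_shift A \<Omega> ` l2_pairs" using surj by blast
  qed
  then show "\<Omega> \<in> resolvent_set A"
    unfolding resolvent_set_def bij_betw_def using inj bd by blast
qed

lemma resolvent_solves:
  assumes "\<Omega> \<in> resolvent_set A" "g \<in> l2_pairs"
  shows "resolvent A \<Omega> g \<in> l2_pairs" "op_shift A \<Omega> (resolvent A \<Omega> g) = g"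
proof -
  have "op_shift A \<Omega> ` l2_pairs = l2_pairs"
    using assms(1) unfolding resolvent_set_def bij_betw_def by blast
  then have "g \<in> op_shift A \<Omega> ` l2_pairs" using assms(2) by simp
  then show "resolvent A \<Omega> g \<in> l2_pairs" "op_shift A \<Omega> (resolvent A \<Omega> g) = g"
    unfolding resolvent_def by (rule inv_into_into, rule f_inv_into_f)
qed

lemma lq2_norm_2_0_triangle:
  assumes "x \<in> l2_pairs" "y \<in> l2_pairs" shows "lq2_norm 2 0 (x + y) \<le>
      lq2_norm 2 0 x + lq2_norm 2 0 y"
  by (rule l2_le_imp_l2_pairs(2)) (simp only: state_add l2_le_add l2_pairs_l2_le assms)

lemma lq2_norm_2_0_scale:
  assumes "x \<in> l2_pairs" shows "lq2_norm 2 0 (seq2_scale c x) \<le> cmod c * lq2_norm 2 0 x"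
  by (rule l2_le_imp_l2_pairs(2)) (simp only: state_scale l2_le_mult l2_pairs_l2_le assms)

lemma lq2_norm_2_0_nonneg: "0 \<le> lq2_norm 2 0 x"
  by (simp add: lq2_norm_def)

lemma l2_pairs_add: "x \<in> l2_pairs \<Longrightarrow> y \<in> l2_pairs \<Longrightarrow> x + y \<in> l2_pairs"
  unfolding l2_pairs_iff_l2_le state_add using l2_le_add by blast

lemma l2_pairs_scale: "x \<in> l2_pairs \<Longrightarrow> seq2_scale c x \<in> l2_pairs"
  unfolding l2_pairs_iff_l2_le state_scale using l2_le_mult by blast

lemma lq2_space_1_1_bounds:
  assumes x: "x \<in> lq2_space 1 1" and F: "finite F"
  shows "(\<Sum>n\<in>F. sqrt (1 + (real_of_int n)\<^sup>2) * cmod (state x (n, s))) \<le> lq2_norm 1 1 x"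
proof -
  have w: "lq_weight 1 n = sqrt (1 + (real_of_int n)\<^sup>2)" for n
    by (simp add: lq_weight_def powr_half_sqrt)
  have pw: "(sqrt (1 + (real_of_int n)\<^sup>2) * cmod c) powr 1 =
      sqrt (1 + (real_of_int n)\<^sup>2) * cmod c" for n c
    by simp
  have u: "(\<lambda>n. sqrt (1 + (real_of_int n)\<^sup>2) * cmod (fst x n)) summable_on UNIV"
    "(\<lambda>n. sqrt (1 + (real_of_int n)\<^sup>2) * cmod (snd x n)) summable_on UNIV"
    using x unfolding lq2_space_def by (cases x; simp add: lq_space_def w)+
  have n0: "0 \<le> (\<Sum>\<^sub>\<infinity>n. sqrt (1 + (real_of_int n)\<^sup>2) * cmod (v n))" for v :: "int \<Rightarrow> complex"
    by (intro infsum_nonneg) simp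
  have N: "lq2_norm 1 1 x = (\<Sum>\<^sub>\<infinity>n. sqrt (1 + (real_of_int n)\<^sup>2) * cmod (fst x n)) +
      (\<Sum>\<^sub>\<infinity>n. sqrt (1 + (real_of_int n)\<^sup>2) * cmod (snd x n))"
    unfolding lq2_norm_def lq_norm_def w using n0 by simp
  have f: "(\<Sum>n\<in>F. sqrt (1 + (real_of_int n)\<^sup>2) * cmod (v n)) \<le>
      (\<Sum>\<^sub>\<infinity>n. sqrt (1 + (real_of_int n)\<^sup>2) * cmod (v n))"
    if "(\<lambda>n. sqrt (1 + (real_of_int n)\<^sup>2) * cmod (v n)) summable_on UNIV" for v :: "int \<Rightarrow> complex"
    by (rule finite_sum_le_infsum[OF that F]) auto
  show ?thesis
    unfolding N using f[OF u(1)] f[OF u(2)] n0[of "fst x"] n0[of "snd x"]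
    by (cases s) (simp_all add: state_def)
qed

context dnls_graph
begin

text \<open>An arbitrary operator on pairs that acts on states as \<open>H\<close>, to be
  instantiated by \<open>dnls_operator\<close>.\<close>

context
  fixes A :: "seq2 \<Rightarrow> seq2"
  assumes A: "\<And>x. state (A x) = H (state x)"
begin

interpretation E: complex_endomorphism seq2_scale A
proof
  show "A (x + y) = A x + A y" for x y
    unfolding state_eq_iff[symmetric] A state_add by (rule ext) (rule H_add)
  show "A (seq2_scale t x) = seq2_scale t (A x)" for t x
    unfolding state_eq_iff[symmetric] A state_scale by (rule ext) (rule H_scale)
qed

lemma shifted_eq: "E.shifted = op_shift A"
  by (intro ext) (simp add: E.shifted_def op_shift_def)

lemma state_shift: "state (op_shift A \<Omega> x) = (\<lambda>i. H (state x) i - \<Omega> * state x i)"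
  by (simp add: state_op_shift A)

lemma A_bound:
  assumes "x \<in> l2_pairs"
  shows "A x \<in> l2_pairs" "lq2_norm 2 0 (A x) \<le> (4 * \<epsilon> + 1 + 2 * (1 + 2 * real p)) * lq2_norm 2 0 x"
  using l2_le_imp_l2_pairs[of "A x"] H_l2[OF l2_pairs_l2_le[OF assms]] unfolding A by blast+

lemma op_shift_l2_pairs: "x \<in> l2_pairs \<Longrightarrow> op_shift A \<Omega> x \<in> l2_pairs"
  using l2_pairs_add[OF A_bound(1) l2_pairs_scale, of x x "- \<Omega>"]
  by (simp add: op_shift_def seq2.scale_minus_left)

lemma op_shift_bound:
  assumes "x \<in> l2_pairs"
  shows "lq2_norm 2 0 (op_shift A \<Omega> x) \<le> (4 * \<epsilon> + 1 + 2 * (1 + 2 * real p) +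
      cmod \<Omega>) * lq2_norm 2 0 x"
proof -
  have "op_shift A \<Omega> x = A x + seq2_scale (- \<Omega>) x" by (simp add: op_shift_def)
  then show ?thesis
    using lq2_norm_2_0_triangle[OF A_bound(1)[OF assms] l2_pairs_scale[OF assms], of "- \<Omega>"]
      A_bound(2)[OF assms] lq2_norm_2_0_scale[OF assms, of "- \<Omega>"] by (simp add: distrib_right)
qed

lemma inj_on_op_shift:
  assumes "\<And>x. x \<in> l2_pairs \<Longrightarrow> op_shift A \<Omega> x = 0 \<Longrightarrow> x = 0"
  shows "inj_on (op_shift A \<Omega>) l2_pairs"
proof (rule inj_onI)
  fix x y assume xy: "x \<in> l2_pairs" "y \<in> l2_pairs" "op_shift A \<Omega> x = op_shift A \<Omega> y"
  have "x - y \<in> l2_pairs" using l2_pairs_add[OF xy(1) l2_pairs_scale[OF xy(2), of "-1"]] by simp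
  moreover have "op_shift A \<Omega> (x - y) = 0" using xy(3) E.shifted_diff[of \<Omega> x y]
      by (simp add: shifted_eq)
  ultimately show "x = y" using assms[of "x - y"] by simp
qed

lemma off_band_resolvent_set:
  assumes \<Omega>: "1/2 \<le> cmod \<Omega>" "\<Omega> \<notin> spectral_bands \<epsilon>"
  shows "\<Omega> \<in> resolvent_set A"
proof -
  obtain z where z: "band_roots \<Omega> z" "\<And>s. cmod (z s) < 1"
    using band_roots_exist[OF \<Omega>(2)] by blast
  obtain K where K: "\<And>f F. l2_le f F \<Longrightarrow> \<exists>x. (\<forall>i. H x i - \<Omega> * x i = f i) \<and> l2_le x (K * F)"
    using off_band_surjective[OF \<Omega>(1) z(2,1)] by blast
  show ?thesis
  proof (rule resolvent_setI(1))
    show "inj_on (op_shift A \<Omega>) l2_pairs"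
    proof (rule inj_on_op_shift)
      fix x assume x: "x \<in> l2_pairs" "op_shift A \<Omega> x = 0"
      have "H (state x) i - \<Omega> * state x i = 0" for i
        using x(2) unfolding state_eq_iff[symmetric] state_shift state_0 by (rule fun_cong)
      then have "state x = (\<lambda>_. 0)"
        by (rule off_band_injective[OF \<Omega>(1) z(2,1) l2_pairs_l2_le[OF x(1)]])
      then show "x = 0" by (simp add: state_eq_0_iff)
    qed
    show "\<exists>x\<in>l2_pairs. op_shift A \<Omega> x = g \<and> lq2_norm 2 0 x \<le>
        K * lq2_norm 2 0 g" if g: "g \<in> l2_pairs" for g
    proof -
      obtain x where x: "\<And>i. H x i - \<Omega> * x i = state g i" "l2_le x (K * lq2_norm 2 0 g)"
        using K[OF l2_pairs_l2_le[OF g]] by blast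
      have "op_shift A \<Omega> (of_state x) = g"
        unfolding state_eq_iff[symmetric] state_shift state_of_state using x(1) by (rule ext)
      then show ?thesis using l2_le_imp_l2_pairs[of "of_state x"] x(2) unfolding state_of_state
          by blast
    qed
  qed (rule op_shift_l2_pairs)
qed

text \<open>Off the real axis the resolvent value is square summable, hence bounded, hence a fixed
  point of \<open>decoupled\<close>, and \<open>limiting_absorption\<close> applies. The constant
  comes from comparing the weight on the lattice with the distance to the excited sites.\<close>

lemma boundary_values:
  fixes \<omega> \<sigma> :: real
  assumes \<omega>: "complex_of_real \<omega> \<in> spectral_bands \<epsilon>" and \<sigma>: "\<sigma> \<noteq> 0" and x: "x \<in> lq2_space 1 1"
  shows "\<exists>y. (\<forall>i. ((\<lambda>\<mu>. state (resolvent A (of_real \<omega> +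
      \<i> * of_real (\<sigma> * \<mu>)) x) i) \<longlongrightarrow> y i) (at_right 0)) \<and>
    (\<forall>i. cmod (y i) \<le> 4 * (1 + \<bar>real_of_int a\<bar> + \<bar>real_of_int b\<bar>) / \<epsilon> * lq2_norm 1 1 x)"
proof -
  define f where "f = state x"
  define \<Omega> where "\<Omega> \<mu> = of_real \<omega> + \<i> * of_real (\<sigma> * \<mu>)" for \<mu> :: real
  define W where "W = (1 + \<bar>real_of_int a\<bar> + \<bar>real_of_int b\<bar>) * lq2_norm 1 1 x"
  have w1: "1 \<le> \<bar>\<omega>\<bar>" using \<omega> eps by (auto simp: spectral_bands_def)
  have big: "1/2 \<le> cmod (\<Omega> \<mu>)" for \<mu>
    using abs_Re_le_cmod[of "\<Omega> \<mu>"] w1 by (simp add: \<Omega>_def)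
  have notin: "\<Omega> \<mu> \<notin> spectral_bands \<epsilon>" if "\<mu> > 0" for \<mu>
  proof
    assume "\<Omega> \<mu> \<in> spectral_bands \<epsilon>"
    then have "Im (\<Omega> \<mu>) = 0" unfolding spectral_bands_def by (auto simp del: of_real_eq_iff)
    then show False using \<sigma> that by (simp add: \<Omega>_def)
  qed
  obtain z z0 where z: "\<And>\<mu>. \<mu> > 0 \<Longrightarrow> band_roots (\<Omega> \<mu>) (z \<mu>) \<and> (\<forall>s. cmod (z \<mu> s) < 1)"
    "\<And>s. ((\<lambda>\<mu>. z \<mu> s) \<longlongrightarrow> z0 s) (at_right 0)"
    using band_roots_limit[OF \<sigma>, of \<omega>] unfolding \<Omega>_def by blast
  have bd: "(\<Sum>n\<in>F. sqrt (1 + (real_of_int n)\<^sup>2) * cmod (f (n, s))) \<le>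
      lq2_norm 1 1 x" if "finite F" for F s
    unfolding f_def by (rule lq2_space_1_1_bounds[OF x that])
  have N0: "0 \<le> lq2_norm 1 1 x" using bd[of "{}" True] by simp
  have NW: "lq2_norm 1 1 x \<le> W"
    unfolding W_def using N0 mult_right_mono[of 1 "1 + \<bar>real_of_int a\<bar> +
        \<bar>real_of_int b\<bar>" "lq2_norm 1 1 x"] by simp
  have s1: "1 \<le> sqrt (1 + (real_of_int n)\<^sup>2)" "\<bar>real_of_int n\<bar> \<le> sqrt (1 + (real_of_int n)\<^sup>2)" for n
    by (auto intro: real_le_rsqrt)
  have l2: "l2_le f (2 * lq2_norm 1 1 x)"
  proof (rule l2_le_sum_bound)
    fix F :: "(int \<times> bool) set" assume F: "finite F"
    have "(\<Sum>i\<in>F. cmod (f i)) \<le> (\<Sum>i\<in>fst ` F \<times> UNIV. cmod (f i))"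
      using F by (intro sum_mono2) (auto intro: rev_image_eqI)
    also have "\<dots> = (\<Sum>s\<in>UNIV. \<Sum>n\<in>fst ` F. cmod (f (n, s)))"
      by (subst sum.swap) (simp add: sum.cartesian_product)
    also have "\<dots> \<le> (\<Sum>s\<in>(UNIV::bool set). lq2_norm 1 1 x)"
    proof (rule sum_mono)
      fix s
      have "(\<Sum>n\<in>fst ` F. 1 * cmod (f (n, s))) \<le> (\<Sum>n\<in>fst ` F. sqrt (1 +
          (real_of_int n)\<^sup>2) * cmod (f (n, s)))"
        by (intro sum_mono mult_right_mono s1) auto
      then show "(\<Sum>n\<in>fst ` F. cmod (f (n, s))) \<le> lq2_norm 1 1 x" using bd[of "fst ` F" s] F by simp
    qed
    finally show "(\<Sum>i\<in>F. cmod (f i)) \<le> 2 * lq2_norm 1 1 x" by simp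
  qed
  have x2: "x \<in> l2_pairs" using l2 l2_le_imp_l2_pairs(1) unfolding f_def by blast
  have fW: "weighted_le (\<lambda>k. f (site r k, s)) W" for r s
  proof (rule weighted_leI)
    fix m
    have "(\<Sum>k<m. (1 + real k) * cmod (f (site r k, s))) \<le>
      (\<Sum>k<m. (1 + \<bar>real_of_int a\<bar> + \<bar>real_of_int b\<bar>) * (sqrt (1 +
          (real_of_int (site r k))\<^sup>2) * cmod (f (site r k, s))))"
    proof (rule sum_mono)
      fix k
      \<comment> \<open>\<open>1 + k\<close> is the distance from the edge site, which is at most
        \<open>(1 + |a| + |b|)\<close> times the lattice weight.\<close>
      have "1 + real k = \<bar>real_of_int (site r k) - real_of_int (edge r)\<bar>"
        by (simp add: site_def edge_def)
      also have "\<dots> \<le> \<bar>real_of_int (site r k)\<bar> * 1 + (\<bar>real_of_int a\<bar> + \<bar>real_of_int b\<bar>) * 1"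
        using abs_triangle_ineq4[of "real_of_int (site r k)" "real_of_int (edge r)"]
            by (auto simp: edge_def)
      also have "\<dots> \<le> sqrt (1 + (real_of_int (site r k))\<^sup>2) * 1 +
          (\<bar>real_of_int a\<bar> + \<bar>real_of_int b\<bar>) * sqrt (1 + (real_of_int (site r k))\<^sup>2)"
        by (intro add_mono mult_right_mono mult_left_mono s1) auto
      finally have "1 + real k \<le> (1 + \<bar>real_of_int a\<bar> + \<bar>real_of_int b\<bar>) * sqrt (1 +
          (real_of_int (site r k))\<^sup>2)"
        by (simp add: algebra_simps)
      then show "(1 + real k) * cmod (f (site r k, s)) \<le> (1 + \<bar>real_of_int a\<bar> + \<bar>real_of_int b\<bar>) *
          (sqrt (1 + (real_of_int (site r k))\<^sup>2) * cmod (f (site r k, s)))"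
        unfolding mult.assoc[symmetric] by (rule mult_right_mono) simp
    qed
    also have "\<dots> = (1 + \<bar>real_of_int a\<bar> + \<bar>real_of_int b\<bar>) *
        (\<Sum>n\<in>site r ` {..<m}. sqrt (1 + (real_of_int n)\<^sup>2) * cmod (f (n, s)))"
      by (subst sum.reindex) (auto simp: sum_distrib_left inj_on_def site_def)
    also have "\<dots> \<le> W" unfolding W_def by (intro mult_left_mono bd) auto
    finally show "(\<Sum>k<m. (1 + real k) * cmod (f (site r k, s))) \<le> W" .
  qed
  have fin: "cmod (f (n, s)) \<le> W" for n s
  proof -
    have "1 * cmod (f (n, s)) \<le> sqrt (1 + (real_of_int n)\<^sup>2) * cmod (f (n, s))"
      by (intro mult_right_mono s1) auto
    then show ?thesis using bd[of "{n}" s] NW by simp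
  qed
  define u where "u \<mu> = state (resolvent A (\<Omega> \<mu>) x)" for \<mu>
  have u: "l2_le (u \<mu>) (lq2_norm 2 0 (resolvent A (\<Omega> \<mu>) x))" "decoupled (\<Omega> \<mu>) (z \<mu>) f (u \<mu>) = u \<mu>"
    if \<mu>: "\<mu> > 0" for \<mu>
  proof -
    note r = resolvent_solves[OF off_band_resolvent_set[OF big notin[OF \<mu>]] x2]
    show l: "l2_le (u \<mu>) (lq2_norm 2 0 (resolvent A (\<Omega> \<mu>) x))"
      unfolding u_def by (rule l2_pairs_l2_le[OF r(1)])
    have eq: "H (u \<mu>) i - \<Omega> \<mu> * u \<mu> i = f i" for i
      using fun_cong[OF arg_cong[OF r(2), of state], of i] by (simp add: state_shift u_def f_def)
    have zl: "cmod (z \<mu> s) < 1" for s using z(1)[OF \<mu>] by blast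
    show "decoupled (\<Omega> \<mu>) (z \<mu>) f (u \<mu>) = u \<mu>"
      by (rule decoupled_unique[OF big zl z(1)[OF \<mu>, THEN conjunct1] l2_le_pointwise[OF l] eq])
  qed
  have "\<exists>y. (\<forall>i. ((\<lambda>\<mu>. u \<mu> i) \<longlongrightarrow> y i) (at_right 0)) \<and>
      (\<forall>i. cmod (y i) \<le> 2 * ((4 * (8 * real p + 2) + 1 / \<epsilon>) * W))"
  proof (rule limiting_absorption)
    show "(\<Omega> \<longlongrightarrow> of_real \<omega>) (at_right 0)"
    proof -
      have "((\<lambda>\<mu>. of_real \<omega> + \<i> * of_real (\<sigma> * \<mu>)) \<longlongrightarrow> of_real \<omega> + \<i> * of_real (\<sigma> * 0)) (at_right 0)"
        by (intro tendsto_intros)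
      then show ?thesis unfolding \<Omega>_def by simp
    qed
    show "1/2 \<le> cmod (complex_of_real \<omega>)" using w1 by simp
    show "\<forall>\<^sub>F \<mu> in at_right 0. 1/2 \<le> cmod (\<Omega> \<mu>)" using big by simp
    show "((\<lambda>\<mu>. z \<mu> s) \<longlongrightarrow> z0 s) (at_right 0)" for s by (rule z(2))
    show "\<forall>\<^sub>F \<mu> in at_right 0. \<forall>s. cmod (z \<mu> s) \<le> 1"
      using eventually_at_right_less[of "0::real"]
          by eventually_elim (use z(1) in \<open>auto simp: less_imp_le\<close>)
    show "\<forall>\<^sub>F \<mu> in at_right 0. decoupled (\<Omega> \<mu>) (z \<mu>) f (u \<mu>) = u \<mu>"
      using eventually_at_right_less[of "0::real"] by eventually_elim (rule u(2))
    show "\<forall>\<^sub>F \<mu> in at_right 0. \<exists>B. sup_le wt (u \<mu>) B"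
      using eventually_at_right_less[of "0::real"]
          by eventually_elim (use l2_le_sup_le[OF u(1)] in blast)
    show "weighted_le (\<lambda>k. f (site r k, s)) W" for r s by (rule fW)
    show "cmod (f (n, s)) \<le> W" for n s by (rule fin)
  qed simp
  moreover have "2 * ((4 * (8 * real p + 2) + 1 / \<epsilon>) * W) \<le>
      4 * (1 + \<bar>real_of_int a\<bar> + \<bar>real_of_int b\<bar>) / \<epsilon> * lq2_norm 1 1 x"
  proof -
    \<comment> \<open>By \<open>small\<close>, the contribution \<open>4 * (8 * p + 2)\<close> of
      the excited sites is at most \<open>1 / \<epsilon>\<close> and is absorbed into the half-line
      term.\<close>
    have "(8 * real p + 2) * 4 \<le> (8 * real p + 2) * (4 + c * (1 + 2 * real p))"
      using c by (intro mult_left_mono) auto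
    then have "(8 * real p + 2) * 4 * \<epsilon> \<le> (8 * real p + 2) * (4 + c * (1 + 2 * real p)) * \<epsilon>"
      using eps by (intro mult_right_mono) auto
    then have "(8 * real p + 2) * 4 * \<epsilon> \<le> 1" using small by linarith
    then have "4 * (8 * real p + 2) \<le> 1 / \<epsilon>" using eps by (simp add: pos_le_divide_eq mult.commute)
    then have "(4 * (8 * real p + 2) + 1 / \<epsilon>) * W \<le> (1 / \<epsilon> + 1 / \<epsilon>) * W"
      using NW N0 by (intro mult_right_mono) auto
    moreover have "(1 / \<epsilon> + 1 / \<epsilon>) * W = 2 * (W / \<epsilon>)" by simp
    moreover have "4 * (1 + \<bar>real_of_int a\<bar> + \<bar>real_of_int b\<bar>) / \<epsilon> * lq2_norm 1 1 x = 4 * (W / \<epsilon>)"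
      unfolding W_def by simp
    ultimately show ?thesis by linarith
  qed
  ultimately show ?thesis unfolding u_def \<Omega>_def by (meson order_trans)
qed

lemma boundary_resolvent_bound:
  fixes \<omega> \<sigma> :: real
  assumes \<omega>: "complex_of_real \<omega> \<in> spectral_bands \<epsilon>" and \<sigma>: "\<sigma> \<noteq> 0"
  shows "boundary_limits_exist A \<sigma> (of_real \<omega>)"
    "op_norm_le (lq2_space 1 1) (lq2_norm 1 1) linf2_space linf2_norm (boundary_resolvent A \<sigma>
        (of_real \<omega>))
      (4 * (1 + \<bar>real_of_int a\<bar> + \<bar>real_of_int b\<bar>) / \<epsilon>)"
proof -
  let ?R = "\<lambda>\<mu>. resolvent A (of_real \<omega> + \<i> * of_real (\<sigma> * \<mu>))"
  have lim: "\<exists>y. (\<forall>n. ((\<lambda>\<mu>. fst (?R \<mu> x) n) \<longlongrightarrow> y (n, True)) (at_right 0)) \<and>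
      (\<forall>n. ((\<lambda>\<mu>. snd (?R \<mu> x) n) \<longlongrightarrow> y (n, False)) (at_right 0)) \<and>
      (\<forall>i. cmod (y i) \<le> 4 * (1 + \<bar>real_of_int a\<bar> + \<bar>real_of_int b\<bar>) / \<epsilon> * lq2_norm 1 1 x)"
    if x: "x \<in> lq2_space 1 1" for x
  proof -
    obtain y where y: "\<And>i. ((\<lambda>\<mu>. state (?R \<mu> x) i) \<longlongrightarrow> y i) (at_right 0)"
      "\<And>i. cmod (y i) \<le> 4 * (1 + \<bar>real_of_int a\<bar> + \<bar>real_of_int b\<bar>) / \<epsilon> * lq2_norm 1 1 x"
      using boundary_values[OF \<omega> \<sigma> x] by blast
    have "((\<lambda>\<mu>. fst (?R \<mu> x) n) \<longlongrightarrow> y (n, True)) (at_right 0)"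
      "((\<lambda>\<mu>. snd (?R \<mu> x) n) \<longlongrightarrow> y (n, False)) (at_right 0)" for n
      using y(1)[of "(n, True)"] y(1)[of "(n, False)"] by (simp_all add: state_def)
    then show ?thesis using y(2) by blast
  qed
  show "boundary_limits_exist A \<sigma> (of_real \<omega>)"
    unfolding boundary_limits_exist_def using lim by blast
  show "op_norm_le (lq2_space 1 1) (lq2_norm 1 1) linf2_space linf2_norm (boundary_resolvent A \<sigma>
      (of_real \<omega>))
      (4 * (1 + \<bar>real_of_int a\<bar> + \<bar>real_of_int b\<bar>) / \<epsilon>)"
    unfolding op_norm_le_def
  proof
    fix x :: seq2 assume "x \<in> lq2_space 1 1"
    then obtain y where y: "\<And>n. ((\<lambda>\<mu>. fst (?R \<mu> x) n) \<longlongrightarrow> y (n, True)) (at_right 0)"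
      "\<And>n. ((\<lambda>\<mu>. snd (?R \<mu> x) n) \<longlongrightarrow> y (n, False)) (at_right 0)"
      "\<And>i. cmod (y i) \<le> 4 * (1 + \<bar>real_of_int a\<bar> + \<bar>real_of_int b\<bar>) / \<epsilon> * lq2_norm 1 1 x"
      using lim[of x] by blast
    have eq: "boundary_resolvent A \<sigma> (of_real \<omega>) x = ((\<lambda>n. y (n, True)), (\<lambda>n. y (n, False)))"
    proof -
      have "Lim (at_right 0) (\<lambda>\<mu>. fst (?R \<mu> x) n) = y (n, True)"
        "Lim (at_right 0) (\<lambda>\<mu>. snd (?R \<mu> x) n) = y (n, False)" for n
        by (rule tendsto_Lim[OF _ y(1)], simp) (rule tendsto_Lim[OF _ y(2)], simp)
      then show ?thesis unfolding boundary_resolvent_def by (simp only:)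
    qed
    have "bounded (range (\<lambda>n. y (n, s)))" for s
      unfolding bounded_iff using y(3) by blast
    moreover have "linf_norm (\<lambda>n. y (n, s)) \<le> 4 * (1 + \<bar>real_of_int a\<bar> +
        \<bar>real_of_int b\<bar>) / \<epsilon> * lq2_norm 1 1 x" for s
      unfolding linf_norm_def by (rule cSUP_least) (use y(3) in auto)
    ultimately show "boundary_resolvent A \<sigma> (of_real \<omega>) x \<in> linf2_space \<and>
        linf2_norm (boundary_resolvent A \<sigma> (of_real \<omega>) x) \<le>
        4 * (1 + \<bar>real_of_int a\<bar> + \<bar>real_of_int b\<bar>) / \<epsilon> * lq2_norm 1 1 x"
      unfolding eq linf2_space_def linf2_norm_def linf_space_def by simp
  qed
qed

section \<open>Poles and multiplicities near zero\<close>

definition V :: "seq2 set" where "V = {x. state x \<in> W}"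

lemma V_l2_pairs: "V \<subseteq> l2_pairs"
  using W_l2 by (auto simp: V_def l2_pairs_iff_l2_le)

lemma V_basis:
  "seq2.independent ((\<lambda>j. of_state (w j)) ` I)" "V \<subseteq> seq2.span ((\<lambda>j. of_state (w j)) ` I)"
  "(\<lambda>j. of_state (w j)) ` I \<subseteq> V" "inj_on (\<lambda>j. of_state (w j)) I"
proof -
  let ?v = "\<lambda>j. of_state (w j)"
  have state_sum: "state (\<Sum>j\<in>K. seq2_scale (t j) (?v j)) =
      (\<lambda>i. \<Sum>j\<in>K. t j * w j i)" if "finite K" for K t
    using that by (induction K rule: finite_induct) (auto simp: state_0 state_add state_scale)
  show inj: "inj_on ?v I"
  proof (rule inj_onI)
    fix j k assume jk: "j \<in> I" "k \<in> I" "?v j = ?v k"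
    then have "w j = w k" by (metis state_of_state)
    then show "j = k" using coord_w[OF jk(1), of j] coord_w[OF jk(1), of k]
        by (auto split: if_splits)
  qed
  show "seq2.independent (?v ` I)"
  proof (rule seq2.independent_if_scalars_zero)
    fix t x assume t: "(\<Sum>x\<in>?v ` I. seq2_scale (t x) x) = 0" and x: "x \<in> ?v ` I"
    obtain k where k: "k \<in> I" "x = ?v k" using x by blast
    have "(\<Sum>j\<in>I. seq2_scale (t (?v j)) (?v j)) = 0" using t by (simp add: sum.reindex[OF inj])
    then have "(\<lambda>i. \<Sum>j\<in>I. t (?v j) * w j i) = (\<lambda>_. 0)"
      unfolding state_sum[OF finite_I, symmetric] by (simp add: state_0)
    then have "coord (\<lambda>i. \<Sum>j\<in>I. t (?v j) * w j i) k = 0" by (simp add: coord_def)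
    moreover have "coord (\<lambda>i. \<Sum>j\<in>I. t (?v j) * w j i) k = (\<Sum>j\<in>I. if k = j then t (?v j) else 0)"
      unfolding coord_sum[OF finite_I] using k by (intro sum.cong) (auto simp: coord_w)
    ultimately show "t x = 0" using k by simp
  qed simp
  show "?v ` I \<subseteq> V"
  proof (rule image_subsetI)
    fix k assume k: "k \<in> I"
    have "(\<lambda>i. \<Sum>j\<in>I. (if j = k then 1 else 0) * w j i) = w k"
    proof
      fix i
      have "(\<Sum>j\<in>I. (if j = k then 1 else 0) * w j i) = (\<Sum>j\<in>I. if j = k then w j i else 0)"
        by (rule sum.cong) auto
      then show "(\<Sum>j\<in>I. (if j = k then 1 else 0) * w j i) = w k i" using k by simp
    qed
    then have "w k \<in> W" using combination_in_W[of "\<lambda>j. if j = k then 1 else 0"] by simp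
    then show "?v k \<in> V" by (simp add: V_def)
  qed
  show "V \<subseteq> seq2.span (?v ` I)"
  proof
    fix x assume "x \<in> V"
    then have "state x = (\<lambda>i. \<Sum>j\<in>I. coord (state x) j * w j i)" by (simp add: V_def W_def)
    then have "x = (\<Sum>j\<in>I. seq2_scale (coord (state x) j) (?v j))"
      unfolding state_eq_iff[symmetric] state_sum[OF finite_I] .
    moreover have "(\<Sum>j\<in>I. seq2_scale (coord (state x) j) (?v j)) \<in> seq2.span (?v ` I)"
      by (intro seq2.span_sum seq2.span_scale seq2.span_base) auto
    ultimately show "x \<in> seq2.span (?v ` I)" by simp
  qed
qed

lemma dim_V: "seq2.dim V = 2 * card {a..b}"
  using seq2.basis_card_eq_dim[OF V_basis(3,2,1)] card_image[OF V_basis(4)] card_I by simp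

lemma V_invariant: "E.invariant V"
  unfolding E.invariant_def
proof (intro conjI)
  have "(\<lambda>_. 0) \<in> W" using combination_in_W[of "\<lambda>_. 0"] by simp
  then show "seq2.subspace V"
    unfolding seq2.subspace_def V_def by (simp add: state_0 state_add state_scale W_add W_scale)
  show "A ` V \<subseteq> V" using H_W by (auto simp: V_def A)
  show "\<exists>B. finite B \<and> V \<subseteq> seq2.span B" using V_basis(2) by (meson finite_I finite_imageI)
qed

lemma eigenvalues_V_small: assumes "z \<in> E.eigenvalues V" shows "cmod z \<le> 1/8"
proof -
  obtain x where x: "x \<in> V" "x \<noteq> 0" "A x = seq2_scale z x" using assms
      by (auto simp: E.eigenvalues_def)
  show ?thesis
  proof (rule W_eigenvalue_small)
    show "state x \<in> W" using x by (simp add: V_def)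
    show "state x \<noteq> (\<lambda>_. 0)" using x by (simp add: state_eq_0_iff)
    show "H (state x) i = z * state x i" for i using arg_cong[OF x(3), of state]
        by (simp add: A state_scale)
  qed
qed

lemma op_shift_in_V:
  assumes "cmod \<Omega> < 1/2" "x \<in> l2_pairs" "op_shift A \<Omega> x \<in> V" shows "x \<in> V"
  using complement_injective[OF assms(1) l2_pairs_l2_le[OF assms(2)]] assms(3)
  by (simp add: V_def state_shift)

text \<open>Injectivity modulo \<open>V\<close> is applied once for each power: if
  \<open>(A - z)^k x\<close> lies in \<open>V\<close>, then so does \<open>x\<close>. Thus the
  generalized eigenspace in the full space is already contained in \<open>V\<close>.\<close>

lemma gen_eigenspace_eq:
  assumes z: "cmod z < 1/2" shows "gen_eigenspace A z = E.gen_eigenvectors V z"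
proof
  have inV: "x \<in> V" if "x \<in> l2_pairs" "(op_shift A z ^^ k) x \<in> V" for x k
    using that
  proof (induction k arbitrary: x)
    case (Suc k)
    have "(op_shift A z ^^ k) (op_shift A z x) \<in> V"
      using Suc.prems(2) by (simp only: funpow_Suc_right comp_apply)
    then have "op_shift A z x \<in> V" by (rule Suc.IH[OF op_shift_l2_pairs[OF Suc.prems(1)]])
    then show ?case by (rule op_shift_in_V[OF z Suc.prems(1)])
  qed simp
  have "0 \<in> V" using V_invariant by (auto simp: E.invariant_def seq2.subspace_0)
  show "gen_eigenspace A z \<subseteq> E.gen_eigenvectors V z"
  proof
    fix x assume "x \<in> gen_eigenspace A z"
    then obtain k where k: "x \<in> l2_pairs" "(op_shift A z ^^ k) x = 0"
        by (auto simp: gen_eigenspace_def)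
    then have "x \<in> V" using inV[OF k(1), of k] \<open>0 \<in> V\<close> by simp
    then show "x \<in> E.gen_eigenvectors V z" using k(2)
        by (auto simp: E.gen_eigenvectors_def shifted_eq)
  qed
  show "E.gen_eigenvectors V z \<subseteq> gen_eigenspace A z"
    using V_l2_pairs by (auto simp: gen_eigenspace_def E.gen_eigenvectors_def shifted_eq)
qed

text \<open>The solution is a sum: \<open>x1\<close> solves the equation modulo \<open>V\<close>,
  uniformly in \<open>\<Omega>\<close>, and \<open>x2\<close> removes the remainder inside
  \<open>V\<close>, where a product of factors \<open>A - z\<close> vanishes. Only \<open>x2\<close>
  is singular, and the exponent \<open>m\<close>, the number of factors, bounds the order of the
  poles.\<close>

lemma resolvent_near_0:
  "\<exists>K m. \<forall>\<Omega> r. cmod \<Omega> < 1/2 \<and> 0 < r \<and> r \<le> 1 \<and> (\<forall>z\<in>E.eigenvalues V. r \<le> cmod (z - \<Omega>)) \<longrightarrow>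
    \<Omega> \<in> resolvent_set A \<and>
    op_norm_le l2_pairs (lq2_norm 2 0) l2_pairs (lq2_norm 2 0) (resolvent A \<Omega>) (K / r ^ m)"
proof -
  let ?N = "lq2_norm 2 0"
  let ?h = "4 * \<epsilon> + 1 + 2 * (1 + 2 * real p)"
  obtain zs where zs: "set zs \<subseteq> E.eigenvalues V" "\<And>x. x \<in> V \<Longrightarrow> fold E.shifted zs x = 0"
    using E.primary_decomposition[OF V_invariant] by blast
  have "\<exists>K\<ge>0. \<forall>\<Omega> r. 0 < r \<and> r \<le> 1 \<and> (\<forall>z\<in>set zs. r \<le> cmod (z - \<Omega>)) \<longrightarrow>
    (\<forall>g\<in>V. fold E.shifted zs g = 0 \<longrightarrow>
      (\<exists>x\<in>V. E.shifted \<Omega> x = g \<and> ?N x \<le> K / r ^ length zs * ?N g))"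
  proof (rule E.solve_annihilated[OF V_invariant])
    show "?N 0 = 0" by (simp add: lq2_norm_2_0)
    show "?N (x + y) \<le> ?N x + ?N y" if "x \<in> V" "y \<in> V" for x y
      using that V_l2_pairs by (intro lq2_norm_2_0_triangle) auto
    show "?N (seq2_scale t x) \<le> cmod t * ?N x" if "x \<in> V" for t x
      using that V_l2_pairs by (intro lq2_norm_2_0_scale) auto
    show "?N (A x) \<le> ?h * ?N x" if "x \<in> V" for x
      using that V_l2_pairs by (intro A_bound) auto
  qed (use eps lq2_norm_2_0_nonneg in auto)
  then obtain K where K: "K \<ge> 0" "\<And>\<Omega> r g. 0 < r \<Longrightarrow> r \<le> 1 \<Longrightarrow> (\<forall>z\<in>set zs. r \<le> cmod (z - \<Omega>)) \<Longrightarrow>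
      g \<in> V \<Longrightarrow> \<exists>x\<in>V. op_shift A \<Omega> x = g \<and> ?N x \<le> K / r ^ length zs * ?N g"
    using zs(2) unfolding shifted_eq by blast
  define K1 where "K1 = 4 * (1 + real (card {a..b}) * (1 + 2 / \<eta>))"
  have K1: "0 \<le> K1" using eta(1) by (simp add: K1_def)
  define K2 where "K2 = K1 + K * (1 + (?h + 1/2) * K1)"
  have main: "\<Omega> \<in> resolvent_set A \<and>
    op_norm_le l2_pairs ?N l2_pairs ?N (resolvent A \<Omega>) (K2 / r ^ length zs)"
    if \<Omega>: "cmod \<Omega> < 1/2" and r: "0 < r" "r \<le> 1" "\<forall>z\<in>E.eigenvalues V. r \<le> cmod (z - \<Omega>)" for \<Omega> r
  proof (rule conjI; rule resolvent_setI)
    show "op_shift A \<Omega> x \<in> l2_pairs" if "x \<in> l2_pairs" for x by (rule op_shift_l2_pairs[OF that])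
    then show "op_shift A \<Omega> x \<in> l2_pairs" if "x \<in> l2_pairs" for x using that .
    show inj: "inj_on (op_shift A \<Omega>) l2_pairs"
    proof (rule inj_on_op_shift)
      fix x assume x: "x \<in> l2_pairs" "op_shift A \<Omega> x = 0"
      have "0 \<in> V" using V_invariant by (auto simp: E.invariant_def seq2.subspace_0)
      then have "x \<in> V" using op_shift_in_V[OF \<Omega> x(1)] x(2) by simp
      show "x = 0"
      proof (rule ccontr)
        assume "x \<noteq> 0"
        then have "\<Omega> \<in> E.eigenvalues V" using \<open>x \<in> V\<close> x(2)
            by (auto simp: E.eigenvalues_iff shifted_eq)
        then show False using r by auto
      qed
    qed
    then show "inj_on (op_shift A \<Omega>) l2_pairs" .
    show surj: "\<exists>x\<in>l2_pairs. op_shift A \<Omega> x = g \<and>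
        ?N x \<le> K2 / r ^ length zs * ?N g" if g: "g \<in> l2_pairs" for g
    proof -
      obtain y where y: "l2_le y (K1 * ?N g)" "(\<lambda>i. state g i - (H y i - \<Omega> * y i)) \<in> W"
        using complement_solution[OF \<Omega> l2_pairs_l2_le[OF g]] unfolding K1_def by blast
      define x1 where "x1 = of_state y"
      have x1: "x1 \<in> l2_pairs" "?N x1 \<le> K1 * ?N g"
        using l2_le_imp_l2_pairs[of x1] y(1) by (auto simp: x1_def)
      define d where "d = g - op_shift A \<Omega> x1"
      have d: "d \<in> V" using y(2) by (simp add: d_def V_def state_diff state_shift x1_def)
      have dN: "?N d \<le> (1 + (?h + 1/2) * K1) * ?N g"
      proof -
        have "d = g + seq2_scale (-1) (op_shift A \<Omega> x1)" by (simp add: d_def)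
        then have "?N d \<le> ?N g + ?N (op_shift A \<Omega> x1)"
          using lq2_norm_2_0_triangle[OF g l2_pairs_scale[OF op_shift_l2_pairs[OF x1(1)]],
              of "-1" \<Omega>]
            lq2_norm_2_0_scale[OF op_shift_l2_pairs[OF x1(1)], of "-1" \<Omega>] by simp
        also have "?N (op_shift A \<Omega> x1) \<le> (?h + cmod \<Omega>) * ?N x1" by (rule op_shift_bound[OF x1(1)])
        also have "\<dots> \<le> (?h + 1/2) * (K1 * ?N g)"
          using \<Omega> eps x1(2) lq2_norm_2_0_nonneg by (intro mult_mono) auto
        finally show ?thesis by (simp add: algebra_simps)
      qed
      have "\<forall>z\<in>set zs. r \<le> cmod (z - \<Omega>)" using r(3) zs(1) by blast
      then obtain x2 where x2: "x2 \<in> V" "op_shift A \<Omega> x2 = d" "?N x2 \<le> K / r ^ length zs * ?N d"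
        using K(2)[OF r(1,2) _ d] by blast
      have x2l: "x2 \<in> l2_pairs" using x2(1) V_l2_pairs by blast
      have "op_shift A \<Omega> (x1 + x2) = g"
        using E.shifted_add[of \<Omega> x1 x2] x2(2) by (simp add: shifted_eq d_def)
      moreover have "?N (x1 + x2) \<le> K2 / r ^ length zs * ?N g"
      proof -
        have rp: "0 < r ^ length zs" "r ^ length zs \<le> 1" using r by (auto simp: power_le_one)
        have "K1 * ?N g * (r ^ length zs) \<le> K1 * ?N g * 1"
          using rp K1 lq2_norm_2_0_nonneg by (intro mult_left_mono) auto
        then have 1: "K1 * ?N g \<le> K1 * ?N g / r ^ length zs" using rp
            by (simp add: pos_le_divide_eq)
        have "K / r ^ length zs * ?N d \<le> K / r ^ length zs * ((1 + (?h + 1/2) * K1) * ?N g)"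
          using K(1) rp by (intro mult_left_mono dN) auto
        also have "\<dots> = K * (1 + (?h + 1/2) * K1) * ?N g / r ^ length zs" by simp
        finally have "?N (x1 + x2) \<le> K1 * ?N g / r ^ length zs + K * (1 + (?h +
            1/2) * K1) * ?N g / r ^ length zs"
          using lq2_norm_2_0_triangle[OF x1(1) x2l] x1(2) x2(3) 1 by linarith
        also have "\<dots> = K2 / r ^ length zs * ?N g"
          unfolding K2_def by (simp only: add_divide_distrib distrib_right times_divide_eq_left)
        finally show ?thesis .
      qed
      ultimately show ?thesis using l2_pairs_add[OF x1(1) x2l] by blast
    qed
    then show "\<exists>x\<in>l2_pairs. op_shift A \<Omega> x = g \<and> ?N x \<le>
        K2 / r ^ length zs * ?N g" if "g \<in> l2_pairs" for g
      using that .
  qed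
  then show ?thesis by blast
qed

lemma finite_eigenvalues_V: "finite (E.eigenvalues V)"
  using E.primary_decomposition[OF V_invariant] by blast

lemma resolvent_poles_near_0: "{z \<in> ball 0 (1/2). resolvent_pole A z} = E.eigenvalues V"
proof
  show "{z \<in> ball 0 (1/2). resolvent_pole A z} \<subseteq> E.eigenvalues V"
  proof clarify
    fix z assume z: "z \<in> ball 0 (1/2)" "resolvent_pole A z"
    then obtain x where x: "x \<in> l2_pairs" "x \<noteq> 0" "A x = seq2_scale z x"
      by (auto simp: resolvent_pole_def is_eigenvalue_def)
    have 0: "op_shift A z x = 0" using x(3) by (simp add: op_shift_def)
    have "0 \<in> V" using V_invariant by (auto simp: E.invariant_def seq2.subspace_0)
    then have "x \<in> V" using op_shift_in_V[OF _ x(1), of z] z(1) 0 by simp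
    then show "z \<in> E.eigenvalues V" using x by (auto simp: E.eigenvalues_def)
  qed
  show "E.eigenvalues V \<subseteq> {z \<in> ball 0 (1/2). resolvent_pole A z}"
  proof
    fix z assume z: "z \<in> E.eigenvalues V"
    have zs: "cmod z \<le> 1/8" by (rule eigenvalues_V_small[OF z])
    have ev: "is_eigenvalue A z"
      using z V_l2_pairs by (auto simp: is_eigenvalue_def E.eigenvalues_def)
    obtain K m where K: "\<And>\<Omega> r. cmod \<Omega> < 1/2 \<Longrightarrow> 0 < r \<Longrightarrow> r \<le> 1 \<Longrightarrow>
        (\<forall>z\<in>E.eigenvalues V. r \<le> cmod (z - \<Omega>)) \<Longrightarrow>
        \<Omega> \<in> resolvent_set A \<and>
        op_norm_le l2_pairs (lq2_norm 2 0) l2_pairs (lq2_norm 2 0) (resolvent A \<Omega>) (K / r ^ m)"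
      using resolvent_near_0 by blast
    obtain \<rho> where \<rho>: "\<rho> > 0" "\<And>y. y \<in> E.eigenvalues V \<Longrightarrow> y \<noteq> z \<Longrightarrow> \<rho> \<le> dist z y"
      using finite_set_avoid[OF finite_eigenvalues_V, of z] by blast
    \<comment> \<open>Within \<open>\<rho> / 2\<close> of \<open>z\<close> no other eigenvalue is
      closer to \<open>\<Omega>\<close> than \<open>z\<close>, and \<open>1/4\<close> keeps
      \<open>|\<Omega>| < 1/2\<close> because \<open>|z| \<le> 1/8\<close>.\<close>
    define r where "r = min (\<rho> / 2) (1/4)"
    have "\<Omega> \<in> resolvent_set A \<and> op_norm_le l2_pairs (lq2_norm 2 0) l2_pairs (lq2_norm 2 0)
          (resolvent A \<Omega>) (K / cmod (\<Omega> - z) ^ m)" if "\<Omega> \<in> ball z r - {z}" for \<Omega>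
    proof (rule K)
      have d: "cmod (\<Omega> - z) < \<rho> / 2" "cmod (\<Omega> - z) < 1/4" "\<Omega> \<noteq> z"
        using that by (auto simp: r_def dist_norm norm_minus_commute)
      show "cmod \<Omega> < 1/2" using norm_triangle_ineq[of "\<Omega> - z" z] d zs by simp
      show "0 < cmod (\<Omega> - z)" "cmod (\<Omega> - z) \<le> 1" using d by auto
      show "\<forall>y\<in>E.eigenvalues V. cmod (\<Omega> - z) \<le> cmod (y - \<Omega>)"
      proof
        fix y assume y: "y \<in> E.eigenvalues V"
        show "cmod (\<Omega> - z) \<le> cmod (y - \<Omega>)"
        proof (cases "y = z")
          case True then show ?thesis by (simp add: norm_minus_commute)
        next
          case False
          have "\<rho> \<le> cmod (z - y)" using \<rho>(2)[OF y False] by (simp add: dist_norm)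
          also have "\<dots> \<le> cmod (\<Omega> - z) + cmod (y - \<Omega>)"
            using norm_triangle_ineq[of "z - \<Omega>" "\<Omega> - y"] by (simp add: norm_minus_commute)
          finally show ?thesis using d by linarith
        qed
      qed
    qed
    moreover have "r > 0" using \<rho> by (simp add: r_def)
    ultimately have "resolvent_pole A z" unfolding resolvent_pole_def using ev by blast
    then show "z \<in> {z \<in> ball 0 (1/2). resolvent_pole A z}" using zs by simp
  qed
qed

lemma near_0_resolvent_set:
  assumes \<Omega>: "cmod \<Omega> < 1/2" "\<Omega> \<notin> E.eigenvalues V" shows "\<Omega> \<in> resolvent_set A"
proof -
  obtain \<rho> where \<rho>: "\<rho> > 0" "\<And>y. y \<in> E.eigenvalues V \<Longrightarrow> y \<noteq> \<Omega> \<Longrightarrow> \<rho> \<le> dist \<Omega> y"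
    using finite_set_avoid[OF finite_eigenvalues_V, of \<Omega>] by blast
  have "\<forall>z\<in>E.eigenvalues V. min \<rho> 1 \<le> cmod (z - \<Omega>)"
  proof
    fix z assume z: "z \<in> E.eigenvalues V"
    then have "\<rho> \<le> dist \<Omega> z" using \<rho>(2) \<Omega>(2) by blast
    then show "min \<rho> 1 \<le> cmod (z - \<Omega>)" by (simp add: dist_norm norm_minus_commute)
  qed
  then show ?thesis using resolvent_near_0 \<Omega>(1) \<rho>(1)
      by (metis min_less_iff_conj min.cobounded2 zero_less_one)
qed

theorem dnls_spectrum:
  "(\<forall>\<Omega>. \<Omega> \<notin> ball 0 (1/2) \<union> spectral_bands \<epsilon> \<longrightarrow> \<Omega> \<in> resolvent_set A)"
  "ball 0 (1/2) - {z \<in> ball 0 (1/2). resolvent_pole A z} \<subseteq> resolvent_set A"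
  "finite {z \<in> ball 0 (1/2). resolvent_pole A z}"
  "\<forall>z\<in>{z \<in> ball 0 (1/2). resolvent_pole A z}. finite_alg_mult A z"
  "(\<Sum>z\<in>{z \<in> ball 0 (1/2). resolvent_pole A z}. alg_mult A z) = 2 * card {a..b}"
proof -
  show "\<forall>\<Omega>. \<Omega> \<notin> ball 0 (1/2) \<union> spectral_bands \<epsilon> \<longrightarrow> \<Omega> \<in> resolvent_set A"
    by (auto intro!: off_band_resolvent_set)
  show "ball 0 (1/2) - {z \<in> ball 0 (1/2). resolvent_pole A z} \<subseteq> resolvent_set A"
    unfolding resolvent_poles_near_0 using near_0_resolvent_set by auto
  show "finite {z \<in> ball 0 (1/2). resolvent_pole A z}"
    unfolding resolvent_poles_near_0 by (rule finite_eigenvalues_V)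
  have g: "gen_eigenspace A z = E.gen_eigenvectors V z" if "z \<in> E.eigenvalues V" for z
    by (rule gen_eigenspace_eq) (use eigenvalues_V_small[OF that] in simp)
  show "\<forall>z\<in>{z \<in> ball 0 (1/2). resolvent_pole A z}. finite_alg_mult A z"
  proof
    fix z assume "z \<in> {z \<in> ball 0 (1/2). resolvent_pole A z}"
    then have "gen_eigenspace A z = E.gen_eigenvectors V z" unfolding resolvent_poles_near_0
        by (rule g)
    also have "\<dots> \<subseteq> seq2.span ((\<lambda>j. of_state (w j)) ` I)"
      using V_basis(2) by (auto simp: E.gen_eigenvectors_def)
    finally show "finite_alg_mult A z" unfolding finite_alg_mult_def
        by (meson finite_I finite_imageI)
  qed
  have "(\<Sum>z\<in>E.eigenvalues V. alg_mult A z) = (\<Sum>z\<in>E.eigenvalues V. seq2.dim (E.gen_eigenvectors V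
      z))"
    by (rule sum.cong) (simp_all add: alg_mult_def g)
  then show "(\<Sum>z\<in>{z \<in> ball 0 (1/2). resolvent_pole A z}. alg_mult A z) = 2 * card {a..b}"
    unfolding resolvent_poles_near_0 using E.primary_decomposition[OF V_invariant] dim_V by simp
qed

end

end

theorem theorem3:
  fixes Up Um :: "int set" and p :: nat and \<phi> :: "real \<Rightarrow> int \<Rightarrow> real"
  assumes "Up \<inter> Um = {}" and "finite Up" and "finite Um"
    and "1 \<le> card Up + card Um"
    and "lattice_simply_connected (Up \<union> Um)"
    and "p \<ge> 2"
    and "soliton_branch p Up Um \<phi>"
  shows "\<exists>\<epsilon>0>0. \<exists>\<delta>>0. \<exists>C>0. \<forall>\<epsilon>\<in>{0<..<\<epsilon>0}.
    let H = dnls_operator p \<epsilon> (\<phi> \<epsilon>); P = {z \<in> ball 0 \<delta>. resolvent_pole H z} in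
      (\<forall>\<Omega>. \<Omega> \<notin> ball 0 \<delta> \<union> spectral_bands \<epsilon> \<longrightarrow> \<Omega> \<in> resolvent_set H) \<and>
      ball 0 \<delta> - P \<subseteq> resolvent_set H \<and>
      finite P \<and> (\<forall>z\<in>P. finite_alg_mult H z) \<and>
      (\<Sum>z\<in>P. alg_mult H z) = 2 * (card Up + card Um) \<and>
      (\<forall>\<Omega>\<in>spectral_bands \<epsilon>. \<forall>\<sigma>\<in>{1, -1}.
         boundary_limits_exist H \<sigma> \<Omega> \<and>
         op_norm_le (lq2_space 1 1) (lq2_norm 1 1) linf2_space linf2_norm
           (boundary_resolvent H \<sigma> \<Omega>) (C / \<epsilon>))"
proof -
  define a b where "a = Min (Up \<union> Um)" and "b = Max (Up \<union> Um)"
  have fin: "finite (Up \<union> Um)" and ne: "Up \<union> Um \<noteq> {}" using assms by auto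
  have U: "Up \<union> Um = {a..b}"
    unfolding a_def b_def by (rule lattice_simply_connected_interval[OF assms(5) fin ne])
  have ab: "a \<le> b" using U ne by auto
  have card: "card Up + card Um = card {a..b}"
    using card_Un_disjoint[OF assms(2,3,1)] U by simp
  have "1 \<le> p" using assms(6) by simp
  from soliton_estimates[OF this assms(1) U assms(7)]
  obtain \<epsilon>1 c where e1: "\<epsilon>1 > 0" "c > 0" and est: "\<And>\<epsilon>. 0 < \<epsilon> \<Longrightarrow> \<epsilon> < \<epsilon>1 \<Longrightarrow>
    (\<forall>n. a \<le> n \<longrightarrow> n \<le> b \<longrightarrow> \<bar>\<phi> \<epsilon> n ^ (2 * p) - 1\<bar> \<le> c * \<epsilon>) \<and>
    (\<forall>k::nat. \<bar>\<phi> \<epsilon> (b + 1 + int k) ^ (2 * p)\<bar> \<le> c * \<epsilon>\<^sup>2 * (1/2) ^ k) \<and>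
    (\<forall>k::nat. \<bar>\<phi> \<epsilon> (a - 1 - int k) ^ (2 * p)\<bar> \<le> c * \<epsilon>\<^sup>2 * (1/2) ^ k)"
    by blast
  \<comment> \<open>\<open>q1\<close> and \<open>q2\<close> are the coefficients of
    \<open>\<epsilon>\<close> in \<open>small\<close> and \<open>small_graph\<close>; both hold once
    \<open>(q1 + q2) * \<epsilon> \<le> 1/16\<close>.\<close>
  define q1 where "q1 = (8 * real p + 2) * (4 + c * (1 + 2 * real p))"
  define q2 where "q2 = 2 * real (card {a..b}) * (4 + c * (1 + 2 * real p)) * (1 + 32 * (real p +
      1))"
  have "0 < 4 + c * (1 + 2 * real p)" using e1(2) by (simp add: add_pos_nonneg)
  then have q: "0 < q1" "0 \<le> q2" by (simp_all add: q1_def q2_def)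
  define \<epsilon>0 where "\<epsilon>0 = min \<epsilon>1 (1 / (16 * (q1 + q2)))"
  have e0: "\<epsilon>0 > 0" using e1 q by (simp add: \<epsilon>0_def)
  \<comment> \<open>The constant depends only on the position of the excited interval, so it can be
    fixed before \<open>\<epsilon>\<close>.\<close>
  define C where "C = 4 * (1 + \<bar>real_of_int a\<bar> + \<bar>real_of_int b\<bar>)"
  have C: "C > 0" by (simp add: C_def)
  have "let H = dnls_operator p \<epsilon> (\<phi> \<epsilon>); P = {z \<in> ball 0 (1/2). resolvent_pole H z} in
      (\<forall>\<Omega>. \<Omega> \<notin> ball 0 (1/2) \<union> spectral_bands \<epsilon> \<longrightarrow> \<Omega> \<in> resolvent_set H) \<and>
      ball 0 (1/2) - P \<subseteq> resolvent_set H \<and>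
      finite P \<and> (\<forall>z\<in>P. finite_alg_mult H z) \<and>
      (\<Sum>z\<in>P. alg_mult H z) = 2 * (card Up + card Um) \<and>
      (\<forall>\<Omega>\<in>spectral_bands \<epsilon>. \<forall>\<sigma>\<in>{1, -1}.
         boundary_limits_exist H \<sigma> \<Omega> \<and>
         op_norm_le (lq2_space 1 1) (lq2_norm 1 1) linf2_space linf2_norm
           (boundary_resolvent H \<sigma> \<Omega>) (C / \<epsilon>))"
    if "\<epsilon> \<in> {0<..<\<epsilon>0}" for \<epsilon>
  proof -
    have eps: "0 < \<epsilon>" "\<epsilon> < \<epsilon>1" "\<epsilon> < 1 / (16 * (q1 + q2))" using that by (auto simp: \<epsilon>0_def)
    have q12: "(q1 + q2) * \<epsilon> \<le> 1/16"
      using eps(3) q by (simp add: pos_less_divide_eq algebra_simps)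
    moreover have "0 \<le> q1 * \<epsilon>" "0 \<le> q2 * \<epsilon>" using q eps(1) by simp_all
    ultimately have s1: "q1 * \<epsilon> \<le> 1/16" and s2: "q2 * \<epsilon> \<le> 1/16"
      unfolding distrib_right by linarith+
    interpret dnls_graph a b p \<epsilon> c "\<lambda>n. \<phi> \<epsilon> n ^ (2 * p)"
    proof
      show "(8 * real p + 2) * (4 + c * (1 + 2 * real p)) * \<epsilon> \<le> 1/8" using s1 by (simp add: q1_def)
      show "2 * real (card {a..b}) * ((4 + c * (1 + 2 * real p)) * \<epsilon>) * (1 + 32 * (real p + 1)) \<le>
          1/16"
        using s2 by (simp add: q2_def mult_ac)
    qed (use ab eps(1) e1(2) est[OF eps(1,2)] in blast)+
    have A: "state (dnls_operator p \<epsilon> (\<phi> \<epsilon>) x) = H (state x)" for x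
    proof
      fix i show "state (dnls_operator p \<epsilon> (\<phi> \<epsilon>) x) i = H (state x) i"
        unfolding H_def by (cases i; cases "snd i")
          (simp_all add: state_def dnls_operator_def Let_def discrete_laplacian_def algebra_simps)
    qed
    have bnd: "boundary_limits_exist (dnls_operator p \<epsilon> (\<phi> \<epsilon>)) \<sigma> \<Omega> \<and>
         op_norm_le (lq2_space 1 1) (lq2_norm 1 1) linf2_space linf2_norm
           (boundary_resolvent (dnls_operator p \<epsilon> (\<phi> \<epsilon>)) \<sigma> \<Omega>) (C / \<epsilon>)"
      if \<Omega>: "\<Omega> \<in> spectral_bands \<epsilon>" and \<sigma>: "\<sigma> \<in> {1, -1}" for \<Omega> and \<sigma> :: real
    proof -
      obtain \<omega> where "\<Omega> = of_real \<omega>" using \<Omega> by (auto simp: spectral_bands_def)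
      moreover have "\<sigma> \<noteq> 0" using \<sigma> by auto
      ultimately show ?thesis
        using boundary_resolvent_bound[OF A, of \<omega> \<sigma>] \<Omega> unfolding C_def by blast
    qed
    show ?thesis
      unfolding Let_def card using dnls_spectrum[OF A] bnd by blast
  qed
  moreover have "(0::real) < 1/2" by simp
  ultimately show ?thesis using e0 C by blast
qed

end
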